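(* For every real $\epsilon$ with $0<\epsilon<\frac15$, let $$ \delta(\epsilon)=\min\left(\frac{\epsilon}{192(1-\epsilon)},\frac{25\epsilon}{196(3+5\epsilon)}\right). $$ Then there is a constant $C(\epsilon)>0$ depending only on $\epsilon$ such that for every real $X>1$, every prime number $q$ with $X^{\epsilon}\leq q\leq X^{\frac{2}{5}-\epsilon}$, and every integer $a$ with $(a,q)=1$, $$ |E(X,q,a)| \leq C(\epsilon) \left(\frac{X}{q}\right)^{\frac{1}{2}-\delta(\epsilon)}. $$
   Context: Let $\mu$ be the Möbius function, so $\mu^2$ is the indicator function of squarefree positive integers, and let $\varphi$ be Euler's totient function. For real $X>0$, an integer $q\geq 1$ and an integer $a$ coprime to $q$, define $$ E(X,q,a):=\sum_{\substack{n\leq X\\ n\equiv a \pmod q}}\mu^2(n)-\frac{1}{\varphi(q)}\sum_{\substack{n\leq X\\ (n,q)=1}}\mu^2(n), $$ where $n$ runs over positive integers. *)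

theory Defs
  imports
    "HOL-Analysis.Analysis"
    "HOL-Number_Theory.Number_Theory"
    "HOL-Computational_Algebra.Squarefree"
begin

definition moebius :: "nat \<Rightarrow> int" where
  "moebius n = (if squarefree n then (- 1) ^ card (prime_factors n) else 0)"

lemma moebius_squared: "(moebius n)\<^sup>2 = (if squarefree n then 1 else 0)"
  by (simp add: moebius_def flip: power_mult)

definition sqfree_error :: "real \<Rightarrow> nat \<Rightarrow> int \<Rightarrow> real" where
  "sqfree_error X q a =
     (\<Sum>n\<in>{n :: nat. 0 < n \<and> real n \<le> X \<and> [int n = a] (mod int q)}. real_of_int ((moebius n)\<^sup>2))
     - 1 / real (totient q) *
       (\<Sum>n\<in>{n :: nat. 0 < n \<and> real n \<le> X \<and> coprime n q}. real_of_int ((moebius n)\<^sup>2))"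

(* The index sets in sqfree_error are finite, so no sum collapses to 0 by convention. *)
lemma finite_sqfree_error_index: "finite {n :: nat. 0 < n \<and> real n \<le> X \<and> P n}"
  by (rule finite_subset[of _ "{..nat \<lfloor>X\<rfloor>}"]) (auto simp: le_nat_floor)

definition delta_exp :: "real \<Rightarrow> real" where
  "delta_exp \<epsilon> = min (\<epsilon> / (192 * (1 - \<epsilon>))) (25 * \<epsilon> / (196 * (3 + 5 * \<epsilon>)))"

end

theory Submission
  imports Defs "HOL-Library.Real_Mod"
begin

text \<open>
  Write \<open>\<mu>\<^sup>2(n)\<close> as the sum of \<open>\<mu>(d)\<close> over \<open>d\<^sup>2 | n\<close> and put \<open>D\<^sub>0 = sqrt (X / q)\<close>. Moduli \<open>d\<close> below
  \<open>D\<^sub>0 / z\<close> contribute \<open>O(D\<^sub>0 / z)\<close> trivially, and for \<open>d > D\<^sub>0 z\<close> one counts the solutions of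
  \<open>d\<^sup>2 m \<equiv> a\<close> in boxes. In the window between, \<open>d\<close> is cut into short intervals on which \<open>X / d\<^sup>2\<close> is
  almost constant, and everything reduces to a power saving in \<open>\<Sum> \<mu>(d) e(c d\<^sup>-\<^sup>2 / q)\<close> over
  \<open>d \<le> D\<close>, for \<open>D\<close> slightly larger than \<open>q\<^bsup>3/4\<^esup>\<close>.

  For the last sum Vaughan's identity leaves sums over intervals and bilinear sums. Individual sums
  over intervals are bounded by completion, where the complete sums satisfy a bound \<open>O(q\<^bsup>3/4\<^esup>)\<close>
  obtained in the manner of Kloosterman from a fourth moment and the dilation \<open>x \<mapsto> \<lambda>x\<close>, so that
  Weil's bound is not needed. After the Cauchy--Schwarz inequality the bilinear sums become averages
  over \<open>c\<close> of \<open>|\<Sum> e(c m\<^sup>-\<^sup>2 / q)|\<close>, and for short ranges of \<open>m\<close> they are treated by the shift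
  \<open>m \<mapsto> m + a b\<close>: since \<open>e(c (m + a b)\<^sup>-\<^sup>2 / q)\<close> only depends on \<open>s = c a\<^sup>-\<^sup>2\<close> and \<open>r + b\<close> with
  \<open>r = m / a\<close>, Hoelder's inequality leads to a 16th moment over all residues \<open>r\<close> and \<open>s\<close>, and
  orthogonality in \<open>s\<close> turns this moment into a count of zeros of rational functions in \<open>r\<close>.
\<close>

section \<open>Additive characters and inverse squares modulo a prime\<close>

text \<open>The moduli that matter have size \<open>sqrt (X / q)\<close>, and this exceeds q^(3/4)
  exactly when q is below X^(2/5); the margin \<open>\<epsilon>\<close> in the exponent pays for
  every saving. The threshold 3/4 comes from the bound for complete sums. In a bilinear sum with
  \<open>m * n\<close> near q^(3/4) both variables may lie below the threshold, so that completion
  for a single pair \<open>n\<close>, \<open>n'\<close> is trivial and only an average over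
  \<open>n'\<close> can help. This fixes the order of the moment. Let \<open>M\<close> bound
  \<open>m\<close>, let \<open>N\<close> be the number of \<open>n'\<close>, with
  \<open>N \<le> M\<close> and \<open>M * N\<close> about q^(3/4). In a moment of order
  \<open>2 * l\<close> the identically vanishing rational functions and the others balance at
  \<open>B\<close> = q^(1/l). The edge effects of the shift allow \<open>A\<close> up to about
  \<open>M / B\<close>, and Hoelder's inequality saves once \<open>A * M * N\<close> exceeds
  \<open>q\<close>. Since \<open>M\<close> is at least q^(3/8), the product
  \<open>M^2 * N / B\<close> is at least q^(9/8 - 1/l), so \<open>l = 8\<close> is the first value
  that suffices: hence 16th moments, and q^(1/8) as the basic unit \<open>\<rho>\<close>. Powers of
  \<open>w\<close> supply the slack at this borderline.\<close>

lemma card_roots_mod_prime_le: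
  fixes f :: "int poly" and p :: int
  assumes "prime p" "\<not> p dvd poly f x0"
  shows "card {x \<in> {0..<p}. p dvd poly f x} \<le> degree f"
  using assms(2)
proof (induction "degree f" arbitrary: f)
  case 0
  then obtain c where "f = [:c:]" by (metis degree_eq_zeroE)
  with 0 have "\<not> p dvd c" by simp
  with \<open>f = [:c:]\<close> show ?case by simp
next
  case (Suc n)
  show ?case
  proof (cases "{x \<in> {0..<p}. p dvd poly f x} = {}")
    case True
    then show ?thesis by (simp only: card.empty le0)
  next
    case False
    then obtain a where a: "a \<in> {0..<p}" "p dvd poly f a" by auto
    define g where "g = synthetic_div f a"
    have f: "poly f x = (x - a) * poly g x + poly f a" for x
    proof -
      have "[:- a, 1:] * g + [:poly f a:] = f"
        unfolding g_def by (rule synthetic_div_correct')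
      then have "poly f x = poly ([:- a, 1:] * g + [:poly f a:]) x" by simp
      also have "\<dots> = (x - a) * poly g x + poly f a" by (simp add: algebra_simps)
      finally show ?thesis .
    qed
    have dg: "degree g = n" unfolding g_def by (simp add: degree_synthetic_div Suc(2)[symmetric])
    \<comment> \<open>Nonvanishing at the point \<open>x0\<close> stands for "not the zero
      polynomial modulo \<open>p\<close>"; it passes to the quotient, so the induction stays over
      the integers.\<close>
    have "\<not> p dvd poly g x0"
      using f[of x0] a Suc(3) by (metis dvd_add dvd_mult)
    then have IH: "card {x \<in> {0..<p}. p dvd poly g x} \<le> degree g"
      using Suc(1)[of g] dg by simp
    have "{x \<in> {0..<p}. p dvd poly f x} \<subseteq> insert a {x \<in> {0..<p}. p dvd poly g x}"
    proof
      fix x assume x: "x \<in> {x \<in> {0..<p}. p dvd poly f x}"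
      then have "p dvd (x - a) * poly g x" using f[of x] a(2) by (metis (mono_tags, lifting) mem_Collect_eq dvd_add_left_iff)
      then have "p dvd x - a \<or> p dvd poly g x" using assms(1) prime_dvd_mult_iff by blast
      moreover have "x = a" if "p dvd x - a"
      proof -
        have "x mod p = a mod p" using that by (simp add: mod_eq_dvd_iff)
        then show ?thesis using x a(1) by simp
      qed
      ultimately show "x \<in> insert a {x \<in> {0..<p}. p dvd poly g x}" using x by auto
    qed
    then have "card {x \<in> {0..<p}. p dvd poly f x} \<le> card (insert a {x \<in> {0..<p}. p dvd poly g x})"
      by (intro card_mono finite.insertI finite_subset[OF _ finite_atLeastLessThan_int[of 0 p]]) auto
    also have "\<dots> \<le> Suc (card {x \<in> {0..<p}. p dvd poly g x})" by (rule card_insert_le_m1) auto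
    also have "\<dots> \<le> degree f" using IH dg Suc(2) by simp
    finally show ?thesis .
  qed
qed

lemma norm_sum_square_eq:
  fixes g :: "'a \<Rightarrow> complex"
  shows "complex_of_real ((norm (\<Sum>t\<in>T. g t))\<^sup>2) = (\<Sum>(t, t')\<in>T \<times> T. g t * cnj (g t'))"
  by (simp add: complex_norm_square cnj_sum sum_product sum.cartesian_product
      del: of_real_power)

text \<open>The primes 2 and 3 are excluded because the root count in
  \<open>card_isq_plus_isq\<close> needs 24 to be invertible modulo \<open>q\<close>.\<close>

locale modulus =
  fixes q :: nat
  assumes prime_q: "prime q" and q_gt_3: "3 < q"
begin

abbreviation residues :: "int set" where "residues \<equiv> {0..<int q}"

definition ee :: "int \<Rightarrow> complex" where
  "ee n = cis (2 * pi * real_of_int n / real q)"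

lemma q_pos: "0 < q" using q_gt_3 by simp

lemma prime_int_q: "prime (int q)" using prime_q by simp

lemma ee_0 [simp]: "ee 0 = 1" by (simp add: ee_def)

lemma ee_add: "ee (m + n) = ee m * ee n"
  by (simp add: ee_def cis_mult add_divide_distrib distrib_left)

lemma norm_ee [simp]: "norm (ee n) = 1" by (simp add: ee_def)

lemma cnj_ee: "cnj (ee n) = ee (- n)" by (simp add: ee_def cis_cnj)

lemma ee_minus: "ee (m - n) = ee m * cnj (ee n)"
  using ee_add[of m "- n"] by (simp add: cnj_ee)

lemma ee_mult_nat: "ee (int k * n) = ee n ^ k"
  by (induction k) (simp_all add: algebra_simps ee_add)

lemma ee_sum: "finite A \<Longrightarrow> ee (\<Sum>i\<in>A. f i) = (\<Prod>i\<in>A. ee (f i))"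
  by (induction A rule: finite_induct) (simp_all add: ee_add)

lemma ee_eq_1_iff: "ee n = 1 \<longleftrightarrow> int q dvd n"
proof -
  have "ee n = 1 \<longleftrightarrow> (\<exists>k. 2 * pi * real_of_int n / real q = of_int k * (2 * pi))"
    unfolding ee_def by (rule cis_eq_1_iff)
  also have "\<dots> \<longleftrightarrow> (\<exists>k. real_of_int n = real_of_int (int q * k))"
    using q_pos by (simp add: field_simps)
  also have "\<dots> \<longleftrightarrow> int q dvd n" unfolding of_int_eq_iff by (auto simp: dvd_def)
  finally show ?thesis .
qed

lemma ee_cong:
  assumes "[m = n] (mod int q)"
  shows "ee m = ee n"
proof -
  have "ee (m - n) = 1" using assms by (simp add: ee_eq_1_iff cong_iff_dvd_diff)
  then show ?thesis using ee_add[of "m - n" n] by simp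
qed

lemma sum_residues: "(\<Sum>x\<in>residues. f x) = (\<Sum>x<q. f (int x))"
proof -
  have "residues = int ` {..<q}"
    using image_int_atLeastLessThan[of 0 q] by (simp add: atLeast0LessThan)
  then show ?thesis by (simp add: sum.reindex)
qed

lemma sum_ee: "(\<Sum>s\<in>residues. ee (s * n)) = (if int q dvd n then of_nat q else 0)"
proof -
  have "(\<Sum>s\<in>residues. ee (s * n)) = (\<Sum>s<q. ee n ^ s)"
    by (simp add: sum_residues ee_mult_nat)
  also have "\<dots> = (if int q dvd n then of_nat q else 0)"
  proof (cases "int q dvd n")
    case True
    then have "ee n = 1" by (simp add: ee_eq_1_iff)
    with True show ?thesis by simp
  next
    case False
    then have ne: "ee n \<noteq> 1" by (simp add: ee_eq_1_iff)
    have "ee n ^ q = ee (int q * n)" by (simp add: ee_mult_nat)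
    also have "\<dots> = 1" by (simp add: ee_eq_1_iff)
    finally show ?thesis using geometric_sum[OF ne, of q] False by simp
  qed
  finally show ?thesis .
qed

lemma sum_residues_norm_square:
  assumes "finite T"
  shows "(\<Sum>s\<in>residues. (norm (\<Sum>t\<in>T. ee (s * f t)))\<^sup>2)
    = real q * real (card {(t, t') \<in> T \<times> T. [f t = f t'] (mod int q)})"
proof -
  have "complex_of_real (\<Sum>s\<in>residues. (norm (\<Sum>t\<in>T. ee (s * f t)))\<^sup>2)
    = (\<Sum>s\<in>residues. \<Sum>(t, t')\<in>T \<times> T. ee (s * (f t - f t')))"
    unfolding of_real_sum norm_sum_square_eq
    by (simp add: ee_minus algebra_simps)
  also have "\<dots> = (\<Sum>(t, t')\<in>T \<times> T. \<Sum>s\<in>residues. ee (s * (f t - f t')))"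
    by (subst sum.swap) (simp add: case_prod_unfold)
  also have "\<dots> = (\<Sum>(t, t')\<in>T \<times> T. if [f t = f t'] (mod int q) then of_nat q else 0)"
    unfolding sum_ee cong_iff_dvd_diff ..
  also have "\<dots> = (\<Sum>p\<in>T \<times> T. if p \<in> {(t, t') \<in> T \<times> T. [f t = f t'] (mod int q)} then of_nat q else 0)"
    by (intro sum.cong refl) (auto split: if_splits)
  also have "\<dots> = (\<Sum>p\<in>{(t, t') \<in> T \<times> T. [f t = f t'] (mod int q)}. of_nat q)"
    using assms by (intro sum.mono_neutral_cong_right) auto
  also have "\<dots> = complex_of_real (real q * real (card {(t, t') \<in> T \<times> T. [f t = f t'] (mod int q)}))"
    by simp
  finally show ?thesis by (simp only: of_real_eq_iff)
qed

lemma sum_residues2_norm_square: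
  assumes "finite T"
  shows "(\<Sum>u\<in>residues. \<Sum>v\<in>residues. (norm (\<Sum>t\<in>T. ee (u * f t + v * g t)))\<^sup>2)
    = (real q)\<^sup>2 * real (card {(t, t') \<in> T \<times> T. [f t = f t'] (mod int q) \<and> [g t = g t'] (mod int q)})"
proof -
  let ?P = "{(t, t') \<in> T \<times> T. [f t = f t'] (mod int q) \<and> [g t = g t'] (mod int q)}"
  have "complex_of_real (\<Sum>u\<in>residues. \<Sum>v\<in>residues. (norm (\<Sum>t\<in>T. ee (u * f t + v * g t)))\<^sup>2)
    = (\<Sum>u\<in>residues. \<Sum>v\<in>residues. \<Sum>(t, t')\<in>T \<times> T. ee (u * (f t - f t')) * ee (v * (g t - g t')))"
    unfolding of_real_sum norm_sum_square_eq
    by (intro sum.cong refl) (auto simp flip: ee_add ee_minus simp: cnj_ee algebra_simps)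
  also have "\<dots> = (\<Sum>(t, t')\<in>T \<times> T. (\<Sum>u\<in>residues. ee (u * (f t - f t'))) * (\<Sum>v\<in>residues. ee (v * (g t - g t'))))"
  proof -
    have "(\<Sum>u\<in>residues. \<Sum>v\<in>residues. \<Sum>(t, t')\<in>T \<times> T. ee (u * (f t - f t')) * ee (v * (g t - g t')))
      = (\<Sum>u\<in>residues. \<Sum>(t, t')\<in>T \<times> T. \<Sum>v\<in>residues. ee (u * (f t - f t')) * ee (v * (g t - g t')))"
      by (subst sum.swap) (simp add: case_prod_unfold)
    also have "\<dots> = (\<Sum>(t, t')\<in>T \<times> T. \<Sum>u\<in>residues. \<Sum>v\<in>residues. ee (u * (f t - f t')) * ee (v * (g t - g t')))"
      by (subst sum.swap) (simp add: case_prod_unfold)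
    finally show ?thesis by (simp add: sum_product)
  qed
  also have "\<dots> = (\<Sum>p\<in>T \<times> T. if p \<in> ?P then (of_nat q)\<^sup>2 else 0)"
    by (intro sum.cong refl) (auto simp: sum_ee cong_iff_dvd_diff power2_eq_square split: if_splits)
  also have "\<dots> = (\<Sum>p\<in>?P. (of_nat q)\<^sup>2)"
    using assms by (intro sum.mono_neutral_cong_right) auto
  also have "\<dots> = complex_of_real ((real q)\<^sup>2 * real (card ?P))"
    by simp
  finally show ?thesis by (simp only: of_real_eq_iff)
qed

text \<open>
  By Fermat's theorem this power represents \<open>x\<^sup>-\<^sup>2\<close> modulo \<open>q\<close>. Being a power, it is multiplicative on
  all integers, and it vanishes modulo \<open>q\<close> exactly when \<open>x\<close> does.
\<close>

definition isq :: "int \<Rightarrow> int" where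
  "isq x = x ^ (2 * (q - 2))"

lemma isq_mult: "isq (x * y) = isq x * isq y"
  by (simp add: isq_def power_mult_distrib)

lemma isq_cong: "[x = y] (mod int q) \<Longrightarrow> [isq x = isq y] (mod int q)"
  unfolding isq_def by (rule cong_pow)

lemma fermat_int: "\<not> int q dvd x \<Longrightarrow> [x ^ (q - 1) = 1] (mod int q)"
proof -
  assume x: "\<not> int q dvd x"
  define n where "n = nat (x mod int q)"
  have n: "int n = x mod int q" using q_pos by (simp add: n_def)
  have "\<not> q dvd n" using x n by (metis dvd_mod_iff dvd_refl int_dvd_int_iff)
  then have "[n ^ (q - 1) = 1] (mod q)" using fermat_theorem prime_q by blast
  then have "[int n ^ (q - 1) = 1] (mod int q)" by (metis cong_int_iff of_nat_1 of_nat_power)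
  moreover have "[int n ^ (q - 1) = x ^ (q - 1)] (mod int q)"
    by (rule cong_pow) (simp add: n cong_def)
  ultimately show "[x ^ (q - 1) = 1] (mod int q)" by (metis cong_sym cong_trans)
qed

lemma isq_inverse:
  assumes "\<not> int q dvd x"
  shows "[x\<^sup>2 * isq x = 1] (mod int q)"
proof -
  obtain k where k: "q = k + 2" using q_gt_3 by (intro that[of "q - 2"]) simp
  have "isq x = x ^ (2 * k)" "x ^ (q - 1) = x * x ^ k"
    unfolding isq_def using k by simp_all
  then have "x\<^sup>2 * isq x = (x ^ (q - 1))\<^sup>2"
    by (simp add: power_mult_distrib power_even_eq)
  then show ?thesis using cong_pow[OF fermat_int[OF assms], of 2] by simp
qed

lemma dvd_isq_iff: "int q dvd isq x \<longleftrightarrow> int q dvd x"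
  unfolding isq_def using q_gt_3 prime_int_q by (simp add: prime_dvd_power_iff)

lemma cong_cancel_unit:
  assumes "\<not> int q dvd c" "[c * x = c * y] (mod int q)"
  shows "[x = y] (mod int q)"
proof -
  have "coprime c (int q)"
    using assms(1) prime_int_q by (metis coprime_commute prime_imp_coprime)
  then show ?thesis using assms(2) by (simp add: cong_mult_lcancel)
qed

lemma isq_eqD:
  assumes "\<not> int q dvd x" "\<not> int q dvd y" "[isq x = isq y] (mod int q)"
  shows "[x = y] (mod int q) \<or> [x = - y] (mod int q)"
proof -
  have "[isq x * x\<^sup>2 = 1] (mod int q)" "[isq y * y\<^sup>2 = 1] (mod int q)"
    using isq_inverse assms by (simp_all add: mult.commute)
  moreover have "[isq x * y\<^sup>2 = isq y * y\<^sup>2] (mod int q)"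
    by (rule cong_mult[OF assms(3) cong_refl])
  ultimately have "[isq x * x\<^sup>2 = isq x * y\<^sup>2] (mod int q)"
    by (metis cong_sym cong_trans)
  then have "[x\<^sup>2 = y\<^sup>2] (mod int q)"
    using assms(1) cong_cancel_unit dvd_isq_iff by blast
  then have "int q dvd (x - y) * (x + y)"
    by (simp add: cong_iff_dvd_diff power2_eq_square algebra_simps)
  then have "int q dvd x - y \<or> int q dvd x + y" using prime_int_q prime_dvd_mult_iff by blast
  then show ?thesis by (simp add: cong_iff_dvd_diff)
qed

text \<open>At multiples of \<open>q\<close>, where the inverse square has a pole, the power
  \<open>isq\<close> alone would produce the value 1. The value 0 lets sums run over whole intervals
  and makes these terms drop out.\<close>

definition kern :: "int \<Rightarrow> int \<Rightarrow> complex" where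
  "kern c x = (if int q dvd x then 0 else ee (c * isq x))"

lemma norm_kern_le: "norm (kern c x) \<le> 1" by (simp add: kern_def)

lemma kern_cong:
  assumes "[c = c'] (mod int q)" "[x = x'] (mod int q)"
  shows "kern c x = kern c' x'"
proof -
  have "int q dvd x \<longleftrightarrow> int q dvd x'" using assms(2) by (rule cong_dvd_iff)
  moreover have "ee (c * isq x) = ee (c' * isq x')"
    by (intro ee_cong cong_mult assms isq_cong)
  ultimately show ?thesis by (simp add: kern_def)
qed

lemma kern_mult: "\<not> int q dvd y \<Longrightarrow> kern c (y * x) = kern (c * isq y) x"
  using prime_int_q by (simp add: kern_def isq_mult prime_dvd_mult_iff mult.assoc)

end

section \<open>Complete and incomplete exponential sums\<close>

lemma sum_fiber_le:
  fixes g :: "'b \<Rightarrow> real"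
  assumes "finite A" "finite B" "\<phi> ` A \<subseteq> B" "\<And>b. b \<in> B \<Longrightarrow> g b \<ge> 0"
    and "\<And>b. b \<in> B \<Longrightarrow> card {a \<in> A. \<phi> a = b} \<le> n"
  shows "(\<Sum>a\<in>A. g (\<phi> a)) \<le> real n * (\<Sum>b\<in>B. g b)"
proof -
  have "(\<Sum>a\<in>A. g (\<phi> a)) = (\<Sum>b\<in>B. \<Sum>a\<in>{a \<in> A. \<phi> a = b}. g (\<phi> a))"
    by (rule sum.group[symmetric, OF assms(1-3)])
  also have "\<dots> = (\<Sum>b\<in>B. real (card {a \<in> A. \<phi> a = b}) * g b)"
    by (intro sum.cong refl) simp
  also have "\<dots> \<le> (\<Sum>b\<in>B. real n * g b)"
    using assms by (intro sum_mono mult_right_mono) auto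
  finally show ?thesis by (simp add: sum_distrib_left)
qed

lemma sum_inverse_le_ln:
  assumes "n \<ge> 1"
  shows "(\<Sum>k = 1..n. 1 / real k) \<le> 1 + ln (real n)"
  using assms
proof (induction n rule: dec_induct)
  case base
  then show ?case by simp
next
  case (step n)
  have "ln (real n / real (Suc n)) \<le> real n / real (Suc n) - 1"
    using step by (intro ln_le_minus_one) simp
  then have "1 / real (Suc n) \<le> ln (real (Suc n)) - ln (real n)"
    using step by (simp add: ln_div field_simps)
  then show ?case using step by simp
qed

text \<open>A weak form of Jordan's inequality: \<open>sin t\<close> is
  \<open>2 * sin (t / 2) * cos (t / 2)\<close>, and on the halved range the cosine is at least
  \<open>sqrt 2 / 2\<close>, which by the mean value theorem also bounds \<open>sin (t / 2)\<close>
  from below.\<close>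

lemma sin_ge_half:
  fixes t :: real
  assumes "0 \<le> t" "t \<le> pi / 2"
  shows "t / 2 \<le> sin t"
proof (cases "t = 0")
  case False
  then have t: "0 < t / 2" "t / 2 \<le> pi / 4" using assms by auto
  obtain x where x: "0 < x" "x < t / 2" "sin (t / 2) - sin 0 = (t / 2 - 0) * cos x"
    using MVT2[OF t(1), of sin cos] by (auto intro: DERIV_sin)
  have c: "sqrt 2 / 2 \<le> cos y" if "0 \<le> y" "y \<le> pi / 4" for y
    using cos_monotone_0_pi_le[of y "pi / 4"] that by (simp add: cos_45)
  have "(t / 2) * (sqrt 2 / 2) \<le> sin (t / 2)"
  proof -
    have "(t / 2) * (sqrt 2 / 2) \<le> (t / 2) * cos x" using x t by (intro mult_left_mono c) auto
    then show ?thesis using x(3) by simp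
  qed
  then have "((t / 2) * (sqrt 2 / 2)) * (sqrt 2 / 2) \<le> sin (t / 2) * cos (t / 2)"
    using t c[of "t / 2"] by (intro mult_mono) (auto intro!: sin_ge_zero)
  moreover have "sin t = 2 * sin (t / 2) * cos (t / 2)"
    using sin_double[of "t / 2"] by simp
  moreover have "t * sqrt 2 * sqrt 2 = 2 * t" by simp
  ultimately show ?thesis by simp
qed simp

lemma norm_one_minus_cis: "norm (1 - cis t) = 2 * \<bar>sin (t / 2)\<bar>"
proof -
  have "(norm (1 - cis t))\<^sup>2 = (1 - cos t)\<^sup>2 + (sin t)\<^sup>2"
    by (simp add: cmod_power2)
  also have "\<dots> = 2 - 2 * cos t"
    using sin_cos_squared_add[of t] by (simp add: power2_eq_square algebra_simps)
  also have "\<dots> = (2 * \<bar>sin (t / 2)\<bar>)\<^sup>2"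
    using cos_double_sin[of "t / 2"] by (simp add: power_mult_distrib)
  finally show ?thesis by (rule power2_eq_imp_eq) auto
qed

context modulus
begin

section \<open>Complete sums over inverse squares and their fourth moment\<close>

abbreviation units :: "int set" where "units \<equiv> {1..<int q}"

lemma not_dvd_units: "x \<in> units \<Longrightarrow> \<not> int q dvd x"
  using zdvd_not_zless[of x "int q"] by simp

lemma residues_cong_eq: "x \<in> residues \<Longrightarrow> y \<in> residues \<Longrightarrow> [x = y] (mod int q) \<Longrightarrow> x = y"
  by (simp add: cong_def)

lemma mod_in_units: "\<not> int q dvd x \<Longrightarrow> x mod int q \<in> units"
proof -
  assume "\<not> int q dvd x"
  then have "x mod int q \<noteq> 0" by (simp add: dvd_eq_mod_eq_0)
  moreover have "0 \<le> x mod int q" "x mod int q < int q" using q_pos by simp_all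
  ultimately show ?thesis by simp
qed

text \<open>A Kloosterman sum with the inverse square of \<open>x\<close> in place of the
  inverse.\<close>

definition csum :: "int \<Rightarrow> int \<Rightarrow> complex" where
  "csum c k = (\<Sum>x\<in>units. ee (c * isq x + k * x))"

lemma csum_cong: "[c = c'] (mod int q) \<Longrightarrow> [k = k'] (mod int q) \<Longrightarrow> csum c k = csum c' k'"
  unfolding csum_def by (rule sum.cong[OF refl], rule ee_cong) (intro cong_add cong_mult cong_refl; assumption)

text \<open>Multiplication by \<open>l\<close> permutes the units, and the factor moves into the
  parameters because \<open>isq\<close> is multiplicative.\<close>

lemma csum_dilate:
  assumes "l \<in> units"
  shows "csum (c * isq l) (k * l) = csum c k"
proof -
  have l: "\<not> int q dvd l" using assms by (rule not_dvd_units)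
  let ?f = "\<lambda>x. (l * x) mod int q"
  have inj: "inj_on ?f units"
  proof (rule inj_onI)
    fix x y assume xy: "x \<in> units" "y \<in> units" "?f x = ?f y"
    then have "[l * x = l * y] (mod int q)" by (simp add: cong_def)
    then have "[x = y] (mod int q)" by (rule cong_cancel_unit[OF l])
    with xy show "x = y" by (intro residues_cong_eq) auto
  qed
  have "?f ` units \<subseteq> units"
  proof (rule image_subsetI)
    fix x assume "x \<in> units"
    then have "\<not> int q dvd l * x" using l prime_int_q not_dvd_units prime_dvd_multD by blast
    then show "?f x \<in> units" by (rule mod_in_units)
  qed
  then have bij: "bij_betw ?f units units"
    using inj by (simp add: bij_betw_def endo_inj_surj)
  have "csum c k = (\<Sum>x\<in>units. ee (c * isq (?f x) + k * ?f x))"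
    unfolding csum_def by (rule sum.reindex_bij_betw[OF bij, symmetric])
  also have "\<dots> = (\<Sum>x\<in>units. ee ((c * isq l) * isq x + (k * l) * x))"
  proof (intro sum.cong refl ee_cong)
    fix x
    have "[?f x = l * x] (mod int q)" by (simp add: cong_def)
    then have "[c * isq (?f x) + k * ?f x = c * isq (l * x) + k * (l * x)] (mod int q)"
      by (intro cong_add cong_mult isq_cong cong_refl)
    then show "[c * isq (?f x) + k * ?f x = (c * isq l) * isq x + (k * l) * x] (mod int q)"
      by (simp add: isq_mult algebra_simps)
  qed
  finally show ?thesis by (simp add: csum_def)
qed

text \<open>Substituting \<open>x3 + x4 - x1\<close> for \<open>x2\<close> in the condition on
  inverse squares and clearing denominators makes \<open>x1\<close> a root of a polynomial of degree
  at most 4, and \<open>x1\<close> determines \<open>x2\<close>.\<close>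

lemma card_isq_plus_isq:
  assumes "x3 \<in> units" "x4 \<in> units"
  shows "card {(x1, x2) \<in> units \<times> units. [isq x1 + isq x2 = isq x3 + isq x4] (mod int q)
    \<and> [x1 + x2 = x3 + x4] (mod int q)} \<le> 4" (is "card ?A \<le> 4")
proof -
  define \<sigma> \<tau> where "\<sigma> = x3 + x4" and "\<tau> = isq x3 + isq x4"
  define P where "P = Polynomial.smult \<tau> ([:0, 1:]\<^sup>2 * [:\<sigma>, -1:]\<^sup>2) - [:0, 1:]\<^sup>2 - [:\<sigma>, -1:]\<^sup>2"
  have P: "poly P x = \<tau> * x\<^sup>2 * (\<sigma> - x)\<^sup>2 - x\<^sup>2 - (\<sigma> - x)\<^sup>2" for x
    by (simp add: P_def algebra_simps)
  have "degree ([:0, 1:]\<^sup>2 * [:\<sigma>, -1:]\<^sup>2 :: int poly) \<le> 4"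
    by (rule order.trans[OF degree_mult_le]) (simp add: degree_power_eq)
  then have deg: "degree P \<le> 4"
    unfolding P_def by (intro degree_diff_le order.trans[OF degree_smult_le]) (simp_all add: degree_power_eq)
  \<comment> \<open>The test point is 0, with value \<open>- \<sigma>\<^sup>2\<close>, unless
    \<open>\<sigma>\<close> vanishes modulo \<open>q\<close>. In that case \<open>x4\<close> is
    \<open>- x3\<close>, so \<open>\<tau> * x3\<^sup>2\<close> is 2 modulo \<open>q\<close>, and the
    point \<open>2 * x3\<close> gives \<open>24 * x3\<^sup>2\<close>.\<close>
  have nz: "\<exists>x0. \<not> int q dvd poly P x0"
  proof (cases "int q dvd \<sigma>")
    case False
    then have "\<not> int q dvd poly P 0" using prime_int_q by (simp add: P prime_dvd_power_iff)
    then show ?thesis ..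
  next
    case True
    then have x4: "[x4 = - x3] (mod int q)" by (simp add: \<sigma>_def cong_iff_dvd_diff add.commute)
    then have "[isq x4 = isq (- x3)] (mod int q)" by (rule isq_cong)
    then have "[isq x4 = isq x3] (mod int q)" by (simp add: isq_def)
    then have "[\<tau> = isq x3 + isq x3] (mod int q)" unfolding \<tau>_def by (intro cong_add cong_refl)
    then have "[\<tau> * x3\<^sup>2 = (isq x3 + isq x3) * x3\<^sup>2] (mod int q)" by (intro cong_mult cong_refl)
    moreover have "[(x3\<^sup>2 * isq x3) * 2 = 1 * 2] (mod int q)"
      using assms not_dvd_units by (intro cong_mult cong_refl isq_inverse) auto
    ultimately have t: "[\<tau> * x3\<^sup>2 = 2] (mod int q)"
      by (metis (no_types, lifting) cong_trans mult.commute mult_1 mult_2_right mult.assoc)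
    have s: "[\<sigma> = 0] (mod int q)" using True by (simp add: cong_0_iff)
    have "[poly P (2 * x3) = \<tau> * (2 * x3)\<^sup>2 * (0 - 2 * x3)\<^sup>2 - (2 * x3)\<^sup>2 - (0 - 2 * x3)\<^sup>2] (mod int q)"
      unfolding P by (intro cong_diff cong_mult cong_pow cong_refl s)
    also have "\<tau> * (2 * x3)\<^sup>2 * (0 - 2 * x3)\<^sup>2 - (2 * x3)\<^sup>2 - (0 - 2 * x3)\<^sup>2
      = (\<tau> * x3\<^sup>2) * (16 * x3\<^sup>2) - 8 * x3\<^sup>2" by (simp add: power2_eq_square algebra_simps)
    also have "[(\<tau> * x3\<^sup>2) * (16 * x3\<^sup>2) - 8 * x3\<^sup>2 = 2 * (16 * x3\<^sup>2) - 8 * x3\<^sup>2] (mod int q)"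
      by (intro cong_diff cong_mult cong_refl t)
    finally have c: "[poly P (2 * x3) = (2 * 2 * (2 * 3)) * x3\<^sup>2] (mod int q)" by simp
    have "\<not> int q dvd 2" "\<not> int q dvd 3" using q_gt_3 by (auto dest!: zdvd_imp_le)
    then have "\<not> int q dvd (2 * 2 * (2 * 3))" using prime_int_q prime_dvd_multD by blast
    then have "\<not> int q dvd (2 * 2 * (2 * 3)) * x3\<^sup>2"
      using not_dvd_units[OF assms(1)] prime_int_q prime_dvd_multD prime_dvd_power by blast
    then have "\<not> int q dvd poly P (2 * x3)" using c cong_dvd_iff by blast
    then show ?thesis ..
  qed
  have root: "int q dvd poly P x1 \<and> [x2 = \<sigma> - x1] (mod int q)" if "(x1, x2) \<in> ?A" for x1 x2
  proof
    have x: "\<not> int q dvd x1" "\<not> int q dvd x2" using that not_dvd_units by auto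
    have "[x1 + x2 = \<sigma>] (mod int q)" using that by (simp add: \<sigma>_def)
    then have "[x1 + x2 - x1 = \<sigma> - x1] (mod int q)" by (intro cong_diff cong_refl)
    then show s: "[x2 = \<sigma> - x1] (mod int q)" by simp
    have t: "[\<tau> = isq x1 + isq x2] (mod int q)" using that by (simp add: \<tau>_def cong_sym)
    have "[poly P x1 = (isq x1 + isq x2) * x1\<^sup>2 * x2\<^sup>2 - x1\<^sup>2 - x2\<^sup>2] (mod int q)"
      unfolding P by (intro cong_diff cong_mult cong_pow cong_refl t cong_sym[OF s])
    also have "(isq x1 + isq x2) * x1\<^sup>2 * x2\<^sup>2 - x1\<^sup>2 - x2\<^sup>2
       = (x1\<^sup>2 * isq x1) * x2\<^sup>2 + (x2\<^sup>2 * isq x2) * x1\<^sup>2 - x1\<^sup>2 - x2\<^sup>2"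
      by (simp add: algebra_simps)
    also have "[\<dots> = 1 * x2\<^sup>2 + 1 * x1\<^sup>2 - x1\<^sup>2 - x2\<^sup>2] (mod int q)"
      by (intro cong_diff cong_add cong_mult cong_refl isq_inverse x)
    finally show "int q dvd poly P x1" by (simp add: cong_0_iff)
  qed
  have "card ?A \<le> card {x \<in> residues. int q dvd poly P x}"
  proof (rule card_inj_on_le)
    show "inj_on fst ?A"
    proof (rule inj_onI)
      fix s t assume st: "s \<in> ?A" "t \<in> ?A" "fst s = fst t"
      obtain x1 x2 where s: "s = (x1, x2)" by (cases s)
      obtain y2 where t: "t = (x1, y2)" using st(3) s by (cases t) auto
      have "[x2 = y2] (mod int q)" using root[of x1 x2] root[of x1 y2] st s t by (metis cong_sym cong_trans)
      then show "s = t" using st s t residues_cong_eq[of x2 y2] by auto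
    qed
    show "fst ` ?A \<subseteq> {x \<in> residues. int q dvd poly P x}" using root by fastforce
    show "finite {x \<in> residues. int q dvd poly P x}"
      by (rule finite_subset[of _ residues]) auto
  qed
  also have "\<dots> \<le> degree P" using nz card_roots_mod_prime_le[OF prime_int_q] by blast
  finally show ?thesis using deg by simp
qed

text \<open>The square of \<open>csum\<close> is a sum over pairs of units, so orthogonality in
  \<open>u\<close> and \<open>v\<close> leaves the number of pairs of pairs with equal sums and
  equal sums of inverse squares. One pair is free, and the other then has at most 4 choices.\<close>

lemma csum_fourth_moment: "(\<Sum>u\<in>residues. \<Sum>v\<in>residues. norm (csum u v) ^ 4) \<le> 4 * real q ^ 4"
proof -
  let ?T = "units \<times> units"
  let ?f = "\<lambda>(x1, x2). isq x1 + isq x2" and ?g = "\<lambda>(x1, x2). x1 + x2 :: int"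
  have "norm (csum u v) ^ 4 = (norm (\<Sum>t\<in>?T. ee (u * ?f t + v * ?g t)))\<^sup>2" for u v
  proof -
    have "(csum u v)\<^sup>2 = (\<Sum>t\<in>?T. ee (u * ?f t + v * ?g t))"
      unfolding csum_def power2_eq_square sum_product sum.cartesian_product
      by (intro sum.cong refl) (auto simp flip: ee_add simp: algebra_simps)
    then have "(norm (\<Sum>t\<in>?T. ee (u * ?f t + v * ?g t)))\<^sup>2 = (norm ((csum u v)\<^sup>2))\<^sup>2" by simp
    then show ?thesis by (simp add: norm_power flip: power_mult)
  qed
  then have "(\<Sum>u\<in>residues. \<Sum>v\<in>residues. norm (csum u v) ^ 4)
    = (real q)\<^sup>2 * real (card {(t, t') \<in> ?T \<times> ?T. [?f t = ?f t'] (mod int q) \<and> [?g t = ?g t'] (mod int q)})"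
    using sum_residues2_norm_square[of ?T ?f ?g] by simp
  moreover have "real (card {(t, t') \<in> ?T \<times> ?T. [?f t = ?f t'] (mod int q) \<and> [?g t = ?g t'] (mod int q)}) \<le> 4 * (real q)\<^sup>2"
  proof -
    define S where "S = {(t, t') \<in> ?T \<times> ?T. [?f t = ?f t'] (mod int q) \<and> [?g t = ?g t'] (mod int q)}"
    define F where "F t' = {t \<in> ?T. [?f t = ?f t'] (mod int q) \<and> [?g t = ?g t'] (mod int q)}" for t'
    have "S
       = (\<lambda>(t', t). (t, t')) ` (SIGMA t':?T. F t')"
      by (auto simp: image_iff S_def F_def)
    then have "card S = card ((\<lambda>(t', t). (t, t')) ` (SIGMA t':?T. F t'))" by (rule arg_cong)
    moreover have "card ((\<lambda>(t', t). (t, t')) ` (SIGMA t':?T. F t')) = card (SIGMA t':?T. F t')"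
      by (rule card_image) (auto simp: inj_on_def)
    moreover have "card (SIGMA t':?T. F t') = (\<Sum>t'\<in>?T. card (F t'))"
      by (rule card_SigmaI) (auto simp: F_def intro: finite_subset[of _ ?T])
    moreover have "(\<Sum>t'\<in>?T. card (F t')) \<le> (\<Sum>t'\<in>?T. 4)"
    proof (rule sum_mono)
      fix t' assume "t' \<in> ?T"
      then obtain x3 x4 where t': "t' = (x3, x4)" "x3 \<in> units" "x4 \<in> units" by auto
      have "F t' = {(x1, x2) \<in> units \<times> units. [isq x1 + isq x2 = isq x3 + isq x4] (mod int q) \<and> [x1 + x2 = x3 + x4] (mod int q)}"
        using t' by (auto simp: F_def)
      then show "card (F t') \<le> 4"
        using card_isq_plus_isq[OF t'(2,3)] by simp
    qed
    moreover have "card units = q - 1" using q_pos by (simp add: nat_diff_distrib)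
    then have "(\<Sum>t'\<in>?T. 4) = 4 * (q - 1)\<^sup>2"
      unfolding sum_constant card_cartesian_product by (simp only: power2_eq_square mult.commute of_nat_id)
    moreover have "4 * (q - 1)\<^sup>2 \<le> 4 * q\<^sup>2" by (simp add: power_mono)
    ultimately have S: "card S \<le> 4 * q\<^sup>2"
      by linarith
    then have "real (card S) \<le> real (4 * q\<^sup>2)" by (rule of_nat_mono)
    then show ?thesis unfolding S_def by simp
  qed
  ultimately have "(\<Sum>u\<in>residues. \<Sum>v\<in>residues. norm (csum u v) ^ 4) \<le> (real q)\<^sup>2 * (4 * (real q)\<^sup>2)"
    by (simp only: mult_left_mono zero_le_power2)
  also have "(real q)\<^sup>2 * (4 * (real q)\<^sup>2) = 4 * real q ^ 4" by (simp flip: power_add)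
  finally show ?thesis .
qed

lemma norm_csum_le:
  assumes "\<not> int q dvd c"
  shows "norm (csum c k) \<le> 2 * real q powr (3 / 4)"
proof -
  \<comment> \<open>All dilates of \<open>(c, k)\<close> have the same sum, and they occupy at least \<open>(q - 1) / 2\<close> pairs in
    the fourth moment.\<close>
  define g where "g u = (\<Sum>v\<in>residues. norm (csum u v) ^ 4)" for u
  let ?\<phi> = "\<lambda>l. (c * isq l) mod int q"
  have "real (q - 1) * norm (csum c k) ^ 4 = (\<Sum>l\<in>units. norm (csum c k) ^ 4)" using q_pos by simp
  also have "\<dots> \<le> (\<Sum>l\<in>units. g (?\<phi> l))"
  proof (rule sum_mono)
    fix l assume "l \<in> units"
    then have "csum c k = csum (c * isq l) (k * l)" by (simp add: csum_dilate)
    also have "\<dots> = csum (?\<phi> l) ((k * l) mod int q)" by (intro csum_cong) (auto simp: cong_def)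
    finally have "norm (csum c k) ^ 4 = norm (csum (?\<phi> l) ((k * l) mod int q)) ^ 4" by simp
    also have "\<dots> \<le> g (?\<phi> l)" unfolding g_def using q_pos
      by (intro member_le_sum[of _ _ "\<lambda>v. norm (csum (?\<phi> l) v) ^ 4"]) auto
    finally show "norm (csum c k) ^ 4 \<le> g (?\<phi> l)" .
  qed
  also have "\<dots> \<le> real 2 * (\<Sum>u\<in>residues. g u)"
  proof (rule sum_fiber_le)
    show "?\<phi> ` units \<subseteq> residues" using q_pos by auto
    fix b
    show "card {l \<in> units. ?\<phi> l = b} \<le> 2"
    proof (cases "{l \<in> units. ?\<phi> l = b} = {}")
      case True
      then show ?thesis by (simp only: card.empty le0)
    next
      case False
      then obtain m where m: "m \<in> units" "?\<phi> m = b" by auto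
      have "{l \<in> units. ?\<phi> l = b} \<subseteq> {m, int q - m}"
      proof
        fix l assume l: "l \<in> {l \<in> units. ?\<phi> l = b}"
        then have "[c * isq l = c * isq m] (mod int q)" using m by (simp add: cong_def)
        then have "[isq l = isq m] (mod int q)" using assms cong_cancel_unit by blast
        then have "[l = m] (mod int q) \<or> [l = - m] (mod int q)"
          using l m not_dvd_units by (intro isq_eqD) auto
        then show "l \<in> {m, int q - m}"
        proof
          assume "[l = m] (mod int q)"
          then show ?thesis using l m residues_cong_eq[of l m] by auto
        next
          assume "[l = - m] (mod int q)"
          then have "[l = int q - m] (mod int q)"
            by (rule cong_trans) (simp add: cong_iff_dvd_diff)
          then show ?thesis using l m residues_cong_eq[of l "int q - m"] by auto
        qed
      qed
      then have "card {l \<in> units. ?\<phi> l = b} \<le> card {m, int q - m}" by (intro card_mono) auto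
      also have "\<dots> \<le> 2" by (simp add: card_insert_if)
      finally show ?thesis .
    qed
  qed (auto simp: g_def intro: sum_nonneg)
  also have "\<dots> \<le> 8 * real q ^ 4" using csum_fourth_moment by (simp add: g_def)
  finally have "real (q - 1) * norm (csum c k) ^ 4 \<le> 8 * real q ^ 4" .
  moreover have "real q / 2 * norm (csum c k) ^ 4 \<le> real (q - 1) * norm (csum c k) ^ 4"
    using q_gt_3 by (intro mult_right_mono) (auto simp: of_nat_diff)
  ultimately have "real q * norm (csum c k) ^ 4 \<le> real q * (16 * real q ^ 3)" by (simp add: power_numeral_reduce)
  then have "norm (csum c k) ^ 4 \<le> 16 * real q ^ 3" using q_pos by simp
  also have "\<dots> = (2 * real q powr (3 / 4)) ^ 4"
    using q_pos by (simp add: power_mult_distrib powr_realpow[symmetric] powr_powr flip: powr_numeral)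
  finally show ?thesis by (subst (asm) power_mono_iff) auto
qed

section \<open>Completion of sums over intervals\<close>

lemma geometric_ee:
  "u \<le> v \<Longrightarrow> (1 - ee k) * (\<Sum>m\<in>{u<..v}. ee (k * int m)) = ee (k * (int u + 1)) - ee (k * (int v + 1))"
proof (induction v rule: dec_induct)
  case (step v)
  have "{u<..Suc v} = insert (Suc v) {u<..v}" using step by auto
  then have "(1 - ee k) * (\<Sum>m\<in>{u<..Suc v}. ee (k * int m))
    = (1 - ee k) * ee (k * (int v + 1)) + (1 - ee k) * (\<Sum>m\<in>{u<..v}. ee (k * int m))"
    by (simp add: distrib_left add.commute)
  also have "\<dots> = (1 - ee k) * ee (k * (int v + 1)) + (ee (k * (int u + 1)) - ee (k * (int v + 1)))"
    unfolding step.IH ..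
  also have "\<dots> = ee (k * (int u + 1)) - ee (k * (int (Suc v) + 1))"
    by (simp add: algebra_simps flip: ee_add)
  finally show ?case .
qed simp

text \<open>Keeping both summands, instead of the distance from \<open>k / q\<close> to the nearest
  integer, avoids a case distinction when summing over \<open>k\<close>.\<close>

lemma norm_one_minus_ee_ge:
  assumes "k \<in> units"
  shows "1 / norm (1 - ee k) \<le> real q / 2 * (1 / real_of_int k + 1 / real_of_int (int q - k))"
proof -
  define x where "x = real_of_int k / real q"
  have x: "0 < x" "x < 1" using assms by (auto simp: x_def field_simps)
  have n: "norm (1 - ee k) = 2 * sin (pi * x)"
  proof -
    have "2 * pi * real_of_int k / real q / 2 = pi * x" by (simp add: x_def)
    moreover have "0 \<le> sin (pi * x)" using x by (intro sin_ge_zero) auto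
    ultimately show ?thesis unfolding ee_def norm_one_minus_cis by simp
  qed
  have key: "y \<le> sin (pi * y)" if "0 < y" "y \<le> 1 / 2" for y
  proof -
    have "pi * y / 2 \<le> sin (pi * y)" using that by (intro sin_ge_half) auto
    moreover have "2 * y \<le> pi * y" using that pi_gt3 by (intro mult_right_mono) auto
    ultimately show ?thesis by simp
  qed
  have s: "sin (pi * (1 - x)) = sin (pi * x)" by (simp add: right_diff_distrib)
  have "1 / sin (pi * x) \<le> 1 / x + 1 / (1 - x)"
  proof (cases "x \<le> 1 / 2")
    case True
    then have "1 / sin (pi * x) \<le> 1 / x" using key[of x] x by (intro divide_left_mono mult_pos_pos) auto
    then show ?thesis using x by (smt (verit) divide_nonneg_pos)
  next
    case False
    then have "1 / sin (pi * x) \<le> 1 / (1 - x)"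
      using key[of "1 - x"] x unfolding s by (intro divide_left_mono mult_pos_pos) auto
    then show ?thesis using x by (smt (verit) divide_nonneg_pos)
  qed
  also have "1 / x + 1 / (1 - x) = real q * (1 / real_of_int k + 1 / real_of_int (int q - k))"
    using q_pos assms by (simp add: x_def field_simps)
  finally show ?thesis unfolding n by simp
qed

definition LQ :: real where "LQ = 1 + ln (real q)"

lemma LQ_ge_1: "1 \<le> LQ" using q_pos by (simp add: LQ_def)

text \<open>The L1 norm of the Dirichlet kernel over the nonzero frequencies; this is the price of
  completion.\<close>

lemma sum_norm_sum_ee_le:
  "(\<Sum>k\<in>units. norm (\<Sum>m\<in>{u<..v}. ee (k * int m))) \<le> 2 * real q * LQ"
proof (cases "u \<le> v")
  case True
  have "norm (\<Sum>m\<in>{u<..v}. ee (k * int m)) \<le> real q * (1 / real_of_int k + 1 / real_of_int (int q - k))"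
    if k: "k \<in> units" for k
  proof -
    have ne: "1 - ee k \<noteq> 0" using not_dvd_units[OF k] ee_eq_1_iff[of k] by auto
    have "norm (1 - ee k) * norm (\<Sum>m\<in>{u<..v}. ee (k * int m)) \<le> 2"
      unfolding norm_mult[symmetric] geometric_ee[OF True] by (rule order.trans[OF norm_triangle_ineq4]) simp
    then have "norm (\<Sum>m\<in>{u<..v}. ee (k * int m)) \<le> 2 * (1 / norm (1 - ee k))"
      using ne by (simp add: field_simps)
    then show ?thesis using norm_one_minus_ee_ge[OF k] by simp
  qed
  then have "(\<Sum>k\<in>units. norm (\<Sum>m\<in>{u<..v}. ee (k * int m)))
    \<le> (\<Sum>k\<in>units. real q * (1 / real_of_int k + 1 / real_of_int (int q - k)))"
    by (intro sum_mono) blast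
  also have "\<dots> = real q * ((\<Sum>k\<in>units. 1 / real_of_int k) + (\<Sum>k\<in>units. 1 / real_of_int (int q - k)))"
    unfolding sum.distrib[symmetric] sum_distrib_left ..
  also have "(\<Sum>k\<in>units. 1 / real_of_int (int q - k)) = (\<Sum>k\<in>units. 1 / real_of_int k)"
    by (rule sum.reindex_bij_witness[of _ "\<lambda>k. int q - k" "\<lambda>k. int q - k"]) auto
  also have "(\<Sum>k\<in>units. 1 / real_of_int k) = (\<Sum>k = 1..q - 1. 1 / real k)"
  proof -
    have "units = int ` {1..q - 1}"
      using q_pos image_int_atLeastAtMost[of 1 "q - 1"] by (auto simp: of_nat_diff)
    then show ?thesis by (simp add: sum.reindex)
  qed
  also have "\<dots> \<le> 1 + ln (real (q - 1))" using q_gt_3 by (intro sum_inverse_le_ln) auto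
  also have "\<dots> \<le> LQ" using q_gt_3 by (simp add: LQ_def)
  finally show ?thesis by (simp add: mult_left_mono)
next
  case False
  then have "{u<..v} = {}" by auto
  then show ?thesis using LQ_ge_1 by simp
qed

text \<open>Fourier inversion modulo \<open>q\<close>: the condition that \<open>m\<close> lies in
  the class of \<open>x\<close> is detected by additive characters, and the sum over
  \<open>x\<close> is then complete.\<close>

lemma kern_completion:
  "finite J \<Longrightarrow> of_nat q * (\<Sum>m\<in>J. kern c (int m)) = (\<Sum>k\<in>residues. (\<Sum>m\<in>J. ee (k * int m)) * csum c (- k))"
proof -
  assume J: "finite J"
  have "(\<Sum>k\<in>residues. (\<Sum>m\<in>J. ee (k * int m)) * csum c (- k))
    = (\<Sum>k\<in>residues. \<Sum>m\<in>J. \<Sum>x\<in>units. ee (c * isq x) * ee (k * (int m - x)))"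
    unfolding csum_def sum_product by (intro sum.cong refl) (simp flip: ee_add add: algebra_simps)
  also have "\<dots> = (\<Sum>m\<in>J. \<Sum>x\<in>units. \<Sum>k\<in>residues. ee (c * isq x) * ee (k * (int m - x)))"
    by (subst sum.swap, rule sum.cong[OF refl], rule sum.swap)
  also have "\<dots> = (\<Sum>m\<in>J. \<Sum>x\<in>units. if [int m = x] (mod int q) then of_nat q * ee (c * isq x) else 0)"
    unfolding sum_distrib_left[symmetric] sum_ee cong_iff_dvd_diff by (intro sum.cong refl) simp
  also have "\<dots> = (\<Sum>m\<in>J. of_nat q * kern c (int m))"
  proof (intro sum.cong refl)
    fix m
    show "(\<Sum>x\<in>units. if [int m = x] (mod int q) then of_nat q * ee (c * isq x) else 0) = of_nat q * kern c (int m)"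
    proof (cases "int q dvd int m")
      case True
      then have "\<not> [int m = x] (mod int q)" if "x \<in> units" for x
        using that not_dvd_units cong_dvd_iff by blast
      then show ?thesis using True by (simp add: kern_def)
    next
      case False
      define y where "y = int m mod int q"
      have y: "y \<in> units" "[int m = y] (mod int q)"
        using mod_in_units[OF False] by (simp_all add: y_def cong_def)
      have "[int m = x] (mod int q) \<longleftrightarrow> y = x" if "x \<in> units" for x
        using that y residues_cong_eq[of y x] by (metis atLeastLessThan_iff cong_sym cong_trans dual_order.trans zero_le_one)
      then have "(\<Sum>x\<in>units. if [int m = x] (mod int q) then of_nat q * ee (c * isq x) else 0)
        = (\<Sum>x\<in>units. if y = x then of_nat q * ee (c * isq x) else 0)" by (intro sum.cong refl) simp
      also have "\<dots> = of_nat q * ee (c * isq y)" using y by simp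
      also have "ee (c * isq y) = ee (c * isq (int m))"
        using y by (intro ee_cong cong_mult isq_cong cong_refl) (rule cong_sym)
      finally show ?thesis using False by (simp add: kern_def)
    qed
  qed
  finally show ?thesis by (simp add: sum_distrib_left)
qed

text \<open>The frequency 0 accounts for the term with the length over \<open>q\<close>, the other
  frequencies for \<open>LQ\<close>. The bound beats the trivial one as soon as the length exceeds
  q^(3/4) by more than a logarithm.\<close>

lemma norm_sum_kern_le:
  assumes "\<not> int q dvd c"
  shows "norm (\<Sum>m\<in>{u<..v}. kern c (int m)) \<le> 4 * real q powr (3 / 4) * (LQ + real (v - u) / real q)"
proof -
  let ?Q = "real q powr (3 / 4)" and ?D = "\<lambda>k. \<Sum>m\<in>{u<..v}. ee (k * int m)"
  have res: "residues = insert 0 units" using q_pos by auto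
  have "real q * norm (\<Sum>m\<in>{u<..v}. kern c (int m)) = norm (\<Sum>k\<in>residues. ?D k * csum c (- k))"
    unfolding kern_completion[OF finite_greaterThanAtMost, symmetric] norm_mult by simp
  also have "\<dots> \<le> (\<Sum>k\<in>residues. norm (?D k) * (2 * ?Q))"
    by (intro sum_norm_le) (simp add: norm_mult mult_left_mono norm_csum_le[OF assms])
  also have "\<dots> = (real (v - u) + (\<Sum>k\<in>units. norm (?D k))) * (2 * ?Q)"
    unfolding res by (simp add: sum_distrib_right distrib_right)
  also have "\<dots> \<le> (2 * real (v - u) + 2 * real q * LQ) * (2 * ?Q)"
    by (intro mult_right_mono add_mono sum_norm_sum_ee_le) auto
  also have "\<dots> = real q * (4 * ?Q * (LQ + real (v - u) / real q))"
    using q_pos by (simp add: field_simps)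
  finally show ?thesis using q_pos by simp
qed

end

section \<open>Equidistribution of inverse squares in residue classes\<close>

context modulus
begin

text \<open>For \<open>d\<close> prime to \<open>q\<close> the congruence says that
  \<open>d\<^sup>2 * m\<close> lies in the class of \<open>a\<close>.\<close>

definition class_count :: "int \<Rightarrow> nat set \<Rightarrow> nat \<Rightarrow> nat" where
  "class_count a J d = card {m \<in> J. [int m = a * isq (int d)] (mod int q)}"

lemma class_count_expansion:
  assumes "finite J" "\<not> int q dvd int d"
  shows "of_nat q * (of_nat (class_count a J d) - of_nat (card J) / of_nat q)
    = (\<Sum>k\<in>units. (\<Sum>m\<in>J. ee (k * int m)) * kern (- k * a) (int d))"
proof -
  have res: "residues = insert 0 units" using q_pos by auto
  have "of_nat q * of_nat (class_count a J d)
    = (\<Sum>m\<in>J. if [int m = a * isq (int d)] (mod int q) then of_nat q else 0 :: complex)"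
    using assms(1) by (simp add: class_count_def sum.If_cases Int_def)
  also have "\<dots> = (\<Sum>m\<in>J. \<Sum>k\<in>residues. ee (k * (int m - a * isq (int d))))"
    unfolding sum_ee cong_iff_dvd_diff ..
  also have "\<dots> = (\<Sum>k\<in>residues. \<Sum>m\<in>J. ee (k * int m) * ee (- k * a * isq (int d)))"
    by (subst sum.swap) (simp flip: ee_add add: algebra_simps)
  also have "\<dots> = (\<Sum>k\<in>residues. (\<Sum>m\<in>J. ee (k * int m)) * kern (- k * a) (int d))"
    using assms(2) by (simp add: kern_def sum_distrib_right)
  also have "\<dots> = of_nat (card J) + (\<Sum>k\<in>units. (\<Sum>m\<in>J. ee (k * int m)) * kern (- k * a) (int d))"
    unfolding res using assms(2) by (simp add: kern_def)
  finally show ?thesis using q_pos by (simp add: field_simps)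
qed

text \<open>Transfers a bound for weighted sums of \<open>kern\<close> to the discrepancy of class
  counts. The bound \<open>T\<close> has to be uniform in \<open>c\<close>, because every frequency
  \<open>- k * a\<close> with \<open>k\<close> a unit occurs; summing over them costs only the L1
  norm of the Dirichlet kernel.\<close>

lemma norm_sum_class_count_le:
  fixes g :: "nat \<Rightarrow> complex"
  assumes "finite I" "\<not> int q dvd a"
    and T: "\<And>c. \<not> int q dvd c \<Longrightarrow> norm (\<Sum>d\<in>I. g d * kern c (int d)) \<le> T"
  shows "norm (\<Sum>d\<in>{d \<in> I. \<not> q dvd d}. g d * (of_nat (class_count a {u<..v} d) - of_nat (v - u) / of_nat q))
    \<le> 2 * LQ * T"
proof -
  let ?D = "\<lambda>k. \<Sum>m\<in>{u<..v}. ee (k * int m)"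
  have T0: "T \<ge> 0" using T[of a] assms(2) norm_ge_zero order.trans by blast
  have "of_nat q * (\<Sum>d\<in>{d \<in> I. \<not> q dvd d}. g d * (of_nat (class_count a {u<..v} d) - of_nat (v - u) / of_nat q))
    = (\<Sum>d\<in>{d \<in> I. \<not> q dvd d}. g d * (of_nat q * (of_nat (class_count a {u<..v} d) - of_nat (card {u<..v}) / of_nat q)))"
    by (simp only: sum_distrib_left card_greaterThanAtMost mult.left_commute)
  also have "\<dots> = (\<Sum>d\<in>{d \<in> I. \<not> q dvd d}. g d * (\<Sum>k\<in>units. ?D k * kern (- k * a) (int d)))"
    by (intro sum.cong refl arg_cong2[where f = "(*)"] class_count_expansion) auto
  also have "\<dots> = (\<Sum>d\<in>I. g d * (\<Sum>k\<in>units. ?D k * kern (- k * a) (int d)))"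
    using assms(1) by (intro sum.mono_neutral_left) (auto simp: kern_def)
  also have "\<dots> = (\<Sum>k\<in>units. ?D k * (\<Sum>d\<in>I. g d * kern (- k * a) (int d)))"
    unfolding sum_distrib_left by (subst sum.swap) (simp add: mult.left_commute)
  finally have "norm (of_nat q * (\<Sum>d\<in>{d \<in> I. \<not> q dvd d}. g d * (of_nat (class_count a {u<..v} d) - of_nat (v - u) / of_nat q)))
    = norm (\<Sum>k\<in>units. ?D k * (\<Sum>d\<in>I. g d * kern (- k * a) (int d)))" by (rule arg_cong)
  then have "real q * norm (\<Sum>d\<in>{d \<in> I. \<not> q dvd d}. g d * (of_nat (class_count a {u<..v} d) - of_nat (v - u) / of_nat q))
    = norm (\<Sum>k\<in>units. ?D k * (\<Sum>d\<in>I. g d * kern (- k * a) (int d)))"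
    by (simp only: norm_mult norm_of_nat)
  also have "\<dots> \<le> (\<Sum>k\<in>units. norm (?D k) * T)"
  proof (rule sum_norm_le)
    fix k assume k: "k \<in> units"
    have "\<not> int q dvd - k * a"
      using not_dvd_units[OF k] assms(2) prime_int_q by (simp add: prime_dvd_mult_iff)
    then show "norm (?D k * (\<Sum>d\<in>I. g d * kern (- k * a) (int d))) \<le> norm (?D k) * T"
      unfolding norm_mult by (intro mult_left_mono T) auto
  qed
  also have "\<dots> \<le> 2 * real q * LQ * T"
    unfolding sum_distrib_right[symmetric] using T0 by (intro mult_right_mono sum_norm_sum_ee_le)
  finally show ?thesis using q_pos by (simp add: mult.assoc)
qed

text \<open>The weight 1 gives an upper bound for the number of points of
  \<open>d\<^sup>2 * m \<equiv> a\<close> in a box: the area over \<open>q\<close>, plus an error of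
  about q^(3/4) as long as the side in \<open>d\<close> is not longer than \<open>q\<close>.\<close>

lemma sum_class_count_le:
  assumes "\<not> int q dvd a"
  shows "(\<Sum>d\<in>{d \<in> {s<..t}. \<not> q dvd d}. real (class_count a {u<..v} d))
    \<le> real (t - s) * real (v - u) / real q + 8 * real q powr (3 / 4) * LQ * (LQ + real (t - s) / real q)"
proof -
  let ?I = "{d \<in> {s<..t}. \<not> q dvd d}"
  let ?T = "4 * real q powr (3 / 4) * (LQ + real (t - s) / real q)"
  have "norm (\<Sum>d\<in>?I. 1 * (of_nat (class_count a {u<..v} d) - of_nat (v - u) / of_nat q :: complex)) \<le> 2 * LQ * ?T"
    using norm_sum_kern_le by (intro norm_sum_class_count_le assms) auto
  then have "Re (\<Sum>d\<in>?I. 1 * (of_nat (class_count a {u<..v} d) - of_nat (v - u) / of_nat q :: complex)) \<le> 2 * LQ * ?T"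
    using complex_Re_le_cmod order.trans by blast
  then have "(\<Sum>d\<in>?I. real (class_count a {u<..v} d)) - real (card ?I) * (real (v - u) / real q) \<le> 2 * LQ * ?T"
    by (simp add: sum_subtractf)
  moreover have "real (card ?I) * (real (v - u) / real q) \<le> real (t - s) * (real (v - u) / real q)"
    using card_mono[of "{s<..t}" ?I] by (intro mult_right_mono of_nat_mono) (auto simp del: greaterThanAtMost_iff)
  ultimately show ?thesis by (simp add: algebra_simps)
qed

end

section \<open>Auxiliary counting estimates\<close>

text \<open>The power mean inequality for exponents \<open>2 ^ j\<close>, by \<open>j\<close>
  applications of the Cauchy--Schwarz inequality.\<close>

lemma sum_power_power2_le:
  fixes g :: "'a \<Rightarrow> real"
  assumes "finite A" "\<And>x. x \<in> A \<Longrightarrow> g x \<ge> 0"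
  shows "(\<Sum>x\<in>A. g x) ^ (2 ^ j) \<le> real (card A) ^ (2 ^ j - 1) * (\<Sum>x\<in>A. g x ^ (2 ^ j))"
proof (induction j)
  case (Suc j)
  let ?n = "2 ^ j :: nat"
  have S: "(\<Sum>x\<in>A. g x ^ ?n)\<^sup>2 \<le> (\<Sum>x\<in>A. (g x ^ ?n)\<^sup>2) * real (card A)"
    by (rule sum_squared_le_sum_of_squares)
  have "(\<Sum>x\<in>A. g x) ^ (2 ^ Suc j) = ((\<Sum>x\<in>A. g x) ^ ?n)\<^sup>2"
    by (simp add: power_mult mult.commute flip: power_mult)
  also have "\<dots> \<le> (real (card A) ^ (?n - 1) * (\<Sum>x\<in>A. g x ^ ?n))\<^sup>2"
    using assms by (intro power_mono Suc.IH zero_le_power sum_nonneg) auto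
  also have "\<dots> = real (card A) ^ (2 * (?n - 1)) * (\<Sum>x\<in>A. g x ^ ?n)\<^sup>2"
    by (simp add: power_mult_distrib power_even_eq)
  also have "\<dots> \<le> real (card A) ^ (2 * (?n - 1)) * ((\<Sum>x\<in>A. (g x ^ ?n)\<^sup>2) * real (card A))"
    by (intro mult_left_mono S) auto
  also have "\<dots> = real (card A) ^ (2 * (?n - 1) + 1) * (\<Sum>x\<in>A. (g x ^ ?n)\<^sup>2)"
    by simp
  also have "2 * (?n - 1) + 1 = 2 ^ Suc j - 1"
  proof -
    have "?n \<ge> 1" by simp
    then show ?thesis by (simp only: power_Suc)
  qed
  also have "(\<Sum>x\<in>A. (g x ^ ?n)\<^sup>2) = (\<Sum>x\<in>A. g x ^ (2 ^ Suc j))"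
    by (simp add: mult.commute flip: power_mult)
  finally show ?case .
qed simp

text \<open>Grouping by the value of \<open>\<phi>\<close> turns the sum into one with
  multiplicities \<open>\<nu>\<close>. A last Cauchy--Schwarz step separates them from
  \<open>G\<close>, so that only their second moment enters, which is the number of coincidences of
  \<open>\<phi>\<close>.\<close>

lemma sum_map_Holder:
  fixes G :: "'b \<Rightarrow> real"
  assumes "finite A" "finite Z" "\<phi> ` A \<subseteq> Z" "\<And>z. z \<in> Z \<Longrightarrow> G z \<ge> 0"
  shows "(\<Sum>x\<in>A. G (\<phi> x)) ^ (2 * 2 ^ j)
    \<le> real (card A) ^ (2 * (2 ^ j - 1)) * real (card {(x, y) \<in> A \<times> A. \<phi> x = \<phi> y}) * (\<Sum>z\<in>Z. G z ^ (2 * 2 ^ j))"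
proof -
  let ?n = "2 ^ j :: nat"
  define \<nu> where "\<nu> z = card {x \<in> A. \<phi> x = z}" for z
  have "(\<Sum>x\<in>A. G (\<phi> x) ^ ?n) = (\<Sum>z\<in>Z. \<Sum>x\<in>{x \<in> A. \<phi> x = z}. G (\<phi> x) ^ ?n)"
    by (rule sum.group[symmetric, OF assms(1-3)])
  also have "\<dots> = (\<Sum>z\<in>Z. real (\<nu> z) * G z ^ ?n)"
    by (intro sum.cong refl) (simp add: \<nu>_def)
  finally have e: "(\<Sum>x\<in>A. G (\<phi> x) ^ ?n) = (\<Sum>z\<in>Z. real (\<nu> z) * G z ^ ?n)" .
  have "{(x, y) \<in> A \<times> A. \<phi> x = \<phi> y} = (\<Union>z\<in>Z. {x \<in> A. \<phi> x = z} \<times> {x \<in> A. \<phi> x = z})"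
    using assms(3) by auto
  then have "card {(x, y) \<in> A \<times> A. \<phi> x = \<phi> y} = card (\<Union>z\<in>Z. {x \<in> A. \<phi> x = z} \<times> {x \<in> A. \<phi> x = z})"
    by simp
  also have "\<dots> = (\<Sum>z\<in>Z. card ({x \<in> A. \<phi> x = z} \<times> {x \<in> A. \<phi> x = z}))"
    using assms(1,2) by (intro card_UN_disjoint) auto
  finally have c: "card {(x, y) \<in> A \<times> A. \<phi> x = \<phi> y} = (\<Sum>z\<in>Z. (\<nu> z)\<^sup>2)"
    by (simp add: \<nu>_def card_cartesian_product power2_eq_square)
  have "(\<Sum>x\<in>A. G (\<phi> x)) ^ (2 * ?n) = ((\<Sum>x\<in>A. G (\<phi> x)) ^ ?n)\<^sup>2"
    by (simp add: power_even_eq)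
  also have "\<dots> \<le> (real (card A) ^ (?n - 1) * (\<Sum>x\<in>A. G (\<phi> x) ^ ?n))\<^sup>2"
    using assms by (intro power_mono sum_power_power2_le zero_le_power sum_nonneg) auto
  also have "\<dots> = real (card A) ^ (2 * (?n - 1)) * (\<Sum>z\<in>Z. real (\<nu> z) * G z ^ ?n)\<^sup>2"
    by (simp add: e power_mult_distrib power_even_eq)
  also have "\<dots> \<le> real (card A) ^ (2 * (?n - 1)) * ((\<Sum>z\<in>Z. (real (\<nu> z))\<^sup>2) * (\<Sum>z\<in>Z. (G z ^ ?n)\<^sup>2))"
    by (intro mult_left_mono Cauchy_Schwarz_ineq_sum) auto
  finally show ?thesis unfolding c by (simp add: power_even_eq mult.assoc)
qed

text \<open>Each unit step exchanges one end term for another, both of modulus at most 1.\<close>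

lemma norm_sum_shift_le:
  fixes f :: "nat \<Rightarrow> complex"
  assumes "\<And>m. norm (f m) \<le> 1"
  shows "norm ((\<Sum>m\<in>{u<..v}. f (m + h)) - (\<Sum>m\<in>{u<..v}. f m)) \<le> 2 * real h"
proof (cases "u \<le> v")
  case True
  show ?thesis
  proof (induction h)
    case (Suc h)
    have "(\<Sum>m\<in>{u<..v}. f (m + Suc h)) - (\<Sum>m\<in>{u<..v}. f (m + h)) = f (v + Suc h) - f (u + Suc h)"
      using True
    proof (induction v rule: dec_induct)
      case (step v)
      have "{u<..Suc v} = insert (Suc v) {u<..v}" using step by auto
      then show ?case using step.IH by (simp add: algebra_simps)
    qed simp
    then have "norm ((\<Sum>m\<in>{u<..v}. f (m + Suc h)) - (\<Sum>m\<in>{u<..v}. f (m + h))) \<le> 2"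
      using norm_triangle_ineq4[of "f (v + Suc h)" "f (u + Suc h)"] assms[of "v + Suc h"] assms[of "u + Suc h"] by simp
    then show ?case
      using Suc norm_triangle_ineq[of "(\<Sum>m\<in>{u<..v}. f (m + Suc h)) - (\<Sum>m\<in>{u<..v}. f (m + h))"
          "(\<Sum>m\<in>{u<..v}. f (m + h)) - (\<Sum>m\<in>{u<..v}. f m)"] by simp
  qed simp
qed simp

lemma card_multiples_le:
  assumes "d > 0"
  shows "card {m \<in> {1..M}. d dvd m} \<le> M div d"
proof -
  have "{m \<in> {1..M}. d dvd m} \<subseteq> (\<lambda>k. d * k) ` {1..M div d}"
  proof
    fix m assume m: "m \<in> {m \<in> {1..M}. d dvd m}"
    then have "m = d * (m div d)" "m div d \<le> M div d" by (auto simp: div_le_mono)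
    moreover have "m div d \<noteq> 0" using m \<open>m = d * (m div d)\<close> by (metis (mono_tags, lifting) atLeastAtMost_iff mem_Collect_eq mult_0_right not_one_le_zero)
    ultimately show "m \<in> (\<lambda>k. d * k) ` {1..M div d}" by (intro image_eqI[of _ _ "m div d"]) auto
  qed
  then have "card {m \<in> {1..M}. d dvd m} \<le> card ((\<lambda>k. d * k) ` {1..M div d})" by (intro card_mono) auto
  also have "\<dots> \<le> M div d" using card_image_le[of "{1..M div d}"] by simp
  finally show ?thesis .
qed

text \<open>The gcd is at most the sum of all common divisors, and a divisor \<open>d\<close> of
  \<open>a\<close> divides at most \<open>A / d\<close> of the numbers \<open>b\<close>.\<close>

lemma sum_gcd_le:
  assumes "a \<ge> 1"
  shows "(\<Sum>b = 1..A. real (gcd a b)) \<le> real A * real (card {d. d dvd a})"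
proof -
  have fin: "finite {d. d dvd a}" using assms by simp
  have "(\<Sum>b = 1..A. real (gcd a b)) \<le> (\<Sum>b = 1..A. \<Sum>d\<in>{d. d dvd a}. if d dvd b then real d else 0)"
  proof (rule sum_mono)
    fix b
    have "real (gcd a b) = (\<Sum>d\<in>{gcd a b}. if d dvd b then real d else 0)" by simp
    also have "\<dots> \<le> (\<Sum>d\<in>{d. d dvd a}. if d dvd b then real d else 0)"
      using fin by (intro sum_mono2) auto
    finally show "real (gcd a b) \<le> (\<Sum>d\<in>{d. d dvd a}. if d dvd b then real d else 0)" .
  qed
  also have "\<dots> = (\<Sum>d\<in>{d. d dvd a}. real d * real (card {b \<in> {1..A}. d dvd b}))"
    by (subst sum.swap) (simp add: sum.If_cases Int_def mult.commute)
  also have "\<dots> \<le> (\<Sum>d\<in>{d. d dvd a}. real A)"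
  proof (rule sum_mono)
    fix d assume "d \<in> {d. d dvd a}"
    then have d: "d > 0" using assms by (auto intro: Nat.gr0I)
    have "d * card {b \<in> {1..A}. d dvd b} \<le> d * (A div d)" using card_multiples_le[OF d, of A] by simp
    also have "\<dots> \<le> A" by simp
    finally show "real d * real (card {b \<in> {1..A}. d dvd b}) \<le> real A" by (metis of_nat_le_iff of_nat_mult)
  qed
  finally show ?thesis by (simp add: mult.commute)
qed

lemma sum_inverse_multiples_le:
  assumes "1 \<le> d" "1 \<le> A"
  shows "(\<Sum>a\<in>{a \<in> {1..A}. d dvd a}. 1 / real a) \<le> (1 + ln (real A)) / real d"
proof -
  have "(\<Sum>a\<in>{a \<in> {1..A}. d dvd a}. 1 / real a) \<le> (\<Sum>a\<in>(\<lambda>e. d * e) ` {1..A}. 1 / real a)"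
  proof (rule sum_mono2)
    show "{a \<in> {1..A}. d dvd a} \<subseteq> (\<lambda>e. d * e) ` {1..A}"
    proof
      fix a assume a: "a \<in> {a \<in> {1..A}. d dvd a}"
      then obtain e where e: "a = d * e" by (auto elim: dvdE)
      moreover have "e \<noteq> 0" using a e by (metis atLeastAtMost_iff mem_Collect_eq mult_0_right not_one_le_zero)
      moreover have "e \<le> a" using e assms by simp
      moreover have "a \<le> A" using a by simp
      ultimately have "e \<ge> 1" "e \<le> A" by linarith+
      then show "a \<in> (\<lambda>e. d * e) ` {1..A}" using a e by (intro image_eqI[of _ _ e]) auto
    qed
  qed auto
  also have "\<dots> = (\<Sum>e = 1..A. 1 / real e) / real d"
    using assms by (subst sum.reindex) (auto simp: inj_on_def sum_divide_distrib mult.commute)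
  also have "\<dots> \<le> (1 + ln (real A)) / real d"
    using assms by (intro divide_right_mono sum_inverse_le_ln) auto
  finally show ?thesis .
qed

lemma sum_card_divisors_over_le:
  assumes "A \<ge> 1"
  shows "(\<Sum>a = 1..A. real (card {d. d dvd a}) / real a) \<le> (1 + ln (real A))\<^sup>2"
proof -
  have "(\<Sum>a = 1..A. real (card {d. d dvd a}) / real a)
    = (\<Sum>a = 1..A. \<Sum>d = 1..A. if d dvd a then 1 / real a else 0)"
  proof (rule sum.cong[OF refl])
    fix a assume a: "a \<in> {1..A}"
    have "{d. d dvd a} = {d \<in> {1..A}. d dvd a}" using a by (auto dest: dvd_imp_le intro: Nat.gr0I)
    then have "real (card {d. d dvd a}) / real a = (\<Sum>d\<in>{d \<in> {1..A}. d dvd a}. 1 / real a)"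
      by simp
    also have "\<dots> = (\<Sum>d = 1..A. if d dvd a then 1 / real a else 0)"
      by (rule sum.inter_filter) simp
    finally show "real (card {d. d dvd a}) / real a = (\<Sum>d = 1..A. if d dvd a then 1 / real a else 0)" .
  qed
  also have "\<dots> = (\<Sum>d = 1..A. \<Sum>a\<in>{a \<in> {1..A}. d dvd a}. 1 / real a)"
    by (subst sum.swap) (intro sum.cong refl sum.inter_filter[symmetric], simp)
  also have "\<dots> \<le> (\<Sum>d = 1..A. (1 + ln (real A)) * (1 / real d))"
    using assms sum_inverse_multiples_le[of _ A] by (intro sum_mono) auto
  also have "\<dots> \<le> (1 + ln (real A)) * (1 + ln (real A))"
    unfolding sum_distrib_left[symmetric] using assms by (intro mult_left_mono sum_inverse_le_ln) auto
  finally show ?thesis by (simp add: power2_eq_square)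
qed

text \<open>For fixed \<open>a\<close> and \<open>a'\<close> the number \<open>m\<close> must be a
  multiple of \<open>a div gcd a a'\<close>, and it determines \<open>m'\<close>. What remains is a
  sum of \<open>M * gcd a a' / a\<close>.\<close>

lemma card_proportional_quadruples_le:
  assumes "A \<ge> 1"
  shows "real (card {((a, m), (a', m')) \<in> ({1..A} \<times> {1..M}) \<times> ({1..A} \<times> {1..M}). m * a' = m' * a})
    \<le> real A * real M * (1 + ln (real A))\<^sup>2"
proof -
  let ?S = "{((a, m), (a', m')) \<in> ({1..A} \<times> {1..M}) \<times> ({1..A} \<times> {1..M}). m * a' = m' * a}"
  let ?T = "SIGMA a:{1..A}. SIGMA a':{1..A}. {m \<in> {1..M}. a div gcd a a' dvd m}"
  have "card ?S \<le> card ?T"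
  proof (rule card_inj_on_le)
    show "inj_on (\<lambda>((a, m), (a', m')). (a, a', m)) ?S"
      by (rule inj_onI) auto
    show "(\<lambda>((a, m), (a', m')). (a, a', m)) ` ?S \<subseteq> ?T"
    proof (rule image_subsetI)
      fix s assume s: "s \<in> ?S"
      obtain a m a' m' where e: "s = ((a, m), (a', m'))" by (metis surj_pair)
      then have *: "a \<ge> 1" "a \<le> A" "a' \<ge> 1" "a' \<le> A" "m \<in> {1..M}" "m * a' = m' * a" using s by auto
      have "a div gcd a a' dvd m * (a' div gcd a a')"
      proof -
        have "m * (a' div gcd a a') = m' * (a div gcd a a')"
          using *(6) by (metis div_mult_swap gcd_dvd1 gcd_dvd2)
        then show ?thesis by simp
      qed
      moreover have "coprime (a div gcd a a') (a' div gcd a a')"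
        using * by (intro div_gcd_coprime) auto
      ultimately have "a div gcd a a' dvd m" by (simp add: coprime_dvd_mult_left_iff)
      then show "(\<lambda>((a, m), (a', m')). (a, a', m)) s \<in> ?T" using * e by auto
    qed
    show "finite ?T" by (intro finite_SigmaI) auto
  qed
  also have "card ?T = (\<Sum>a = 1..A. \<Sum>a' = 1..A. card {m \<in> {1..M}. a div gcd a a' dvd m})"
    by simp
  finally have "real (card ?S) \<le> real (\<Sum>a = 1..A. \<Sum>a' = 1..A. card {m \<in> {1..M}. a div gcd a a' dvd m})"
    by (rule of_nat_mono)
  also have "\<dots> = (\<Sum>a = 1..A. \<Sum>a' = 1..A. real (card {m \<in> {1..M}. a div gcd a a' dvd m}))"
    by (simp only: of_nat_sum)
  also have "\<dots> \<le> (\<Sum>a = 1..A. \<Sum>a' = 1..A. (real M / real a) * real (gcd a a'))"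
  proof (intro sum_mono)
    fix a a' assume a: "a \<in> {1..A}"
    have "a div gcd a a' > 0" using a by (simp add: div_greater_zero_iff gcd_le1_nat)
    from card_multiples_le[OF this, of M]
    have "real (card {m \<in> {1..M}. a div gcd a a' dvd m}) \<le> real (M div (a div gcd a a'))" by simp
    also have "\<dots> \<le> real M / real (a div gcd a a')" by (rule of_nat_div_le_of_nat)
    also have "\<dots> = (real M / real a) * real (gcd a a')" by (simp add: real_of_nat_div)
    finally show "real (card {m \<in> {1..M}. a div gcd a a' dvd m}) \<le> (real M / real a) * real (gcd a a')" .
  qed
  also have "\<dots> = (\<Sum>a = 1..A. (real M / real a) * (\<Sum>a' = 1..A. real (gcd a a')))"
    by (simp add: sum_distrib_left)
  also have "\<dots> \<le> (\<Sum>a = 1..A. (real M / real a) * (real A * real (card {d. d dvd a})))"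
    by (intro sum_mono mult_left_mono sum_gcd_le) auto
  also have "\<dots> = real A * real M * (\<Sum>a = 1..A. real (card {d. d dvd a}) / real a)"
    by (simp add: sum_distrib_left field_simps)
  also have "\<dots> \<le> real A * real M * (1 + ln (real A))\<^sup>2"
    by (intro mult_left_mono sum_card_divisors_over_le assms) auto
  finally show ?thesis .
qed

section \<open>A high moment of short sums over inverse squares\<close>

context modulus
begin

text \<open>If the multiplicities of \<open>v0\<close> differ, the rational function has a genuine
  double pole at \<open>- v0\<close>: the coefficient \<open>n v0\<close> is nonzero of modulus at
  most \<open>l < q\<close>, and the poles are distinct modulo \<open>q\<close>. So the numerator
  does not vanish at \<open>- v0\<close>, and its degree is at most twice the number of
  poles.\<close>

lemma sum_isq_cong_roots:
  fixes \<beta> \<beta>' :: "nat \<Rightarrow> nat"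
  assumes \<beta>: "\<And>i. i < l \<Longrightarrow> \<beta> i < q" and \<beta>': "\<And>i. i < l \<Longrightarrow> \<beta>' i < q" and l: "0 < l" "l < q"
    and ne: "card {i \<in> {..<l}. \<beta> i = v0} \<noteq> card {i \<in> {..<l}. \<beta>' i = v0}"
  shows "card {r \<in> residues. (\<forall>i<l. \<not> int q dvd r + int (\<beta> i)) \<and> (\<forall>i<l. \<not> int q dvd r + int (\<beta>' i)) \<and>
      [(\<Sum>i<l. isq (r + int (\<beta> i))) = (\<Sum>i<l. isq (r + int (\<beta>' i)))] (mod int q)} \<le> 4 * l"
    (is "card ?R \<le> _")
proof -
  define V where "V = \<beta> ` {..<l} \<union> \<beta>' ` {..<l}"
  define n where "n v = int (card {i \<in> {..<l}. \<beta> i = v}) - int (card {i \<in> {..<l}. \<beta>' i = v})" for v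
  \<comment> \<open>the numerator of \<open>\<Sum> n v / (r + v)\<^sup>2\<close>\<close>
  define P where "P = (\<Sum>v\<in>V. Polynomial.smult (n v) (\<Prod>v'\<in>V - {v}. [:int v', 1:]\<^sup>2))"
  have fin: "finite V" by (simp add: V_def)
  have cV: "card V \<le> 2 * l"
    unfolding V_def
    using card_Un_le[of "\<beta> ` {..<l}" "\<beta>' ` {..<l}"] card_image_le[of "{..<l}" \<beta>] card_image_le[of "{..<l}" \<beta>'] by simp
  have Vq: "v < q" if "v \<in> V" for v using that \<beta> \<beta>' by (auto simp: V_def)
  have P: "poly P r = (\<Sum>v\<in>V. n v * (\<Prod>v'\<in>V - {v}. (r + int v')\<^sup>2))" for r
    by (simp add: P_def poly_sum poly_prod add.commute)
  have deg: "degree P \<le> 4 * l"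
    unfolding P_def
  proof (rule degree_sum_le[OF fin])
    fix v
    have "degree (\<Prod>v'\<in>V - {v}. [:int v', 1:]\<^sup>2) \<le> (\<Sum>v'\<in>V - {v}. degree ([:int v', 1:]\<^sup>2))"
      using fin by (intro degree_prod_sum_le[unfolded o_def]) auto
    also have "\<dots> = 2 * card (V - {v})" by (simp add: degree_power_eq)
    also have "\<dots> \<le> 2 * card V" by (intro mult_left_mono card_mono fin) auto
    finally show "degree (Polynomial.smult (n v) (\<Prod>v'\<in>V - {v}. [:int v', 1:]\<^sup>2)) \<le> 4 * l"
      using cV degree_smult_le[of "n v" "\<Prod>v'\<in>V - {v}. [:int v', 1:]\<^sup>2"] by linarith
  qed
  have v0: "v0 \<in> V"
  proof (rule ccontr)
    assume "v0 \<notin> V"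
    then have "{i \<in> {..<l}. \<beta> i = v0} = {}" "{i \<in> {..<l}. \<beta>' i = v0} = {}" by (auto simp: V_def)
    then show False using ne by (simp only:)
  qed
  have "poly P (- int v0) = (\<Sum>v\<in>V. if v = v0 then n v0 * (\<Prod>v'\<in>V - {v0}. (- int v0 + int v')\<^sup>2) else 0)"
    unfolding P
  proof (rule sum.cong[OF refl])
    fix v assume "v \<in> V"
    show "n v * (\<Prod>v'\<in>V - {v}. (- int v0 + int v')\<^sup>2)
      = (if v = v0 then n v0 * (\<Prod>v'\<in>V - {v0}. (- int v0 + int v')\<^sup>2) else 0)"
    proof (cases "v = v0")
      case False
      then have "(\<Prod>v'\<in>V - {v}. (- int v0 + int v')\<^sup>2) = 0"
        using v0 fin by (intro prod_zero bexI[of _ v0]) auto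
      then show ?thesis using False by simp
    qed simp
  qed
  also have "\<dots> = n v0 * (\<Prod>v'\<in>V - {v0}. (- int v0 + int v')\<^sup>2)" using v0 fin by simp
  finally have Pv0: "poly P (- int v0) = n v0 * (\<Prod>v'\<in>V - {v0}. (- int v0 + int v')\<^sup>2)" .
  have small: "\<not> int q dvd x" if "x \<noteq> 0" "\<bar>x\<bar> < int q" for x
    using that dvd_imp_le_int by force
  have "card {i \<in> {..<l}. \<beta> i = v0} \<le> l" "card {i \<in> {..<l}. \<beta>' i = v0} \<le> l"
    using card_mono[of "{..<l}" "{i \<in> {..<l}. \<beta> i = v0}"] card_mono[of "{..<l}" "{i \<in> {..<l}. \<beta>' i = v0}"] by auto
  then have "\<not> int q dvd n v0" using ne l unfolding n_def by (intro small) auto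
  moreover have "\<not> int q dvd (\<Prod>v'\<in>V - {v0}. (- int v0 + int v')\<^sup>2)"
  proof
    assume "int q dvd (\<Prod>v'\<in>V - {v0}. (- int v0 + int v')\<^sup>2)"
    then obtain v' where v': "v' \<in> V - {v0}" "int q dvd (- int v0 + int v')\<^sup>2"
      using fin prime_int_q by (auto simp: prime_dvd_prod_iff)
    then have "int q dvd - int v0 + int v'" using prime_int_q prime_dvd_power by blast
    moreover have "\<not> int q dvd - int v0 + int v'"
      using v' Vq[of v'] Vq[OF v0] by (intro small) auto
    ultimately show False by simp
  qed
  ultimately have nz: "\<not> int q dvd poly P (- int v0)"
    unfolding Pv0 using prime_int_q prime_dvd_multD by blast
  have "?R \<subseteq> {r \<in> residues. int q dvd poly P r}"
  proof
    fix r assume r: "r \<in> ?R"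
    have unit: "\<not> int q dvd r + int v" if "v \<in> V" for v using that r by (auto simp: V_def)
    have grp: "(\<Sum>i<l. isq (r + int (\<gamma> i))) = (\<Sum>v\<in>V. int (card {i \<in> {..<l}. \<gamma> i = v}) * isq (r + int v))"
      if "\<gamma> ` {..<l} \<subseteq> V" for \<gamma>
    proof -
      have "(\<Sum>i<l. isq (r + int (\<gamma> i))) = (\<Sum>v\<in>V. \<Sum>i\<in>{i \<in> {..<l}. \<gamma> i = v}. isq (r + int (\<gamma> i)))"
        by (rule sum.group[symmetric]) (use fin that in auto)
      also have "\<dots> = (\<Sum>v\<in>V. int (card {i \<in> {..<l}. \<gamma> i = v}) * isq (r + int v))"
        by (intro sum.cong refl) simp
      finally show ?thesis .
    qed
    have "[(\<Sum>i<l. isq (r + int (\<beta> i))) - (\<Sum>i<l. isq (r + int (\<beta>' i))) = 0] (mod int q)"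
      using r by (simp add: cong_iff_dvd_diff)
    moreover have "(\<Sum>i<l. isq (r + int (\<beta> i))) - (\<Sum>i<l. isq (r + int (\<beta>' i))) = (\<Sum>v\<in>V. n v * isq (r + int v))"
      using grp[of \<beta>] grp[of \<beta>'] by (simp add: V_def n_def left_diff_distrib sum_subtractf)
    ultimately have z: "[(\<Sum>v\<in>V. n v * isq (r + int v)) = 0] (mod int q)" by simp
    let ?\<Pi> = "\<Prod>v'\<in>V. (r + int v')\<^sup>2"
    have "[(\<Prod>v'\<in>V - {v}. (r + int v')\<^sup>2) = ?\<Pi> * isq (r + int v)] (mod int q)" if v: "v \<in> V" for v
    proof -
      have e: "?\<Pi> * isq (r + int v) = ((r + int v)\<^sup>2 * isq (r + int v)) * (\<Prod>v'\<in>V - {v}. (r + int v')\<^sup>2)"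
        by (simp only: prod.remove[OF fin v, of "\<lambda>v'. (r + int v')\<^sup>2"] mult_ac)
      have "[((r + int v)\<^sup>2 * isq (r + int v)) * (\<Prod>v'\<in>V - {v}. (r + int v')\<^sup>2)
          = 1 * (\<Prod>v'\<in>V - {v}. (r + int v')\<^sup>2)] (mod int q)"
        by (intro cong_mult cong_refl isq_inverse unit v)
      then show ?thesis unfolding e by (simp only: mult_1 cong_sym)
    qed
    then have "[poly P r = (\<Sum>v\<in>V. n v * (?\<Pi> * isq (r + int v)))] (mod int q)"
      unfolding P by (intro cong_sum cong_mult cong_refl)
    also have "(\<Sum>v\<in>V. n v * (?\<Pi> * isq (r + int v))) = ?\<Pi> * (\<Sum>v\<in>V. n v * isq (r + int v))"
      by (simp add: sum_distrib_left mult.left_commute)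
    also have "[\<dots> = ?\<Pi> * 0] (mod int q)" by (intro cong_mult cong_refl z)
    finally show "r \<in> {r \<in> residues. int q dvd poly P r}" using r by (simp add: cong_0_iff)
  qed
  then have "card ?R \<le> card {r \<in> residues. int q dvd poly P r}"
    by (intro card_mono) (rule finite_subset[of _ residues], auto)
  also have "\<dots> \<le> degree P" by (rule card_roots_mod_prime_le[OF prime_int_q nz])
  finally show ?thesis using deg by simp
qed

text \<open>Equal multiplicities make every value of \<open>\<beta>'\<close> a value of
  \<open>\<beta>\<close>, so \<open>\<beta>'\<close> is \<open>\<beta>\<close> composed with one of
  the \<open>l ^ l\<close> self-maps of the indices.\<close>

lemma card_balanced_pairs_le:
  fixes B l :: nat
  defines "\<Phi> \<equiv> PiE {..<l} (\<lambda>_. {1..B})"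
  shows "card {(\<beta>, \<beta>') \<in> \<Phi> \<times> \<Phi>. \<forall>v. card {i \<in> {..<l}. \<beta> i = v} = card {i \<in> {..<l}. \<beta>' i = v}} \<le> l ^ l * B ^ l"
    (is "card ?S \<le> _")
proof -
  have fin: "finite \<Phi>" unfolding \<Phi>_def by (intro finite_PiE) auto
  let ?\<Sigma> = "PiE {..<l} (\<lambda>_. {..<l})"
  have "?S \<subseteq> (\<lambda>(\<beta>, \<sigma>). (\<beta>, restrict (\<beta> \<circ> \<sigma>) {..<l})) ` (\<Phi> \<times> ?\<Sigma>)"
  proof
    fix p assume p: "p \<in> ?S"
    obtain \<beta> \<beta>' where e: "p = (\<beta>, \<beta>')" by (cases p)
    have \<beta>: "\<beta> \<in> \<Phi>" "\<beta>' \<in> \<Phi>" and c: "\<And>v. card {i \<in> {..<l}. \<beta> i = v} = card {i \<in> {..<l}. \<beta>' i = v}"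
      using p e by auto
    have "\<exists>j<l. \<beta> j = \<beta>' i" if "i < l" for i
    proof -
      have "card {j \<in> {..<l}. \<beta>' j = \<beta>' i} \<noteq> 0" using that by auto
      then have "card {j \<in> {..<l}. \<beta> j = \<beta>' i} \<noteq> 0" using c by simp
      then have "{j \<in> {..<l}. \<beta> j = \<beta>' i} \<noteq> {}" by (metis card.empty)
      then show ?thesis by auto
    qed
    then obtain j where j: "\<And>i. i < l \<Longrightarrow> j i < l \<and> \<beta> (j i) = \<beta>' i" by metis
    let ?\<sigma> = "restrict j {..<l}"
    have "?\<sigma> \<in> ?\<Sigma>" using j by auto
    moreover have "\<beta>' = restrict (\<beta> \<circ> ?\<sigma>) {..<l}"
    proof
      fix i
      show "\<beta>' i = restrict (\<beta> \<circ> ?\<sigma>) {..<l} i"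
        using j[of i] \<beta>(2) by (cases "i < l") (auto simp: \<Phi>_def PiE_def extensional_def)
    qed
    ultimately show "p \<in> (\<lambda>(\<beta>, \<sigma>). (\<beta>, restrict (\<beta> \<circ> \<sigma>) {..<l})) ` (\<Phi> \<times> ?\<Sigma>)"
      using \<beta> e by (intro image_eqI[of _ _ "(\<beta>, ?\<sigma>)"]) auto
  qed
  then have "card ?S \<le> card ((\<lambda>(\<beta>, \<sigma>). (\<beta>, restrict (\<beta> \<circ> \<sigma>) {..<l})) ` (\<Phi> \<times> ?\<Sigma>))"
    by (intro card_mono finite_imageI finite_cartesian_product fin finite_PiE) auto
  also have "\<dots> \<le> card (\<Phi> \<times> ?\<Sigma>)" by (intro card_image_le finite_cartesian_product fin finite_PiE) auto
  also have "\<dots> = l ^ l * B ^ l" by (simp add: \<Phi>_def card_cartesian_product card_PiE)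
  finally show ?thesis .
qed

text \<open>Expanding the \<open>l\<close>-th power into tuples and summing over \<open>s\<close>
  leaves pairs of tuples with equal sums of inverse squares. A pair with different multiplicities
  allows at most \<open>4 * l\<close> residues \<open>r\<close>, which gives the first term; a
  balanced pair may allow all \<open>q\<close> residues, but such pairs are few, which gives the
  second.\<close>

lemma kern_moment_le:
  assumes "0 < l" "l < q" "B < q"
  shows "(\<Sum>r\<in>residues. \<Sum>s\<in>residues. norm (\<Sum>b = 1..B. kern s (r + int b)) ^ (2 * l))
    \<le> real q * (4 * real l * real B ^ (2 * l) + real l ^ l * real q * real B ^ l)"
proof -
  define \<Phi> where "\<Phi> = PiE {..<l} (\<lambda>_. {1..B})"
  define ok where "ok r \<beta> \<longleftrightarrow> (\<forall>i<l. \<not> int q dvd r + int (\<beta> i))" for r :: int and \<beta> :: "nat \<Rightarrow> nat"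
  define f where "f r \<beta> = (\<Sum>i<l. isq (r + int (\<beta> i)))" for r :: int and \<beta> :: "nat \<Rightarrow> nat"
  define eq where "eq r p \<longleftrightarrow> ok r (fst p) \<and> ok r (snd p) \<and> [f r (fst p) = f r (snd p)] (mod int q)" for r p
  define bal where "bal p \<longleftrightarrow> (\<forall>v. card {i \<in> {..<l}. fst p i = v} = card {i \<in> {..<l}. snd p i = v})"
    for p :: "(nat \<Rightarrow> nat) \<times> (nat \<Rightarrow> nat)"
  have fin: "finite \<Phi>" unfolding \<Phi>_def by (intro finite_PiE) auto
  have c\<Phi>: "card \<Phi> = B ^ l" by (simp add: \<Phi>_def card_PiE)
  have pow: "(\<Sum>b = 1..B. kern s (r + int b)) ^ l = (\<Sum>\<beta>\<in>{\<beta> \<in> \<Phi>. ok r \<beta>}. ee (s * f r \<beta>))" for r s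
  proof -
    have "(\<Sum>b = 1..B. kern s (r + int b)) ^ l = (\<Prod>i<l. \<Sum>b\<in>{1..B}. kern s (r + int b))" by simp
    also have "\<dots> = (\<Sum>\<beta>\<in>\<Phi>. \<Prod>i<l. kern s (r + int (\<beta> i)))"
      unfolding \<Phi>_def by (rule prod_sum_PiE) auto
    also have "\<dots> = (\<Sum>\<beta>\<in>\<Phi>. if ok r \<beta> then ee (s * f r \<beta>) else 0)"
    proof (rule sum.cong[OF refl])
      fix \<beta>
      show "(\<Prod>i<l. kern s (r + int (\<beta> i))) = (if ok r \<beta> then ee (s * f r \<beta>) else 0)"
      proof (cases "ok r \<beta>")
        case True
        then have "(\<Prod>i<l. kern s (r + int (\<beta> i))) = (\<Prod>i<l. ee (s * isq (r + int (\<beta> i))))"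
          by (intro prod.cong refl) (auto simp: ok_def kern_def)
        then show ?thesis using True by (simp add: f_def sum_distrib_left ee_sum)
      next
        case False
        then obtain i where "i < l" "int q dvd r + int (\<beta> i)" by (auto simp: ok_def)
        then have "(\<Prod>i<l. kern s (r + int (\<beta> i))) = 0"
          by (intro prod_zero bexI[of _ i]) (auto simp: kern_def)
        then show ?thesis using False by simp
      qed
    qed
    also have "\<dots> = (\<Sum>\<beta>\<in>{\<beta> \<in> \<Phi>. ok r \<beta>}. ee (s * f r \<beta>))"
      by (rule sum.inter_filter[symmetric, OF fin])
    finally show ?thesis .
  qed
  have "(\<Sum>s\<in>residues. norm (\<Sum>b = 1..B. kern s (r + int b)) ^ (2 * l)) = real q * (\<Sum>p\<in>\<Phi> \<times> \<Phi>. if eq r p then 1 else 0)" for r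
  proof -
    have "(\<Sum>s\<in>residues. norm (\<Sum>b = 1..B. kern s (r + int b)) ^ (2 * l))
      = (\<Sum>s\<in>residues. (norm (\<Sum>\<beta>\<in>{\<beta> \<in> \<Phi>. ok r \<beta>}. ee (s * f r \<beta>)))\<^sup>2)"
      by (simp flip: pow add: norm_power power_even_eq)
    also have "\<dots> = real q * real (card {(t, t') \<in> {\<beta> \<in> \<Phi>. ok r \<beta>} \<times> {\<beta> \<in> \<Phi>. ok r \<beta>}. [f r t = f r t'] (mod int q)})"
      using fin by (intro sum_residues_norm_square) auto
    also have "{(t, t') \<in> {\<beta> \<in> \<Phi>. ok r \<beta>} \<times> {\<beta> \<in> \<Phi>. ok r \<beta>}. [f r t = f r t'] (mod int q)} = {p \<in> \<Phi> \<times> \<Phi>. eq r p}"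
      by (auto simp: eq_def)
    also have "real (card {p \<in> \<Phi> \<times> \<Phi>. eq r p}) = (\<Sum>p\<in>{p \<in> \<Phi> \<times> \<Phi>. eq r p}. 1)" by simp
    also have "\<dots> = (\<Sum>p\<in>\<Phi> \<times> \<Phi>. if eq r p then 1 else 0)"
      using fin by (intro sum.inter_filter) auto
    finally show ?thesis .
  qed
  then have M: "(\<Sum>r\<in>residues. \<Sum>s\<in>residues. norm (\<Sum>b = 1..B. kern s (r + int b)) ^ (2 * l))
    = real q * (\<Sum>r\<in>residues. \<Sum>p\<in>\<Phi> \<times> \<Phi>. if eq r p then 1 else 0)"
    by (simp add: sum_distrib_left)
  have "(\<Sum>r\<in>residues. \<Sum>p\<in>\<Phi> \<times> \<Phi>. if eq r p then 1 else 0) = (\<Sum>p\<in>\<Phi> \<times> \<Phi>. real (card {r \<in> residues. eq r p}))"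
  proof -
    have "(\<Sum>r\<in>residues. if eq r p then 1 else 0) = real (card {r \<in> residues. eq r p})" for p
      using sum.inter_filter[of residues "\<lambda>_. 1 :: real" "\<lambda>r. eq r p"] by simp
    then show ?thesis by (subst sum.swap) simp
  qed
  also have "\<dots> \<le> (\<Sum>p\<in>\<Phi> \<times> \<Phi>. real (4 * l) + (if bal p then real q else 0))"
  proof (rule sum_mono)
    fix p assume p: "p \<in> \<Phi> \<times> \<Phi>"
    show "real (card {r \<in> residues. eq r p}) \<le> real (4 * l) + (if bal p then real q else 0)"
    proof (cases "bal p")
      case True
      have "card {r \<in> residues. eq r p} \<le> card residues" by (intro card_mono) auto
      then show ?thesis using True by simp
    next
      case False
      then obtain v0 where "card {i \<in> {..<l}. fst p i = v0} \<noteq> card {i \<in> {..<l}. snd p i = v0}"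
        by (auto simp: bal_def)
      moreover have "fst p i < q" "snd p i < q" if "i < l" for i
      proof -
        have "fst p \<in> \<Phi>" "snd p \<in> \<Phi>" using p by (simp_all add: mem_Times_iff)
        then have "fst p i \<in> {1..B}" "snd p i \<in> {1..B}" using that unfolding \<Phi>_def by (auto dest!: PiE_mem[where x = i])
        then show "fst p i < q" "snd p i < q" using assms(3) by simp_all
      qed
      ultimately have "card {r \<in> residues. eq r p} \<le> 4 * l"
        using sum_isq_cong_roots[of l "fst p" "snd p" v0] assms(1,2) unfolding eq_def ok_def f_def by simp
      then show ?thesis using False by simp
    qed
  qed
  also have "\<dots> = 4 * real l * real B ^ (2 * l) + real q * real (card {p \<in> \<Phi> \<times> \<Phi>. bal p})"
  proof -
    have "(\<Sum>p\<in>\<Phi> \<times> \<Phi>. if bal p then real q else 0) = (\<Sum>p\<in>{p \<in> \<Phi> \<times> \<Phi>. bal p}. real q)"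
      using fin by (intro sum.inter_filter[symmetric]) auto
    then show ?thesis
      by (simp add: sum.distrib card_cartesian_product c\<Phi> power_even_eq power2_eq_square)
  qed
  also have "\<dots> \<le> 4 * real l * real B ^ (2 * l) + real q * (real l ^ l * real B ^ l)"
  proof -
    have "{p \<in> \<Phi> \<times> \<Phi>. bal p} = {(\<beta>, \<beta>') \<in> \<Phi> \<times> \<Phi>. \<forall>v. card {i \<in> {..<l}. \<beta> i = v} = card {i \<in> {..<l}. \<beta>' i = v}}"
      by (auto simp: bal_def)
    then have "card {p \<in> \<Phi> \<times> \<Phi>. bal p} \<le> l ^ l * B ^ l"
      using card_balanced_pairs_le[of l B] by (simp add: \<Phi>_def)
    then have "real (card {p \<in> \<Phi> \<times> \<Phi>. bal p}) \<le> real (l ^ l * B ^ l)" by (rule of_nat_mono)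
    then show ?thesis by (intro add_left_mono mult_left_mono) simp_all
  qed
  finally have "(\<Sum>r\<in>residues. \<Sum>p\<in>\<Phi> \<times> \<Phi>. if eq r p then 1 else 0)
    \<le> 4 * real l * real B ^ (2 * l) + real l ^ l * real q * real B ^ l" by (simp only: mult_ac)
  then show ?thesis unfolding M by (intro mult_left_mono) simp_all
qed

end

section \<open>The shift estimate\<close>

context modulus
begin

text \<open>Averaging over the shifts \<open>a * b\<close> costs only the edge effects. The number
  of coincidences of \<open>\<phi>\<close> is nearly as small as the number of triples
  \<open>(n, a, m)\<close>: equal ratios \<open>m / a\<close> force a multiplicative relation
  between integers below \<open>q\<close>, and then the second coordinate determines
  \<open>n'\<close> by injectivity of \<open>c\<close>. The bound on \<open>T\<close> stays in 16th
  powers, so that no root is taken before the parameters are chosen.\<close>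

lemma shift_sum_le:
  fixes c :: "'a \<Rightarrow> int" and lo hi :: "'a \<Rightarrow> nat"
  assumes fin: "finite N"
    and inj: "\<And>n n'. n \<in> N \<Longrightarrow> n' \<in> N \<Longrightarrow> [c n = c n'] (mod int q) \<Longrightarrow> n = n'"
    and hi: "\<And>n. n \<in> N \<Longrightarrow> hi n \<le> M"
    and AB: "1 \<le> A" "1 \<le> B" "1 \<le> M" "A * M < q" "B < q" "8 < q"
  obtains T where "0 \<le> T"
    "(\<Sum>n\<in>N. norm (\<Sum>m\<in>{lo n<..hi n}. kern (c n) (int m))) \<le> 2 * real A * real B * real (card N) + T / (real A * real B)"
    "T ^ 16 \<le> (real A * real M * real (card N)) ^ 15 * (1 + ln (real A))\<^sup>2
      * (real q * (32 * real B ^ 16 + 8 ^ 8 * real q * real B ^ 8))"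
proof -
  define \<Omega> where "\<Omega> = (SIGMA n:N. {1..A} \<times> {lo n<..hi n})"
  \<comment> \<open>By Fermat's theorem \<open>int a ^ (q - 2)\<close> inverts \<open>a\<close>, so
    \<open>\<rho> a m\<close> is the ratio \<open>m / a\<close> modulo \<open>q\<close>; likewise
    \<open>\<sigma> n a\<close> is \<open>c n\<close> over the square of \<open>a\<close>.\<close>
  define \<rho> where "\<rho> a m = (int m * int a ^ (q - 2)) mod int q" for a m :: nat
  define \<sigma> where "\<sigma> n a = (c n * isq (int a)) mod int q" for n and a :: nat
  define \<phi> where "\<phi> = (\<lambda>(n, a, m). (\<rho> a m, \<sigma> n a))"
  define G where "G = (\<lambda>(r, s). norm (\<Sum>b = 1..B. kern s (r + int b)))"
  define T where "T = (\<Sum>\<omega>\<in>\<Omega>. G (\<phi> \<omega>))"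
  have A_lt: "a < q" if "a \<le> A" for a
  proof -
    have "a \<le> A * M" using that AB(3) by (metis le_trans mult.right_neutral mult_le_mono2)
    then show ?thesis using AB(4) by simp
  qed
  have a_unit: "\<not> int q dvd int a" if "a \<in> {1..A}" for a
    using that A_lt[of a] by (intro not_dvd_units) auto
  have a_inv: "[int a * int a ^ (q - 2) = 1] (mod int q)" if "a \<in> {1..A}" for a
  proof -
    have "int a * int a ^ (q - 2) = int a ^ (q - 1)"
    proof -
      have "q - 1 = Suc (q - 2)" using q_gt_3 by simp
      then show ?thesis by (simp only: power_Suc)
    qed
    then show ?thesis using fermat_int[OF a_unit[OF that]] by simp
  qed
  have kern_shift: "kern (c n) (int (m + a * b)) = kern (\<sigma> n a) (\<rho> a m + int b)" if a: "a \<in> {1..A}" for n a m b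
  proof -
    have "[\<rho> a m = int m * int a ^ (q - 2)] (mod int q)" by (simp add: \<rho>_def cong_def)
    then have "[int a * (\<rho> a m + int b) = int a * (int m * int a ^ (q - 2) + int b)] (mod int q)"
      by (intro cong_mult cong_add cong_refl)
    also have "int a * (int m * int a ^ (q - 2) + int b) = int m * (int a * int a ^ (q - 2)) + int a * int b"
      by (simp add: algebra_simps)
    also have "[\<dots> = int m * 1 + int a * int b] (mod int q)"
      by (intro cong_add cong_mult cong_refl a_inv a)
    finally have "[int (m + a * b) = int a * (\<rho> a m + int b)] (mod int q)" by (simp add: cong_sym)
    then have "kern (c n) (int (m + a * b)) = kern (c n) (int a * (\<rho> a m + int b))"
      by (intro kern_cong cong_refl)
    also have "\<dots> = kern (c n * isq (int a)) (\<rho> a m + int b)" by (rule kern_mult[OF a_unit[OF a]])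
    also have "\<dots> = kern (\<sigma> n a) (\<rho> a m + int b)"
      by (intro kern_cong cong_refl) (simp add: \<sigma>_def cong_def)
    finally show ?thesis .
  qed
  have one: "real A * real B * norm (\<Sum>m\<in>{lo n<..hi n}. kern (c n) (int m))
    \<le> (\<Sum>a = 1..A. \<Sum>m\<in>{lo n<..hi n}. G (\<phi> (n, a, m))) + 2 * (real A * real B)\<^sup>2" for n
  proof -
    let ?S = "\<lambda>h. \<Sum>m\<in>{lo n<..hi n}. kern (c n) (int (m + h))"
    have "of_nat A * of_nat B * ?S 0 = (\<Sum>a = 1..A. \<Sum>b = 1..B. ?S (a * b)) - (\<Sum>a = 1..A. \<Sum>b = 1..B. (?S (a * b) - ?S 0))"
      by (simp add: sum_subtractf)
    then have 1: "norm (of_nat A * of_nat B * ?S 0)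
      \<le> norm (\<Sum>a = 1..A. \<Sum>b = 1..B. ?S (a * b)) + norm (\<Sum>a = 1..A. \<Sum>b = 1..B. (?S (a * b) - ?S 0))"
      by (simp only: norm_triangle_ineq4)
    have "norm (\<Sum>a = 1..A. \<Sum>b = 1..B. (?S (a * b) - ?S 0)) \<le> (\<Sum>a = 1..A. \<Sum>b = 1..B. 2 * (real A * real B))"
    proof (intro sum_norm_le)
      fix a b assume ab: "a \<in> {1..A}" "b \<in> {1..B}"
      have "norm (?S (a * b) - ?S 0) \<le> 2 * real (a * b)"
        using norm_sum_shift_le[where f = "\<lambda>m. kern (c n) (int m)" and u = "lo n" and v = "hi n" and h = "a * b", OF norm_kern_le]
        by (simp only: add_0_right)
      also have "\<dots> \<le> 2 * (real A * real B)" using ab by (simp add: mult_mono)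
      finally show "norm (?S (a * b) - ?S 0) \<le> 2 * (real A * real B)" .
    qed
    moreover have "(\<Sum>a = 1..A. \<Sum>b = 1..B. 2 * (real A * real B)) = 2 * (real A * real B)\<^sup>2"
      by (simp add: power2_eq_square)
    moreover have "norm (\<Sum>a = 1..A. \<Sum>b = 1..B. ?S (a * b)) \<le> (\<Sum>a = 1..A. \<Sum>m\<in>{lo n<..hi n}. G (\<phi> (n, a, m)))"
    proof (rule sum_norm_le)
      fix a assume a: "a \<in> {1..A}"
      have "(\<Sum>b = 1..B. ?S (a * b)) = (\<Sum>m\<in>{lo n<..hi n}. \<Sum>b = 1..B. kern (\<sigma> n a) (\<rho> a m + int b))"
        unfolding kern_shift[OF a] by (rule sum.swap)
      then show "norm (\<Sum>b = 1..B. ?S (a * b)) \<le> (\<Sum>m\<in>{lo n<..hi n}. G (\<phi> (n, a, m)))"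
        by (simp only: G_def \<phi>_def prod.case) (rule norm_sum)
    qed
    ultimately have "norm (of_nat A * of_nat B * ?S 0)
      \<le> (\<Sum>a = 1..A. \<Sum>m\<in>{lo n<..hi n}. G (\<phi> (n, a, m))) + 2 * (real A * real B)\<^sup>2"
      using 1 by linarith
    then show ?thesis by (simp add: norm_mult)
  qed
  have T: "T = (\<Sum>n\<in>N. \<Sum>a = 1..A. \<Sum>m\<in>{lo n<..hi n}. G (\<phi> (n, a, m)))"
    using fin by (simp add: T_def \<Omega>_def sum.Sigma sum.cartesian_product)
  have T0: "0 \<le> T" unfolding T_def G_def by (intro sum_nonneg) (auto split: prod.splits)
  have "real A * real B * (\<Sum>n\<in>N. norm (\<Sum>m\<in>{lo n<..hi n}. kern (c n) (int m)))
    \<le> (\<Sum>n\<in>N. (\<Sum>a = 1..A. \<Sum>m\<in>{lo n<..hi n}. G (\<phi> (n, a, m))) + 2 * (real A * real B)\<^sup>2)"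
    unfolding sum_distrib_left by (intro sum_mono one)
  also have "\<dots> = T + real (card N) * (2 * (real A * real B)\<^sup>2)" by (simp add: T sum.distrib)
  finally have main: "(\<Sum>n\<in>N. norm (\<Sum>m\<in>{lo n<..hi n}. kern (c n) (int m)))
    \<le> 2 * real A * real B * real (card N) + T / (real A * real B)"
    using AB by (simp add: field_simps power2_eq_square)
  have fin\<Omega>: "finite \<Omega>" using fin by (simp add: \<Omega>_def)
  let ?Z = "residues \<times> residues"
  have im: "\<phi> ` \<Omega> \<subseteq> ?Z" using q_pos by (auto simp: \<phi>_def \<rho>_def \<sigma>_def)
  \<comment> \<open>The choice \<open>j = 3\<close> gives the exponent
    \<open>2 * 2 ^ 3 = 16\<close>.\<close>
  have Hol: "T ^ 16 \<le> real (card \<Omega>) ^ 14 * real (card {(x, y) \<in> \<Omega> \<times> \<Omega>. \<phi> x = \<phi> y}) * (\<Sum>z\<in>?Z. G z ^ 16)"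
    using sum_map_Holder[OF fin\<Omega> _ im, of G 3] unfolding T_def by (auto simp: G_def)
  have "card \<Omega> = (\<Sum>n\<in>N. A * (hi n - lo n))" using fin by (simp add: \<Omega>_def)
  also have "\<dots> \<le> (\<Sum>n\<in>N. A * M)"
  proof (intro sum_mono mult_left_mono)
    fix n assume "n \<in> N"
    then show "hi n - lo n \<le> M" using hi[of n] by linarith
  qed simp
  finally have card\<Omega>: "card \<Omega> \<le> A * M * card N" by (simp add: mult.commute)
  let ?Q = "{((a, m), (a', m')) \<in> ({1..A} \<times> {1..M}) \<times> ({1..A} \<times> {1..M}). m * a' = m' * a}"
  have "card {(x, y) \<in> \<Omega> \<times> \<Omega>. \<phi> x = \<phi> y} \<le> card (N \<times> ?Q)"
  proof (rule card_inj_on_le)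
    let ?f = "\<lambda>((n, a, m), (n', a', m')). (n, ((a, m), (a', m')))"
    have key: "m * a' = m' * a \<and> [c n' * isq (int a') = c n * isq (int a)] (mod int q)"
      if "(n, a, m) \<in> \<Omega>" "(n', a', m') \<in> \<Omega>" "\<phi> (n, a, m) = \<phi> (n', a', m')" for n a m n' a' m'
    proof
      have r: "\<rho> a m = \<rho> a' m'" and s: "\<sigma> n a = \<sigma> n' a'" using that(3) by (simp_all add: \<phi>_def)
      have a: "a \<in> {1..A}" "a' \<in> {1..A}" and m: "m \<le> M" "m' \<le> M"
        using that(1,2) hi[of n] hi[of n'] by (simp_all add: \<Omega>_def)
      show "[c n' * isq (int a') = c n * isq (int a)] (mod int q)"
        using s by (simp add: \<sigma>_def cong_def)
      have x: "[int m * int a' = int a * int a' * \<rho> a m] (mod int q)" if "a \<in> {1..A}" for a a' m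
      proof -
        have "[int a * int a' * \<rho> a m = int a * int a' * (int m * int a ^ (q - 2))] (mod int q)"
          by (intro cong_mult cong_refl) (simp add: \<rho>_def cong_def)
        also have "int a * int a' * (int m * int a ^ (q - 2)) = (int a * int a ^ (q - 2)) * (int m * int a')"
          by (simp add: algebra_simps)
        also have "[\<dots> = 1 * (int m * int a')] (mod int q)" by (intro cong_mult cong_refl a_inv that)
        finally show ?thesis by (simp add: cong_sym)
      qed
      have "[int m * int a' = int m' * int a] (mod int q)"
        using x[OF a(1), of m a'] x[OF a(2), of m' a] r
        by (simp add: mult.commute[of "int a"] cong_def)
      then have "[m * a' = m' * a] (mod q)" by (metis cong_int_iff of_nat_mult)
      \<comment> \<open>Here \<open>A * M < q\<close> turns the congruence into an equality of
        integers.\<close>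
      moreover have "m * a' < q" "m' * a < q"
      proof -
        have "m * a' \<le> M * A" "m' * a \<le> M * A" using a m by (auto intro!: mult_mono)
        then show "m * a' < q" "m' * a < q" using AB(4) by (simp_all add: mult.commute)
      qed
      ultimately show "m * a' = m' * a" by (simp add: cong_def)
    qed
    show "inj_on ?f {(x, y) \<in> \<Omega> \<times> \<Omega>. \<phi> x = \<phi> y}"
    proof (rule inj_onI)
      fix p1 p2 assume p: "p1 \<in> {(x, y) \<in> \<Omega> \<times> \<Omega>. \<phi> x = \<phi> y}" "p2 \<in> {(x, y) \<in> \<Omega> \<times> \<Omega>. \<phi> x = \<phi> y}" "?f p1 = ?f p2"
      obtain n a m n1 a' m' where p1: "p1 = ((n, a, m), (n1, a', m'))" by (metis surj_pair)
      then obtain n2 where p2: "p2 = ((n, a, m), (n2, a', m'))" using p(3) by (cases p2) auto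
      have "[c n1 * isq (int a') = c n * isq (int a)] (mod int q)" "[c n2 * isq (int a') = c n * isq (int a)] (mod int q)"
        using p p1 p2 key by blast+
      then have "[isq (int a') * c n1 = isq (int a') * c n2] (mod int q)"
        by (metis cong_sym cong_trans mult.commute)
      moreover have "a' \<in> {1..A}" "n1 \<in> N" "n2 \<in> N" using p p1 p2 by (auto simp: \<Omega>_def)
      ultimately have "n1 = n2"
        using a_unit[of a'] inj[of n1 n2] cong_cancel_unit dvd_isq_iff by metis
      then show "p1 = p2" using p1 p2 by simp
    qed
    show "?f ` {(x, y) \<in> \<Omega> \<times> \<Omega>. \<phi> x = \<phi> y} \<subseteq> N \<times> ?Q"
    proof (rule image_subsetI)
      fix p assume p: "p \<in> {(x, y) \<in> \<Omega> \<times> \<Omega>. \<phi> x = \<phi> y}"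
      obtain n a m n' a' m' where e: "p = ((n, a, m), (n', a', m'))" by (metis surj_pair)
      have "n \<in> N" "a \<in> {1..A}" "a' \<in> {1..A}" "1 \<le> m" "1 \<le> m'" "m \<le> M" "m' \<le> M"
        using p e hi[of n] hi[of n'] by (simp_all add: \<Omega>_def)
      moreover have "m * a' = m' * a" using p e key by blast
      ultimately show "?f p \<in> N \<times> ?Q" using e by simp
    qed
    show "finite (N \<times> ?Q)"
      using fin by (intro finite_cartesian_product finite_subset[of ?Q "({1..A} \<times> {1..M}) \<times> ({1..A} \<times> {1..M})"]) auto
  qed
  then have "real (card {(x, y) \<in> \<Omega> \<times> \<Omega>. \<phi> x = \<phi> y}) \<le> real (card N) * real (card ?Q)"
    by (simp only: card_cartesian_product of_nat_le_iff flip: of_nat_mult)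
  also have "\<dots> \<le> real (card N) * (real A * real M * (1 + ln (real A))\<^sup>2)"
    by (intro mult_left_mono card_proportional_quadruples_le AB) auto
  finally have pairs: "real (card {(x, y) \<in> \<Omega> \<times> \<Omega>. \<phi> x = \<phi> y}) \<le> real (card N) * (real A * real M * (1 + ln (real A))\<^sup>2)" .
  have "(\<Sum>z\<in>?Z. G z ^ 16) = (\<Sum>r\<in>residues. \<Sum>s\<in>residues. norm (\<Sum>b = 1..B. kern s (r + int b)) ^ (2 * 8))"
    by (simp add: G_def sum.cartesian_product case_prod_unfold)
  also have "\<dots> \<le> real q * (4 * real 8 * real B ^ (2 * 8) + real 8 ^ 8 * real q * real B ^ 8)"
    by (rule kern_moment_le) (use AB in auto)
  finally have mom: "(\<Sum>z\<in>?Z. G z ^ 16) \<le> real q * (32 * real B ^ 16 + 8 ^ 8 * real q * real B ^ 8)" by simp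
  have "T ^ 16 \<le> real (card \<Omega>) ^ 14 * real (card {(x, y) \<in> \<Omega> \<times> \<Omega>. \<phi> x = \<phi> y}) * (\<Sum>z\<in>?Z. G z ^ 16)"
    by (rule Hol)
  also have "\<dots> \<le> (real A * real M * real (card N)) ^ 14 * (real (card N) * (real A * real M * (1 + ln (real A))\<^sup>2))
      * (real q * (32 * real B ^ 16 + 8 ^ 8 * real q * real B ^ 8))"
  proof (intro mult_mono power_mono pairs mom)
    show "real (card \<Omega>) \<le> real A * real M * real (card N)"
      using of_nat_mono[OF card\<Omega>, where 'a = real] by simp
    show "0 \<le> (\<Sum>z\<in>?Z. G z ^ 16)" by (intro sum_nonneg) (auto simp: G_def)
  qed auto
  also have "(real A * real M * real (card N)) ^ 14 * (real (card N) * (real A * real M * (1 + ln (real A))\<^sup>2))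
    = (real A * real M * real (card N)) ^ 15 * (1 + ln (real A))\<^sup>2"
    by (simp add: power_numeral_reduce)
  finally show ?thesis using that T0 main by blast
qed

text \<open>For \<open>q \<le> B ^ 8\<close> both terms of the moment are of size
  \<open>B ^ 16\<close>. The condition on \<open>\<kappa>\<close> is then what remains of the 16th
  power of the desired inequality, in which \<open>\<kappa>\<close> is the gain over the trivial
  bound \<open>M * card N\<close>.\<close>

lemma shift_sum_saving:
  fixes c :: "'a \<Rightarrow> int" and lo hi :: "'a \<Rightarrow> nat"
  assumes fin: "finite N"
    and inj: "\<And>n n'. n \<in> N \<Longrightarrow> n' \<in> N \<Longrightarrow> [c n = c n'] (mod int q) \<Longrightarrow> n = n'"
    and hi: "\<And>n. n \<in> N \<Longrightarrow> hi n \<le> M"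
    and AB: "1 \<le> A" "1 \<le> B" "1 \<le> M" "A * M < q" "B < q" "8 < q" "q \<le> B ^ 8"
    and \<kappa>: "0 \<le> \<kappa>" "2 ^ 25 * (1 + ln (real A))\<^sup>2 * real q \<le> \<kappa> ^ 16 * (real A * real M * real (card N))"
  shows "(\<Sum>n\<in>N. norm (\<Sum>m\<in>{lo n<..hi n}. kern (c n) (int m)))
    \<le> 2 * real A * real B * real (card N) + \<kappa> * real M * real (card N)"
proof -
  let ?V = "real A * real M * real (card N)" and ?L = "(1 + ln (real A))\<^sup>2"
  obtain T where T: "0 \<le> T"
    "(\<Sum>n\<in>N. norm (\<Sum>m\<in>{lo n<..hi n}. kern (c n) (int m))) \<le> 2 * real A * real B * real (card N) + T / (real A * real B)"
    "T ^ 16 \<le> ?V ^ 15 * ?L * (real q * (32 * real B ^ 16 + 8 ^ 8 * real q * real B ^ 8))"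
    by (rule shift_sum_le[where c = c and lo = lo and hi = hi, OF fin inj hi AB(1-6)])
  have "real q \<le> real B ^ 8" using AB(7) by (simp only: of_nat_le_iff flip: of_nat_power)
  then have "8 ^ 8 * real q * real B ^ 8 \<le> 8 ^ 8 * real B ^ 8 * real B ^ 8"
    by (intro mult_mono) auto
  also have "\<dots> = 8 ^ 8 * real B ^ 16" by (simp flip: power_add)
  \<comment> \<open>Since \<open>8 ^ 8 = 2 ^ 24\<close>, the constant \<open>2 ^ 25\<close> covers
    both terms.\<close>
  also have "32 * real B ^ 16 + 8 ^ 8 * real B ^ 16 \<le> 2 ^ 25 * real B ^ 16"
    unfolding distrib_right[symmetric] by (rule mult_right_mono) auto
  finally have "32 * real B ^ 16 + 8 ^ 8 * real q * real B ^ 8 \<le> 2 ^ 25 * real B ^ 16" by simp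
  then have "T ^ 16 \<le> ?V ^ 15 * ?L * (real q * (2 ^ 25 * real B ^ 16))"
    by (intro order.trans[OF T(3)] mult_left_mono) auto
  also have "\<dots> = ?V ^ 15 * real B ^ 16 * (2 ^ 25 * ?L * real q)" by (simp only: mult_ac)
  also have "\<dots> \<le> ?V ^ 15 * real B ^ 16 * (\<kappa> ^ 16 * ?V)" by (intro mult_left_mono \<kappa>) auto
  also have "\<dots> = (\<kappa> * ?V * real B) ^ 16" by (simp add: power_mult_distrib power_numeral_reduce)
  finally have "T \<le> \<kappa> * ?V * real B" by (subst (asm) power_mono_iff) (use T \<kappa> in auto)
  then have "T / (real A * real B) \<le> \<kappa> * ?V * real B / (real A * real B)" by (intro divide_right_mono) auto
  also have "\<dots> = \<kappa> * real M * real (card N)" using AB by (simp add: field_simps)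
  finally show ?thesis using T(2) by linarith
qed

end

section \<open>Correlations of bilinear forms\<close>

context modulus
begin

lemma kern_uminus: "kern (- c) x = cnj (kern c x)"
  by (simp add: kern_def cnj_ee)

lemma kern_mult_cnj:
  "kern c (int (m * n)) * cnj (kern c (int (m * n')))
    = (if q dvd n \<or> q dvd n' then 0 else kern (c * (isq (int n) - isq (int n'))) (int m))"
proof (cases "q dvd m \<or> q dvd n \<or> q dvd n'")
  case True
  then show ?thesis by (auto simp: kern_def prime_dvd_mult_iff[OF prime_int_q])
next
  case False
  then show ?thesis
    by (simp add: kern_def prime_dvd_mult_iff[OF prime_int_q] isq_mult algebra_simps flip: ee_minus)
qed

text \<open>The inner sum left by the Cauchy--Schwarz inequality: the hyperbolic conditions
  \<open>m * n \<le> D\<close> and \<open>m * n' \<le> D\<close> become upper limits for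
  \<open>m\<close>.\<close>

definition kern_corr :: "int \<Rightarrow> nat \<Rightarrow> nat \<Rightarrow> nat \<Rightarrow> nat \<Rightarrow> complex" where
  "kern_corr c D M n n' = (if q dvd n \<or> q dvd n' then 0
    else \<Sum>m\<in>{M<..min (2 * M) (min (D div n) (D div n'))}. kern (c * (isq (int n) - isq (int n'))) (int m))"

lemma norm_kern_corr_commute: "norm (kern_corr c D M n n') = norm (kern_corr c D M n' n)"
proof -
  have "kern (c * (isq (int n) - isq (int n'))) x = cnj (kern (c * (isq (int n') - isq (int n))) x)" for x
    unfolding kern_uminus[symmetric] by (rule arg_cong2[where f = kern]) (auto simp: algebra_simps)
  then have "kern_corr c D M n n' = cnj (kern_corr c D M n' n)"
    by (simp add: kern_corr_def cnj_sum min.commute[of "D div n"])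
  then show ?thesis by simp
qed

text \<open>After the Cauchy--Schwarz inequality in \<open>m\<close>, the product
  \<open>\<beta> n * \<beta> n'\<close> is replaced by the mean of the squares. By the symmetry of
  the correlations it is enough to bound row sums, and \<open>\<beta>\<close> enters only through
  its second moment.\<close>

lemma bilinear_Cauchy:
  fixes \<alpha> \<beta> :: "nat \<Rightarrow> real"
  assumes E: "\<And>n. n \<in> {N<..2 * N} \<Longrightarrow> (\<Sum>n'\<in>{N<..2 * N}. norm (kern_corr c D M n n')) \<le> E"
  shows "(norm (\<Sum>m\<in>{M<..2 * M}. \<Sum>n\<in>{N<..2 * N}. if m * n \<le> D then of_real (\<alpha> m * \<beta> n) * kern c (int (m * n)) else 0))\<^sup>2
    \<le> (\<Sum>m\<in>{M<..2 * M}. (\<alpha> m)\<^sup>2) * ((\<Sum>n\<in>{N<..2 * N}. (\<beta> n)\<^sup>2) * E)"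
proof -
  let ?I = "{N<..2 * N}" and ?J = "{M<..2 * M}"
  define h where "h m n = (if m * n \<le> D then of_real (\<beta> n) * kern c (int (m * n)) else 0)" for m n
  define F where "F m = (\<Sum>n\<in>?I. h m n)" for m
  have "norm (\<Sum>m\<in>?J. \<Sum>n\<in>?I. if m * n \<le> D then of_real (\<alpha> m * \<beta> n) * kern c (int (m * n)) else 0)
    = norm (\<Sum>m\<in>?J. of_real (\<alpha> m) * F m)"
    unfolding F_def h_def sum_distrib_left by (intro arg_cong[where f = norm] sum.cong refl) auto
  also have "\<dots> \<le> (\<Sum>m\<in>?J. \<bar>\<alpha> m\<bar> * norm (F m))"
    by (intro sum_norm_le) (simp add: norm_mult)
  finally have "(norm (\<Sum>m\<in>?J. \<Sum>n\<in>?I. if m * n \<le> D then of_real (\<alpha> m * \<beta> n) * kern c (int (m * n)) else 0))\<^sup>2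
    \<le> (\<Sum>m\<in>?J. \<bar>\<alpha> m\<bar> * norm (F m))\<^sup>2" by (intro power_mono) auto
  also have "\<dots> \<le> (\<Sum>m\<in>?J. \<bar>\<alpha> m\<bar>\<^sup>2) * (\<Sum>m\<in>?J. (norm (F m))\<^sup>2)"
    by (rule Cauchy_Schwarz_ineq_sum)
  finally have CS: "(norm (\<Sum>m\<in>?J. \<Sum>n\<in>?I. if m * n \<le> D then of_real (\<alpha> m * \<beta> n) * kern c (int (m * n)) else 0))\<^sup>2
    \<le> (\<Sum>m\<in>?J. (\<alpha> m)\<^sup>2) * (\<Sum>m\<in>?J. (norm (F m))\<^sup>2)" by simp
  have "complex_of_real (\<Sum>m\<in>?J. (norm (F m))\<^sup>2) = (\<Sum>m\<in>?J. \<Sum>n\<in>?I. \<Sum>n'\<in>?I. h m n * cnj (h m n'))"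
    unfolding of_real_sum F_def norm_sum_square_eq by (simp add: sum.cartesian_product)
  also have "\<dots> = (\<Sum>n\<in>?I. \<Sum>n'\<in>?I. \<Sum>m\<in>?J. h m n * cnj (h m n'))"
    by (subst sum.swap, rule sum.cong[OF refl], rule sum.swap)
  also have "\<dots> = (\<Sum>n\<in>?I. \<Sum>n'\<in>?I. of_real (\<beta> n * \<beta> n') * kern_corr c D M n n')"
  proof (intro sum.cong refl)
    fix n n' assume n: "n \<in> ?I" "n' \<in> ?I"
    then have pos: "n > 0" "n' > 0" by auto
    let ?H = "min (2 * M) (min (D div n) (D div n'))"
    have "(\<Sum>m\<in>?J. h m n * cnj (h m n'))
      = (\<Sum>m\<in>?J. if m \<in> {M<..?H} then of_real (\<beta> n * \<beta> n') * (kern c (int (m * n)) * cnj (kern c (int (m * n')))) else 0)"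
    proof (intro sum.cong refl)
      fix m assume m: "m \<in> ?J"
      have "m * n \<le> D \<and> m * n' \<le> D \<longleftrightarrow> m \<in> {M<..?H}"
        using m pos by (auto simp: less_eq_div_iff_mult_less_eq)
      then show "h m n * cnj (h m n') = (if m \<in> {M<..?H} then of_real (\<beta> n * \<beta> n') * (kern c (int (m * n)) * cnj (kern c (int (m * n')))) else 0)"
        unfolding h_def by (auto simp del: of_nat_mult)
    qed
    also have "\<dots> = (\<Sum>m\<in>?J \<inter> {M<..?H}. of_real (\<beta> n * \<beta> n') * (kern c (int (m * n)) * cnj (kern c (int (m * n')))))"
      by (rule sum.inter_restrict[symmetric]) simp
    also have "?J \<inter> {M<..?H} = {M<..?H}" by auto
    also have "(\<Sum>m\<in>{M<..?H}. of_real (\<beta> n * \<beta> n') * (kern c (int (m * n)) * cnj (kern c (int (m * n')))))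
      = of_real (\<beta> n * \<beta> n') * kern_corr c D M n n'"
      unfolding kern_mult_cnj kern_corr_def sum_distrib_left[symmetric] by simp
    finally show "(\<Sum>m\<in>?J. h m n * cnj (h m n')) = of_real (\<beta> n * \<beta> n') * kern_corr c D M n n'" .
  qed
  finally have "norm (complex_of_real (\<Sum>m\<in>?J. (norm (F m))\<^sup>2)) = norm (\<Sum>n\<in>?I. \<Sum>n'\<in>?I. of_real (\<beta> n * \<beta> n') * kern_corr c D M n n')"
    by (rule arg_cong)
  then have "(\<Sum>m\<in>?J. (norm (F m))\<^sup>2) = norm (\<Sum>n\<in>?I. \<Sum>n'\<in>?I. of_real (\<beta> n * \<beta> n') * kern_corr c D M n n')"
    by (simp only: norm_of_real) (simp add: sum_nonneg)
  also have "\<dots> \<le> (\<Sum>n\<in>?I. \<Sum>n'\<in>?I. ((\<beta> n)\<^sup>2 / 2) * norm (kern_corr c D M n n') + ((\<beta> n')\<^sup>2 / 2) * norm (kern_corr c D M n' n))"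
  proof (intro sum_norm_le)
    fix n n'
    have "\<bar>\<beta> n * \<beta> n'\<bar> \<le> (\<beta> n)\<^sup>2 / 2 + (\<beta> n')\<^sup>2 / 2"
    proof -
      have "0 \<le> (\<bar>\<beta> n\<bar> - \<bar>\<beta> n'\<bar>)\<^sup>2" by simp
      then show ?thesis unfolding power2_diff by (simp add: abs_mult)
    qed
    then have "\<bar>\<beta> n * \<beta> n'\<bar> * norm (kern_corr c D M n n') \<le> ((\<beta> n)\<^sup>2 / 2 + (\<beta> n')\<^sup>2 / 2) * norm (kern_corr c D M n n')"
      by (intro mult_right_mono) auto
    then show "norm (of_real (\<beta> n * \<beta> n') * kern_corr c D M n n')
        \<le> ((\<beta> n)\<^sup>2 / 2) * norm (kern_corr c D M n n') + ((\<beta> n')\<^sup>2 / 2) * norm (kern_corr c D M n' n)"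
      using norm_kern_corr_commute[of c D M n n'] by (simp only: norm_mult norm_of_real distrib_right)
  qed
  also have "\<dots> = (\<Sum>n\<in>?I. \<Sum>n'\<in>?I. ((\<beta> n)\<^sup>2 / 2) * norm (kern_corr c D M n n')) + (\<Sum>n\<in>?I. \<Sum>n'\<in>?I. ((\<beta> n')\<^sup>2 / 2) * norm (kern_corr c D M n' n))"
    by (simp only: sum.distrib)
  also have "(\<Sum>n\<in>?I. \<Sum>n'\<in>?I. ((\<beta> n')\<^sup>2 / 2) * norm (kern_corr c D M n' n)) = (\<Sum>n\<in>?I. \<Sum>n'\<in>?I. ((\<beta> n)\<^sup>2 / 2) * norm (kern_corr c D M n n'))"
    by (rule sum.swap)
  also have "(\<Sum>n\<in>?I. \<Sum>n'\<in>?I. ((\<beta> n)\<^sup>2 / 2) * norm (kern_corr c D M n n')) + (\<Sum>n\<in>?I. \<Sum>n'\<in>?I. ((\<beta> n)\<^sup>2 / 2) * norm (kern_corr c D M n n'))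
    = (\<Sum>n\<in>?I. (\<beta> n)\<^sup>2 * (\<Sum>n'\<in>?I. norm (kern_corr c D M n n')))"
    unfolding sum.distrib[symmetric] sum_distrib_left by (intro sum.cong refl) (simp add: field_simps)
  also have "\<dots> \<le> (\<Sum>n\<in>?I. (\<beta> n)\<^sup>2 * E)" by (intro sum_mono mult_left_mono E) auto
  finally have "(\<Sum>m\<in>?J. (norm (F m))\<^sup>2) \<le> (\<Sum>n\<in>?I. (\<beta> n)\<^sup>2) * E" by (simp add: sum_distrib_right)
  then have "(\<Sum>m\<in>?J. (\<alpha> m)\<^sup>2) * (\<Sum>m\<in>?J. (norm (F m))\<^sup>2) \<le> (\<Sum>m\<in>?J. (\<alpha> m)\<^sup>2) * ((\<Sum>n\<in>?I. (\<beta> n)\<^sup>2) * E)"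
    by (intro mult_left_mono) (auto intro: sum_nonneg)
  with CS show ?thesis by linarith
qed

section \<open>Row sums of the correlations for long and for short ranges of m\<close>

lemma card_class_interval_le:
  "real (card {n \<in> {N<..N + H}. [int n = x] (mod int q)}) \<le> real H / real q + 2"
proof -
  let ?S = "{n \<in> {N<..N + H}. [int n = x] (mod int q)}"
  have "card ?S \<le> card {N div q..(N + H) div q}"
  proof (rule card_inj_on_le)
    show "inj_on (\<lambda>n. n div q) ?S"
    proof (rule inj_onI)
      fix m n assume mn: "m \<in> ?S" "n \<in> ?S" "m div q = n div q"
      then have "[int m = int n] (mod int q)" by (metis (mono_tags, lifting) cong_sym cong_trans mem_Collect_eq)
      then have "[m = n] (mod q)" by (simp only: cong_int_iff)
      then have "m mod q = n mod q" by (simp only: cong_def)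
      then show "m = n" using mn(3) by (metis div_mult_mod_eq)
    qed
    show "(\<lambda>n. n div q) ` ?S \<subseteq> {N div q..(N + H) div q}" by (auto intro!: div_le_mono)
  qed auto
  also have "\<dots> = Suc ((N + H) div q) - N div q" by simp
  finally have "card ?S \<le> Suc ((N + H) div q) - N div q" .
  moreover have "N div q \<le> (N + H) div q" by (rule div_le_mono) simp
  ultimately have "card ?S + N div q \<le> (N + H) div q + 1" by linarith
  then have "real (card ?S + N div q) \<le> real ((N + H) div q + 1)" by (simp only: of_nat_le_iff)
  then have "real (card ?S) + real (N div q) \<le> real ((N + H) div q) + 1"
    unfolding of_nat_add of_nat_1 .
  then have "real (card ?S) \<le> real ((N + H) div q) + 1 - real (N div q)"
    by (simp only: le_diff_eq)
  moreover have "real ((N + H) div q) \<le> real (N + H) / real q" by (rule of_nat_div_le_of_nat)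
  moreover have "real N / real q \<le> real (N div q) + 1"
  proof -
    have "N = q * (N div q) + N mod q" "N mod q < q" using q_pos by simp_all
    then have "N \<le> q * (N div q) + q" by linarith
    then have "real N \<le> real (q * (N div q) + q)" by (simp only: of_nat_le_iff)
    then show ?thesis using q_pos by (simp add: field_simps)
  qed
  ultimately show ?thesis by (simp add: add_divide_distrib)
qed

lemma norm_kern_corr_le: "norm (kern_corr c D M n n') \<le> real M"
proof -
  have "norm (\<Sum>m\<in>{M<..h}. kern k (int m)) \<le> real M" if "h \<le> 2 * M" for h k
  proof -
    have "norm (\<Sum>m\<in>{M<..h}. kern k (int m)) \<le> (\<Sum>m\<in>{M<..h}. 1)"
      by (rule sum_norm_le) (rule norm_kern_le)
    then show ?thesis using that by simp
  qed
  then show ?thesis by (simp add: kern_corr_def)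
qed

text \<open>For \<open>m\<close> in a range longer than q^(3/4) by the factor \<open>w\<close>,
  completion wins for each single \<open>n'\<close> outside the classes of \<open>n\<close> and
  \<open>- n\<close>. The \<open>n'\<close> in these two classes are estimated trivially; there are
  few of them, because both \<open>N\<close> and \<open>q\<close> are at least
  \<open>w\<close>.\<close>

lemma sum_kern_corr_long:
  fixes \<rho> w :: real
  assumes c: "\<not> int q dvd c"
    and \<rho>: "real q = \<rho> ^ 8" "1 \<le> w" "w ^ 5 \<le> \<rho>" "1 \<le> \<rho>"
    and M: "\<rho> ^ 6 * w \<le> real M" and N: "w \<le> real N"
  shows "(\<Sum>n'\<in>{N<..2 * N}. norm (kern_corr c D M n n')) \<le> 16 * LQ * real M * real N / w"
proof -
  have w_le: "w \<le> \<rho>\<^sup>2" "w \<le> \<rho> ^ 8"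
  proof -
    have "w \<le> w ^ 5" using \<rho>(2) by (rule self_le_power) simp
    moreover have "\<rho> \<le> \<rho>\<^sup>2" "\<rho> \<le> \<rho> ^ 8" using \<rho>(4) by (simp_all add: self_le_power)
    ultimately show "w \<le> \<rho>\<^sup>2" "w \<le> \<rho> ^ 8" using \<rho>(3) by linarith+
  qed
  have \<rho>6: "real q powr (3 / 4) = \<rho> ^ 6"
    using \<rho>(4) by (simp add: \<rho>(1) powr_realpow[symmetric] powr_powr flip: powr_numeral)
  let ?I = "{N<..2 * N}"
  let ?X = "{n' \<in> ?I. [int n' = int n] (mod int q)} \<union> {n' \<in> ?I. [int n' = - int n] (mod int q)}"
  have "norm (kern_corr c D M n n') \<le> (if n' \<in> ?X then real M else 0) + 4 * \<rho> ^ 6 * (LQ + real M / real q)" if n': "n' \<in> ?I" for n'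
  proof (cases "n' \<in> ?X \<or> q dvd n \<or> q dvd n'")
    case True
    have "0 \<le> 4 * \<rho> ^ 6 * (LQ + real M / real q)" using LQ_ge_1 \<rho>(4) by simp
    moreover have "norm (kern_corr c D M n n') \<le> (if n' \<in> ?X then real M else 0)"
      using True norm_kern_corr_le[of c D M n n'] by (auto simp: kern_corr_def)
    ultimately show ?thesis by linarith
  next
    case False
    let ?H = "min (2 * M) (min (D div n) (D div n'))"
    have "\<not> int q dvd isq (int n) - isq (int n')"
    proof
      assume "int q dvd isq (int n) - isq (int n')"
      then have "[isq (int n') = isq (int n)] (mod int q)" by (simp add: cong_iff_dvd_diff dvd_diff_commute)
      then have "[int n' = int n] (mod int q) \<or> [int n' = - int n] (mod int q)"
        using False by (intro isq_eqD) auto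
      then show False using False n' by auto
    qed
    then have "\<not> int q dvd c * (isq (int n) - isq (int n'))"
      using c prime_int_q prime_dvd_multD by blast
    then have "norm (kern_corr c D M n n') \<le> 4 * \<rho> ^ 6 * (LQ + real (?H - M) / real q)"
      using False norm_sum_kern_le[where u = M and v = ?H] by (simp add: kern_corr_def \<rho>6)
    also have "\<dots> \<le> 4 * \<rho> ^ 6 * (LQ + real M / real q)"
      using \<rho>(4) by (intro mult_left_mono add_left_mono divide_right_mono) auto
    finally show ?thesis using False by simp
  qed
  then have "(\<Sum>n'\<in>?I. norm (kern_corr c D M n n'))
    \<le> (\<Sum>n'\<in>?I. (if n' \<in> ?X then real M else 0) + 4 * \<rho> ^ 6 * (LQ + real M / real q))"
    by (rule sum_mono)
  also have "\<dots> = real (card ?X) * real M + real N * (4 * \<rho> ^ 6 * (LQ + real M / real q))"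
  proof -
    have "(\<Sum>n'\<in>?I. if n' \<in> ?X then real M else 0) = (\<Sum>n'\<in>?I \<inter> ?X. real M)"
      by (rule sum.inter_restrict[symmetric]) simp
    moreover have "?I \<inter> ?X = ?X" by auto
    ultimately show ?thesis by (simp only: sum.distrib sum_constant) simp
  qed
  finally have 1: "(\<Sum>n'\<in>?I. norm (kern_corr c D M n n'))
    \<le> real (card ?X) * real M + real N * (4 * \<rho> ^ 6 * (LQ + real M / real q))" .
  have "real (card ?X) \<le> real (card {n' \<in> ?I. [int n' = int n] (mod int q)}) + real (card {n' \<in> ?I. [int n' = - int n] (mod int q)})"
    using card_Un_le by (simp only: of_nat_le_iff flip: of_nat_add)
  also have "\<dots> \<le> (real N / real q + 2) + (real N / real q + 2)"
    unfolding mult_2 by (intro add_mono card_class_interval_le)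
  finally have "real (card ?X) * real M \<le> (2 * (real N / real q) + 4) * real M"
    by (intro mult_right_mono) auto
  also have "\<dots> \<le> (2 * (real N / w) + 4 * (real N / w)) * real M"
    using w_le \<rho> N by (intro mult_right_mono add_mono mult_left_mono divide_left_mono) (auto simp: field_simps)
  also have "\<dots> = 6 * (real M * real N / w)" by simp
  finally have 2: "real (card ?X) * real M \<le> 6 * (real M * real N / w)" .
  have "LQ * (\<rho> ^ 6 * real N) \<le> LQ * (real M / w * real N)"
    using M \<rho> LQ_ge_1 by (intro mult_left_mono mult_right_mono) (auto simp: field_simps)
  then have 3: "\<rho> ^ 6 * real N * LQ \<le> LQ * (real M * real N / w)" by (simp add: mult_ac)
  have "\<rho> ^ 6 * (real M / real q) = real M / \<rho>\<^sup>2"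
  proof -
    have "\<rho> ^ 8 = \<rho> ^ 6 * \<rho>\<^sup>2" by (simp flip: power_add)
    then have "\<rho> ^ 6 * (real M / real q) = (\<rho> ^ 6 * real M) / (\<rho> ^ 6 * \<rho>\<^sup>2)"
      by (simp only: \<rho>(1) times_divide_eq_right)
    also have "\<dots> = real M / \<rho>\<^sup>2"
      using \<rho>(4) by (intro nonzero_mult_divide_mult_cancel_left) auto
    finally show ?thesis .
  qed
  also have "\<dots> \<le> real M / w" using w_le \<rho> by (intro divide_left_mono) (auto intro!: mult_pos_pos)
  finally have "real N * (\<rho> ^ 6 * (real M / real q)) \<le> real N * (real M / w)" by (intro mult_left_mono) auto
  moreover have "1 * (real M * real N / w) \<le> LQ * (real M * real N / w)"
    using LQ_ge_1 \<rho> by (intro mult_right_mono) auto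
  moreover have "real N * (4 * \<rho> ^ 6 * (LQ + real M / real q)) = 4 * (\<rho> ^ 6 * real N * LQ) + 4 * (real N * (\<rho> ^ 6 * (real M / real q)))"
    by (simp add: algebra_simps)
  moreover have "real N * (real M / w) = real M * real N / w" by simp
  moreover have "0 \<le> real M * real N / w" using \<rho> by simp
  ultimately have "(\<Sum>n'\<in>?I. norm (kern_corr c D M n n')) \<le> 16 * (LQ * (real M * real N / w))"
    using 1 2 3 by linarith
  then show ?thesis by (simp add: mult.assoc)
qed

text \<open>The range of \<open>m\<close> is too short for completion, but the coefficients
  \<open>c * (isq (int n) - isq (int n'))\<close> are distinct modulo \<open>q\<close> as
  \<open>n'\<close> varies, which is the injectivity that the shift estimate asks for.\<close>

lemma sum_kern_corr_short:
  fixes \<rho> w :: real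
  assumes c: "\<not> int q dvd c"
    and \<rho>: "real q = \<rho> ^ 8" "1 \<le> w" "w ^ 5 \<le> \<rho>" "4 \<le> \<rho>"
    and M: "real M < \<rho> ^ 6 * w" and NM: "N \<le> M" and MN: "\<rho> ^ 6 * w ^ 49 \<le> real M * real N"
    and n: "n \<in> {N<..2 * N}"
  shows "(\<Sum>n'\<in>{N<..2 * N}. norm (kern_corr c D M n n')) \<le> 16 * LQ * real M * real N / w"
proof -
  let ?I = "{N<..2 * N}"
  have w\<rho>: "w \<le> \<rho>"
  proof -
    have "w \<le> w ^ 5" using \<rho>(2) by (rule self_le_power) simp
    then show ?thesis using \<rho>(3) by simp
  qed
  have pos: "0 < \<rho>" "0 < w" using \<rho> by auto
  \<comment> \<open>The larger variable is at least the square root of the product; dividing the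
    product by the upper bound for \<open>M\<close> gives the lower bound \<open>Nw\<close> for the
    other one.\<close>
  have M2: "\<rho> ^ 3 * w ^ 24 \<le> real M"
  proof -
    have "(\<rho> ^ 3 * w ^ 24)\<^sup>2 = \<rho> ^ 6 * w ^ 48" by (simp add: power_mult_distrib flip: power_mult)
    also have "\<dots> \<le> \<rho> ^ 6 * w ^ 49" using \<rho> by (intro mult_left_mono power_increasing) auto
    also have "\<dots> \<le> real M * real M" using MN NM by (meson mult_left_mono of_nat_0_le_iff of_nat_mono order_trans)
    finally have "(\<rho> ^ 3 * w ^ 24)\<^sup>2 \<le> (real M)\<^sup>2" by (simp add: power2_eq_square)
    then show ?thesis by (rule power2_le_imp_le) simp
  qed
  have Mpos: "0 < real M" using M2 pos by (smt (verit) mult_pos_pos zero_less_power)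
  have Nw: "w ^ 48 \<le> real N"
  proof -
    have "\<rho> ^ 6 * w ^ 49 \<le> (\<rho> ^ 6 * w) * real N"
      using MN M by (smt (verit) mult_right_mono of_nat_0_le_iff)
    then have "(\<rho> ^ 6 * w) * w ^ 48 \<le> (\<rho> ^ 6 * w) * real N" by (simp add: power_numeral_reduce mult_ac)
    then show ?thesis using pos by simp
  qed
  \<comment> \<open>\<open>B\<close> is just large enough for \<open>q \<le> B ^ 8\<close>; \<open>A\<close> is limited by the edge effects, of size \<open>A * B\<close>,
    and by the condition \<open>2 * A * M < q\<close> of the shift estimate.\<close>
  define B where "B = nat \<lceil>\<rho>\<rceil>"
  have B: "\<rho> \<le> real B" "real B \<le> 2 * \<rho>"
    using \<rho>(4) by (auto simp: B_def) linarith
  define \<mu> where "\<mu> = min (real M / (w * real B)) (real q / (4 * real M))"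
  define A where "A = nat \<lfloor>\<mu>\<rfloor>"
  have Bpos: "0 < real B" using B pos by linarith
  have \<mu>1: "1 \<le> \<mu>"
  proof -
    have "w * real B \<le> w * (2 * \<rho>)" using B pos by simp
    also have "\<dots> \<le> w ^ 24 * (\<rho> * \<rho>\<^sup>2)"
    proof (rule mult_mono)
      show "w \<le> w ^ 24" using \<rho>(2) by (rule self_le_power) simp
      show "2 * \<rho> \<le> \<rho> * \<rho>\<^sup>2"
        using \<rho>(4) mult_mono[of 4 \<rho> 4 \<rho>] by (simp add: power2_eq_square)
    qed (use pos in auto)
    also have "\<dots> = \<rho> ^ 3 * w ^ 24" by (simp add: power_numeral_reduce mult_ac)
    finally have "w * real B \<le> real M" using M2 by linarith
    moreover have "4 * real M \<le> real q"
    proof -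
      have "4 * real M \<le> 4 * (\<rho> ^ 6 * w)" using M by simp
      also have "\<dots> \<le> \<rho> * (\<rho> ^ 6 * \<rho>)" using \<rho> w\<rho> by (intro mult_mono) auto
      also have "\<dots> = real q" by (simp add: \<rho>(1) power_numeral_reduce mult_ac)
      finally show ?thesis .
    qed
    ultimately show ?thesis using pos Bpos Mpos by (simp add: \<mu>_def)
  qed
  have A: "1 \<le> A" "real A \<le> \<mu>" "\<mu> \<le> 2 * real A"
  proof -
    have f: "1 \<le> \<lfloor>\<mu>\<rfloor>" using \<mu>1 by simp
    then have e: "real A = of_int \<lfloor>\<mu>\<rfloor>" by (simp add: A_def)
    show "1 \<le> A" using nat_mono[OF f] by (simp only: A_def nat_1 One_nat_def)
    show "real A \<le> \<mu>" unfolding e by simp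
    have "1 \<le> real_of_int \<lfloor>\<mu>\<rfloor>" using f by simp
    then show "\<mu> \<le> 2 * real A" unfolding e by linarith
  qed
  have Aq: "real A * real B \<le> real M / w" "real A * (4 * real M) \<le> real q"
  proof -
    have "real A \<le> real M / (w * real B)" "real A \<le> real q / (4 * real M)" using A(2) by (auto simp: \<mu>_def)
    then show "real A * real B \<le> real M / w" "real A * (4 * real M) \<le> real q"
      using pos Bpos Mpos by (auto simp: field_simps)
  qed
  have M4: "4 * real M \<le> real q"
  proof -
    have "1 * (4 * real M) \<le> real A * (4 * real M)" using A(1) by (intro mult_right_mono) auto
    then show ?thesis using Aq(2) by simp
  qed
  then have "real (4 * M) \<le> real q" by simp
  then have M4n: "4 * M \<le> q" by (simp only: of_nat_le_iff)
  have q_large: "4 ^ 8 \<le> real q" unfolding \<rho>(1) using \<rho>(4) by (intro power_mono) auto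
  have I_lt: "0 < n'" "n' < q" if "n' \<in> ?I" for n'
  proof -
    have "n' \<le> 2 * M" using that NM by simp
    then show "0 < n'" "n' < q" using that Mpos M4n by auto
  qed
  have unit: "\<not> int q dvd int n'" if "n' \<in> ?I" for n'
    using I_lt[OF that] by (intro not_dvd_units) auto
  have "(\<Sum>n'\<in>?I. norm (kern_corr c D M n n')) =
    (\<Sum>n'\<in>?I. norm (\<Sum>m\<in>{M<..min (2 * M) (min (D div n) (D div n'))}. kern (c * (isq (int n) - isq (int n'))) (int m)))"
    using unit n by (intro sum.cong refl) (auto simp: kern_corr_def)
  \<comment> \<open>The saving is \<open>\<kappa> = 4 * LQ / w\<close>. In its 16th power the
    constant \<open>2 ^ 32\<close> absorbs the \<open>2 ^ 25\<close> of the shift estimate, the 64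
    in \<open>key\<close> below and the 2 lost in rounding \<open>\<mu>\<close> down to
    \<open>A\<close>.\<close>
  also have "\<dots> \<le> 2 * real A * real B * real (card ?I) + (4 * LQ / w) * real (2 * M) * real (card ?I)"
  proof (rule shift_sum_saving)
    fix n1 n2 assume n12: "n1 \<in> ?I" "n2 \<in> ?I"
      "[c * (isq (int n) - isq (int n1)) = c * (isq (int n) - isq (int n2))] (mod int q)"
    then have "[isq (int n) - isq (int n1) = isq (int n) - isq (int n2)] (mod int q)"
      using c cong_cancel_unit by blast
    then have "[isq (int n1) = isq (int n2)] (mod int q)"
      by (simp add: cong_iff_dvd_diff dvd_diff_commute)
    then have "[int n1 = int n2] (mod int q) \<or> [int n1 = - int n2] (mod int q)"
      using n12 unit by (intro isq_eqD) auto
    then show "n1 = n2"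
    proof
      assume "[int n1 = int n2] (mod int q)"
      then show ?thesis
        using residues_cong_eq[of "int n1" "int n2"] I_lt[OF n12(1)] I_lt[OF n12(2)] by simp
    next
      \<comment> \<open>Since \<open>n1 + n2 \<le> 4 * N \<le> q\<close>, the sum can only be
        \<open>q\<close>, and then both numbers are the endpoint \<open>2 * N\<close>.\<close>
      assume "[int n1 = - int n2] (mod int q)"
      then have "int q dvd int (n1 + n2)" by (simp add: cong_iff_dvd_diff)
      then have "q dvd n1 + n2" by (simp only: int_dvd_int_iff)
      moreover have "n1 + n2 \<le> q" using n12 NM M4n by auto
      moreover have "0 < n1 + n2" using I_lt[OF n12(1)] by simp
      ultimately have "n1 + n2 = q" using dvd_imp_le[of q "n1 + n2"] by simp
      then have "n1 = 2 * N" "n2 = 2 * N" using n12 NM M4n by auto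
      then show ?thesis by simp
    qed
  next
    show "1 \<le> A" by (rule A)
    show "1 \<le> B" using Bpos by simp
    show "1 \<le> 2 * M" using Mpos by simp
    have "real (A * (2 * M)) * 2 \<le> real q" using Aq(2) by simp
    moreover have "0 < real (A * (2 * M))" using A(1) Mpos by simp
    ultimately have "real (A * (2 * M)) < real q" by linarith
    then show "A * (2 * M) < q" by (simp only: of_nat_less_iff)
    have "real B < real q"
    proof -
      have "2 * \<rho> < \<rho> * \<rho>" using \<rho>(4) by simp
      also have "\<dots> = \<rho>\<^sup>2" by (simp add: power2_eq_square)
      also have "\<dots> \<le> \<rho> ^ 8" using \<rho>(4) by (intro power_increasing) auto
      finally show ?thesis using B \<rho>(1) by simp
    qed
    then show "B < q" by simp
    show "8 < q" using q_large by simp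
    have "\<rho> ^ 8 \<le> real B ^ 8" using B pos by (intro power_mono) auto
    then show "q \<le> B ^ 8" unfolding \<rho>(1)[symmetric] by (simp only: of_nat_le_iff flip: of_nat_power)
    show "0 \<le> 4 * LQ / w" using LQ_ge_1 pos by simp
    have "1 + ln (real A) \<le> LQ"
    proof -
      have "1 * real A \<le> (4 * real M) * real A" using Mpos by (intro mult_right_mono) auto
      then have "real A \<le> real q" using Aq(2) by (simp add: mult.commute)
      then show ?thesis using A(1) by (simp add: LQ_def)
    qed
    then have L: "(1 + ln (real A))\<^sup>2 \<le> LQ ^ 16"
    proof -
      assume "1 + ln (real A) \<le> LQ"
      moreover have "0 \<le> ln (real A)" using A(1) by simp
      ultimately have "(1 + ln (real A))\<^sup>2 \<le> LQ\<^sup>2" by (intro power_mono) auto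
      also have "\<dots> \<le> LQ ^ 16" using LQ_ge_1 by (intro power_increasing) auto
      finally show ?thesis .
    qed
    \<comment> \<open>If the edge effects limit \<open>A\<close>, the lower bounds for
      \<open>M\<close> and \<open>M * N\<close> over \<open>w * \<rho>\<close> give the exponent 3 +
      6 - 1 = 8 of \<open>\<rho>\<close>, which is exactly \<open>q\<close>. If the condition on
      \<open>A * M\<close> limits it, \<open>M\<close> cancels and the lower bound for
      \<open>N\<close> supplies the power of \<open>w\<close>.\<close>
    have key: "real q * w ^ 16 \<le> 64 * (\<mu> * (real M * real N))"
    proof (cases "real M / (w * real B) \<le> real q / (4 * real M)")
      case True
      have "real q * w ^ 16 \<le> real q * w ^ 72" using \<rho> by (intro mult_left_mono power_increasing) auto
      also have "\<dots> = (\<rho> ^ 3 * w ^ 24) * (\<rho> ^ 6 * w ^ 49) / (w * \<rho>)"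
      proof -
        have "\<rho> ^ 3 * \<rho> ^ 6 = \<rho> ^ 8 * \<rho>" "w ^ 24 * w ^ 49 = w ^ 72 * w" by (simp_all flip: power_add power_Suc2)
        then have "(\<rho> ^ 3 * w ^ 24) * (\<rho> ^ 6 * w ^ 49) = (\<rho> ^ 8 * \<rho>) * (w ^ 72 * w)"
          by (metis (no_types, lifting) mult.assoc mult.left_commute)
        then show ?thesis using pos by (simp add: \<rho>(1))
      qed
      also have "\<dots> \<le> real M * (real M * real N) / (w * \<rho>)"
        using pos by (intro divide_right_mono mult_mono[OF M2 MN]) auto
      also have "\<dots> \<le> 2 * (real M * (real M * real N) / (w * real B))"
      proof -
        have "real M * (real M * real N) / (w * \<rho>) = 2 * (real M * (real M * real N) / (w * (2 * \<rho>)))" by simp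
        also have "real M * (real M * real N) / (w * (2 * \<rho>)) \<le> real M * (real M * real N) / (w * real B)"
          using pos B Bpos by (intro divide_left_mono mult_left_mono) auto
        finally show ?thesis by simp
      qed
      also have "\<dots> = 2 * (\<mu> * (real M * real N))" using True by (simp add: \<mu>_def)
      also have "\<dots> \<le> 64 * (\<mu> * (real M * real N))" using \<mu>1 by (intro mult_right_mono) auto
      finally show ?thesis .
    next
      case False
      have "real q * w ^ 16 \<le> real q * w ^ 48" using \<rho> by (intro mult_left_mono power_increasing) auto
      also have "\<dots> \<le> real q * real N" using Nw by (intro mult_left_mono) auto
      also have "\<dots> = 4 * (\<mu> * (real M * real N))" using False Mpos by (simp add: \<mu>_def)
      also have "\<dots> \<le> 64 * (\<mu> * (real M * real N))" using \<mu>1 by (intro mult_right_mono) auto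
      finally show ?thesis .
    qed
    have "2 ^ 25 * (1 + ln (real A))\<^sup>2 * real q \<le> 2 ^ 25 * LQ ^ 16 * real q"
      using L by (intro mult_right_mono mult_left_mono) auto
    also have "\<dots> = 2 ^ 25 * LQ ^ 16 / w ^ 16 * (real q * w ^ 16)" using pos by simp
    also have "\<dots> \<le> 2 ^ 25 * LQ ^ 16 / w ^ 16 * (64 * (2 * real A * (real M * real N)))"
    proof (intro mult_left_mono order.trans[OF key])
      show "\<mu> * (real M * real N) \<le> 2 * real A * (real M * real N)" using A by (intro mult_right_mono) auto
    qed (use LQ_ge_1 pos in auto)
    also have "\<dots> = (4 * LQ / w) ^ 16 * (real A * real (2 * M) * real (card ?I)) / 2"
      by (simp add: power_divide power_mult_distrib)
    also have "\<dots> \<le> (4 * LQ / w) ^ 16 * (real A * real (2 * M) * real (card ?I))"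
      using LQ_ge_1 pos by simp
    finally show "2 ^ 25 * (1 + ln (real A))\<^sup>2 * real q \<le> (4 * LQ / w) ^ 16 * (real A * real (2 * M) * real (card ?I))" .
  qed auto
  also have "\<dots> = 2 * (real A * real B) * real N + 8 * (LQ * (real M * real N / w))"
    using pos by (simp add: field_simps)
  also have "\<dots> \<le> 2 * (real M / w) * real N + 8 * (LQ * (real M * real N / w))"
    using Aq(1) by (intro add_right_mono mult_right_mono mult_left_mono) auto
  also have "\<dots> \<le> 2 * (LQ * (real M * real N / w)) + 8 * (LQ * (real M * real N / w))"
  proof -
    have "1 * (real M * real N / w) \<le> LQ * (real M * real N / w)"
      using LQ_ge_1 pos by (intro mult_right_mono) auto
    moreover have "2 * (real M / w) * real N = 2 * (real M * real N / w)" by simp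
    ultimately show ?thesis by linarith
  qed
  also have "\<dots> \<le> 16 * (LQ * (real M * real N / w))"
  proof -
    have "0 \<le> LQ * (real M * real N / w)" using LQ_ge_1 pos by simp
    then show ?thesis by linarith
  qed
  finally show ?thesis by (simp add: mult.assoc)
qed

end

section \<open>Moebius function and divisor sums\<close>

text \<open>The square counts pairs \<open>a\<close>, \<open>b\<close> with
  \<open>lcm a b dvd k\<close>. Dividing by the lcm amounts to multiplying by the gcd over
  \<open>a * b\<close>, and bounding the gcd by the sum of all common divisors \<open>g\<close>
  makes the sums over \<open>a\<close> and \<open>b\<close> independent, with one logarithm for each
  of \<open>a\<close>, \<open>b\<close>, \<open>g\<close>.\<close>

lemma sum_card_divisors_squared_le:
  assumes "1 \<le> n"
  shows "(\<Sum>k = 1..n. (real (card {d. d dvd k}))\<^sup>2) \<le> real n * (1 + ln (real n)) ^ 3"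
proof -
  let ?H = "1 + ln (real n)"
  have H: "1 \<le> ?H" using assms by simp
  have "(\<Sum>k = 1..n. (real (card {d. d dvd k}))\<^sup>2)
    = (\<Sum>k = 1..n. \<Sum>a = 1..n. \<Sum>b = 1..n. if lcm a b dvd k then 1 else 0)"
  proof (rule sum.cong[OF refl])
    fix k assume k: "k \<in> {1..n}"
    then have "{d. d dvd k} = {d \<in> {1..n}. d dvd k}" by (auto dest: dvd_imp_le intro: Nat.gr0I)
    then have "real (card {d. d dvd k}) = (\<Sum>d\<in>{d \<in> {1..n}. d dvd k}. 1)" by simp
    also have "\<dots> = (\<Sum>d = 1..n. if d dvd k then 1 else 0)" by (rule sum.inter_filter) simp
    finally have "(real (card {d. d dvd k}))\<^sup>2
      = (\<Sum>a = 1..n. if a dvd k then 1 else 0) * (\<Sum>b = 1..n. if b dvd k then 1 else 0)"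
      by (simp add: power2_eq_square)
    then show "(real (card {d. d dvd k}))\<^sup>2 = (\<Sum>a = 1..n. \<Sum>b = 1..n. if lcm a b dvd k then 1 else 0)"
      unfolding sum_product by (simp cong: sum.cong) (intro sum.cong refl, auto)
  qed
  also have "\<dots> = (\<Sum>a = 1..n. \<Sum>b = 1..n. real (card {k \<in> {1..n}. lcm a b dvd k}))"
  proof -
    have "real (card {k \<in> {1..n}. lcm a b dvd k}) = (\<Sum>k = 1..n. if lcm a b dvd k then 1 else 0)" for a b
      using sum.inter_filter[of "{1..n}" "\<lambda>_. 1 :: real" "\<lambda>k. lcm a b dvd k"] by simp
    then show ?thesis by (simp only:) (subst sum.swap, rule sum.cong[OF refl], rule sum.swap)
  qed
  also have "\<dots> \<le> (\<Sum>a = 1..n. \<Sum>b = 1..n. \<Sum>g = 1..n. if g dvd a \<and> g dvd b then real n * (real g * (1 / real a) * (1 / real b)) else 0)"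
  proof (intro sum_mono)
    fix a b assume ab: "a \<in> {1..n}" "b \<in> {1..n}"
    then have "0 < lcm a b" by (simp add: lcm_pos_nat)
    from card_multiples_le[OF this, of n]
    have "real (card {k \<in> {1..n}. lcm a b dvd k}) \<le> real (n div lcm a b)" by simp
    also have "\<dots> \<le> real n / real (lcm a b)" by (rule of_nat_div_le_of_nat)
    also have "\<dots> = real n * (real (gcd a b) * (1 / real a) * (1 / real b))"
    proof -
      have "real (lcm a b) * real (gcd a b) = real a * real b"
        by (metis mult.commute of_nat_mult prod_gcd_lcm_nat)
      moreover have "0 < real (lcm a b)" using \<open>0 < lcm a b\<close> by (simp only: of_nat_0_less_iff)
      ultimately show ?thesis using ab by (simp add: field_simps)
    qed
    also have "\<dots> = (\<Sum>g\<in>{gcd a b}. if g dvd a \<and> g dvd b then real n * (real g * (1 / real a) * (1 / real b)) else 0)"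
      by simp
    also have "\<dots> \<le> (\<Sum>g = 1..n. if g dvd a \<and> g dvd b then real n * (real g * (1 / real a) * (1 / real b)) else 0)"
    proof (rule sum_mono2)
      have "gcd a b \<le> a" using ab by (simp add: gcd_le1_nat)
      moreover have "0 < gcd a b" using ab by (auto intro: Nat.gr0I)
      moreover have "a \<le> n" using ab by simp
      ultimately have "gcd a b \<in> {1..n}" unfolding atLeastAtMost_iff by linarith
      then show "{gcd a b} \<subseteq> {1..n}" by blast
    qed auto
    finally show "real (card {k \<in> {1..n}. lcm a b dvd k})
      \<le> (\<Sum>g = 1..n. if g dvd a \<and> g dvd b then real n * (real g * (1 / real a) * (1 / real b)) else 0)" .
  qed
  also have "\<dots> = (\<Sum>g = 1..n. \<Sum>a = 1..n. \<Sum>b = 1..n. if g dvd a \<and> g dvd b then real n * (real g * (1 / real a) * (1 / real b)) else 0)"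
    by (subst sum.swap, subst (2) sum.swap) (rule refl)
  also have "\<dots> = (\<Sum>g = 1..n. real n * real g * (\<Sum>a\<in>{a \<in> {1..n}. g dvd a}. 1 / real a)\<^sup>2)"
  proof (rule sum.cong[OF refl])
    fix g
    let ?f = "\<lambda>a. if g dvd a then 1 / real a else 0"
    have "(\<Sum>a\<in>{a \<in> {1..n}. g dvd a}. 1 / real a) = (\<Sum>a = 1..n. ?f a)"
      by (rule sum.inter_filter) simp
    then have "real n * real g * (\<Sum>a\<in>{a \<in> {1..n}. g dvd a}. 1 / real a)\<^sup>2
      = real n * real g * (\<Sum>a = 1..n. \<Sum>b = 1..n. ?f a * ?f b)"
      by (simp only: power2_eq_square sum_product)
    also have "\<dots> = (\<Sum>a = 1..n. \<Sum>b = 1..n. real n * real g * (?f a * ?f b))"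
      by (simp only: sum_distrib_left)
    also have "\<dots> = (\<Sum>a = 1..n. \<Sum>b = 1..n. if g dvd a \<and> g dvd b then real n * (real g * (1 / real a) * (1 / real b)) else 0)"
      by (rule sum.cong[OF refl], rule sum.cong[OF refl]) auto
    finally show "(\<Sum>a = 1..n. \<Sum>b = 1..n. if g dvd a \<and> g dvd b then real n * (real g * (1 / real a) * (1 / real b)) else 0)
      = real n * real g * (\<Sum>a\<in>{a \<in> {1..n}. g dvd a}. 1 / real a)\<^sup>2" by (rule sym)
  qed
  also have "\<dots> \<le> (\<Sum>g = 1..n. real n * real g * (?H / real g)\<^sup>2)"
    using assms by (intro sum_mono mult_left_mono power_mono sum_inverse_multiples_le sum_nonneg) auto
  also have "\<dots> = real n * ?H\<^sup>2 * (\<Sum>g = 1..n. 1 / real g)"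
    unfolding sum_distrib_left by (intro sum.cong refl) (simp add: power2_eq_square)
  also have "\<dots> \<le> real n * ?H\<^sup>2 * ?H"
    using assms by (intro mult_left_mono sum_inverse_le_ln) auto
  finally show ?thesis by (simp add: power3_eq_cube power2_eq_square mult.assoc)
qed

lemma sum_divisor_pairs:
  fixes F :: "nat \<Rightarrow> nat \<Rightarrow> 'a :: comm_monoid_add"
  shows "(\<Sum>d = 1..D. \<Sum>n | n dvd d. F (d div n) n) = (\<Sum>n = 1..D. \<Sum>m = 1..D div n. F m n)"
proof -
  have "(\<Sum>d = 1..D. \<Sum>n | n dvd d. F (d div n) n) = (\<Sum>(d, n)\<in>(SIGMA d:{1..D}. {n. n dvd d}). F (d div n) n)"
    by (subst sum.Sigma) auto
  also have "\<dots> = (\<Sum>(n, m)\<in>(SIGMA n:{1..D}. {1..D div n}). F m n)"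
  proof (rule sum.reindex_bij_witness[of _ "\<lambda>(n, m). (m * n, n)" "\<lambda>(d, n). (n, d div n)"])
    fix p assume p: "p \<in> (SIGMA d:{1..D}. {n. n dvd d})"
    obtain d n where "p = (d, n)" "1 \<le> d" "d \<le> D" "n dvd d" using p by auto
    then obtain e where e: "p = (n * e, n)" "1 \<le> n * e" "n * e \<le> D" by (auto elim: dvdE)
    then have ne: "0 < n" "0 < e" by (auto intro: Nat.gr0I)
    have "n \<le> n * e" using ne by simp
    then have "n \<le> D" using e by linarith
    then show "(case p of (d, n) \<Rightarrow> (n, d div n)) \<in> (SIGMA n:{1..D}. {1..D div n})"
      using e ne by (simp add: less_eq_div_iff_mult_less_eq mult.commute Suc_le_eq)
    show "(case case p of (d, n) \<Rightarrow> (n, d div n) of (n, m) \<Rightarrow> (m * n, n)) = p"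
      "(case case p of (d, n) \<Rightarrow> (n, d div n) of (n, m) \<Rightarrow> F m n) = (case p of (d, n) \<Rightarrow> F (d div n) n)"
      using e ne by simp_all
  next
    fix p assume p: "p \<in> (SIGMA n:{1..D}. {1..D div n})"
    then obtain n m where e: "p = (n, m)" "0 < n" "0 < m" "m * n \<le> D"
      by (auto simp: less_eq_div_iff_mult_less_eq)
    then show "(case p of (n, m) \<Rightarrow> (m * n, n)) \<in> (SIGMA d:{1..D}. {n. n dvd d})"
      "(case case p of (n, m) \<Rightarrow> (m * n, n) of (d, n) \<Rightarrow> (n, d div n)) = p"
      by (simp_all add: Suc_le_eq)
  qed
  also have "\<dots> = (\<Sum>n = 1..D. \<Sum>m = 1..D div n. F m n)" by (subst sum.Sigma) auto
  finally show ?thesis .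
qed

section \<open>Divisor sums of the Moebius function\<close>

lemma abs_moebius_le: "\<bar>moebius n\<bar> \<le> 1"
  by (simp add: moebius_def power_abs)

text \<open>Taking products identifies the subsets of the set of prime factors with the squarefree
  divisors, and the alternating sum over subsets is a product of factors
  \<open>- 1 + 1\<close>.\<close>

lemma sum_moebius_divisors:
  assumes "0 < n"
  shows "(\<Sum>d | d dvd n. moebius d) = (if n = 1 then 1 else 0)"
proof -
  let ?P = "prime_factors n"
  have pf: "prime_factors (\<Prod>S) = S" if "S \<subseteq> ?P" for S
  proof -
    have "finite S" using that by (rule finite_subset) simp
    have "prime_factorization (\<Prod>S) = prime_factorization (\<Prod>\<^sub># (mset_set S))"
      using \<open>finite S\<close> by (simp add: prod_unfold_prod_mset)
    also have "\<dots> = mset_set S"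
      using that \<open>finite S\<close> by (intro prime_factorization_prod_mset_primes) (auto dest: in_prime_factors_imp_prime)
    finally show ?thesis using \<open>finite S\<close> by simp
  qed
  have sf: "squarefree (\<Prod>S)" if "S \<subseteq> ?P" for S
  proof (intro squarefree_prod_coprime)
    fix a b assume "a \<in> S" "b \<in> S" "a \<noteq> b"
    then show "coprime a b" using that by (meson in_prime_factors_imp_prime primes_coprime subsetD)
  next
    fix a assume "a \<in> S"
    then show "squarefree a" using that by (meson in_prime_factors_imp_prime squarefree_prime subsetD)
  qed
  have prod_pf: "\<Prod>(prime_factors d) = d" if "squarefree d" for d :: nat
  proof -
    have d0: "d \<noteq> 0" using that by (metis not_squarefree_0)
    have "(\<Prod>p\<in>prime_factors d. p ^ multiplicity p d) = d"
      using prod_prime_factors[OF d0] by simp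
    moreover have "(\<Prod>p\<in>prime_factors d. p ^ multiplicity p d) = \<Prod>(prime_factors d)"
    proof (intro prod.cong refl)
      fix p assume p: "p \<in> prime_factors d"
      then have "0 < multiplicity p d" "prime p" by (auto simp: prime_factors_multiplicity)
      moreover have "multiplicity p d \<le> 1"
        using that d0 \<open>prime p\<close> by (auto simp: squarefree_factorial_semiring'')
      ultimately have "multiplicity p d = 1" by linarith
      then show "p ^ multiplicity p d = p" by simp
    qed
    ultimately show ?thesis by simp
  qed
  have "(\<Sum>d | d dvd n. moebius d) = (\<Sum>d\<in>{d. d dvd n \<and> squarefree d}. moebius d)"
    using assms by (intro sum.mono_neutral_right) (auto simp: moebius_def)
  also have "\<dots> = (\<Sum>S\<in>Pow ?P. (- 1) ^ card S)"
  proof (rule sum.reindex_bij_witness[of _ Prod prime_factors])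
    fix d assume d: "d \<in> {d. d dvd n \<and> squarefree d}"
    then show "\<Prod>(prime_factors d) = d" using prod_pf by simp
    show "prime_factors d \<in> Pow ?P" using d assms by (auto intro: dvd_prime_factors[THEN subsetD])
    show "(- 1) ^ card (prime_factors d) = moebius d" using d by (simp add: moebius_def)
  next
    fix S assume S: "S \<in> Pow ?P"
    then show "prime_factors (\<Prod>S) = S" using pf by simp
    have "\<Prod>S dvd \<Prod>?P" using S by (intro prod_dvd_prod_subset) auto
    also have "\<Prod>?P dvd (\<Prod>p\<in>?P. p ^ multiplicity p n)"
      by (intro prod_dvd_prod dvd_power) (auto simp: prime_factors_multiplicity)
    also have "(\<Prod>p\<in>?P. p ^ multiplicity p n) = n" using prod_prime_factors[of n] assms by simp
    finally show "\<Prod>S \<in> {d. d dvd n \<and> squarefree d}" using sf S by simp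
  qed
  also have "\<dots> = (\<Prod>p\<in>?P. - 1 + 1)"
    by (subst prod_add) (auto simp: prod_constant)
  also have "\<dots> = (if n = 1 then 1 else 0)"
    using assms by (auto simp: card_gt_0_iff prime_factorization_empty_iff)
  finally show ?thesis .
qed

text \<open>The \<open>d\<close> with \<open>d\<^sup>2 dvd n\<close> are the divisors of
  \<open>square_part n\<close>, which is 1 exactly for squarefree \<open>n\<close>.\<close>

lemma moebius_squared_eq_sum:
  assumes "0 < n"
  shows "(moebius n)\<^sup>2 = (\<Sum>d | d\<^sup>2 dvd n. moebius d)"
proof -
  have "(\<Sum>d | d\<^sup>2 dvd n. moebius d) = (\<Sum>d | d dvd square_part n. moebius d)"
    by (simp add: dvd_square_part_iff)
  also have "\<dots> = (if square_part n = 1 then 1 else 0)"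
    using assms by (intro sum_moebius_divisors) (auto intro: Nat.gr0I)
  also have "square_part n = 1 \<longleftrightarrow> squarefree n"
  proof
    assume eq: "square_part n = 1"
    show "squarefree n"
    proof (rule squarefreeI)
      fix x assume "x\<^sup>2 dvd n"
      then have "x dvd square_part n" by (simp only: dvd_square_part_iff)
      then show "x dvd 1" using eq by simp
    qed
  next
    assume "squarefree n"
    then have "square_part n dvd 1" by (rule squarefreeD) (rule square_part_square_dvd)
    then show "square_part n = 1" by simp
  qed
  finally have "(\<Sum>d | d\<^sup>2 dvd n. moebius d) = (if squarefree n then 1 else 0)" .
  then show ?thesis by (simp only: moebius_squared)
qed

section \<open>Vaughan's identity\<close>

definition moebius_low :: "nat \<Rightarrow> nat \<Rightarrow> int" where
  "moebius_low U m = (\<Sum>b | b dvd m \<and> b \<le> U. moebius b)"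

definition moebius_high :: "nat \<Rightarrow> nat \<Rightarrow> int" where
  "moebius_high U m = (\<Sum>b | b dvd m \<and> U < b. moebius b)"

lemma moebius_low_plus_high:
  assumes "0 < m"
  shows "moebius_low U m + moebius_high U m = (if m = 1 then 1 else 0)"
proof -
  have "(\<Sum>b | b dvd m. moebius b) = moebius_low U m + moebius_high U m"
    unfolding moebius_low_def moebius_high_def using assms
    by (subst sum.union_disjoint[symmetric]) (auto intro!: sum.cong)
  then show ?thesis using sum_moebius_divisors[OF assms] by simp
qed

lemma abs_moebius_high_le: "\<bar>real_of_int (moebius_high U m)\<bar> \<le> real (card {d. d dvd m})" if "0 < m"
proof -
  have fin: "finite {d. d dvd m}" using that by simp
  have "\<bar>real_of_int (moebius_high U m)\<bar> \<le> (\<Sum>b | b dvd m \<and> U < b. \<bar>real_of_int (moebius b)\<bar>)"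
    unfolding moebius_high_def of_int_sum by (rule sum_abs)
  also have "\<dots> \<le> (\<Sum>b | b dvd m \<and> U < b. 1)"
    using abs_moebius_le by (intro sum_mono) (simp flip: of_int_abs)
  also have "\<dots> = real (card {b. b dvd m \<and> U < b})" by simp
  also have "\<dots> \<le> real (card {d. d dvd m})" using fin by (intro of_nat_mono card_mono) auto
  finally show ?thesis .
qed

lemma moebius_high_eq_0: "0 < m \<Longrightarrow> m \<le> U \<Longrightarrow> moebius_high U m = 0"
proof -
  assume "0 < m" "m \<le> U"
  then have "{b. b dvd m \<and> U < b} = {}" by (auto dest: dvd_imp_le)
  then show ?thesis unfolding moebius_high_def by (simp only: sum.empty)
qed

text \<open>In the middle term \<open>moebius_low\<close> unfolds to a sum over
  \<open>b \<le> U\<close>, so two variables are small and the third runs freely over an interval.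
  In the last term both variables exceed \<open>U\<close>, since \<open>moebius_high U\<close>
  vanishes at positive arguments up to \<open>U\<close>; this is the bilinear part.\<close>

lemma Vaughan_identity:
  assumes "0 < d"
  shows "moebius d = 2 * (if d \<le> U then moebius d else 0)
    - (\<Sum>n | n dvd d. (if n \<le> U then moebius n else 0) * moebius_low U (d div n))
    + (\<Sum>n | n dvd d. (if U < n then moebius n else 0) * moebius_high U (d div n))"
proof -
  let ?Dv = "{n. n dvd d}"
  have fin: "finite ?Dv" using assms by simp
  have pos: "0 < d div n" "0 < n" if "n \<in> ?Dv" for n
    using that assms by (auto simp: div_greater_zero_iff intro: dvd_imp_le dvd_pos_nat)
  have eq1: "d div n = 1 \<longleftrightarrow> n = d" if "n \<in> ?Dv" for n
    using that assms by (auto simp: dvd_div_eq_iff)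
  \<comment> \<open>After exchanging the sums, the inner one runs over \<open>moebius\<close> at the
    divisors of \<open>d div b\<close> and keeps only \<open>b = d\<close>.\<close>
  have low: "(\<Sum>n\<in>?Dv. moebius n * moebius_low U (d div n)) = (if d \<le> U then moebius d else 0)"
  proof -
    have "(\<Sum>n\<in>?Dv. moebius n * moebius_low U (d div n))
      = (\<Sum>n\<in>?Dv. \<Sum>b | b dvd d div n \<and> b \<le> U. moebius n * moebius b)"
      by (simp add: moebius_low_def sum_distrib_left)
    also have "\<dots> = (\<Sum>(n, b)\<in>(SIGMA n:?Dv. {b. b dvd d div n \<and> b \<le> U}). moebius n * moebius b)"
      using fin pos by (subst sum.Sigma) (auto intro: finite_subset[OF _ finite_divisors_nat])
    also have "\<dots> = (\<Sum>(b, n)\<in>(SIGMA b:{b. b dvd d \<and> b \<le> U}. {n. n dvd d div b}). moebius n * moebius b)"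
    proof (rule sum.reindex_bij_witness[of _ "\<lambda>(b, n). (n, b)" "\<lambda>(n, b). (b, n)"])
      have key: "x dvd d \<and> y dvd d div x \<longleftrightarrow> x * y dvd d" if "0 < d" for x y
        using that by (metis dvd_div_iff_mult dvd_mult_left dvd_0_left_iff div_0 mult.commute not_gr0)
      show "(case p of (n, b) \<Rightarrow> (b, n)) \<in> (SIGMA b:{b. b dvd d \<and> b \<le> U}. {n. n dvd d div b})"
        if "p \<in> (SIGMA n:?Dv. {b. b dvd d div n \<and> b \<le> U})" for p
      proof -
        obtain n b where p: "p = (n, b)" "n dvd d" "b dvd d div n" "b \<le> U" using \<open>p \<in> _\<close> by auto
        then have "b * n dvd d" using key[OF assms, of n b] by (simp add: mult.commute)
        then show ?thesis using key[OF assms, of b n] p by simp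
      qed
      show "(case p of (b, n) \<Rightarrow> (n, b)) \<in> (SIGMA n:?Dv. {b. b dvd d div n \<and> b \<le> U})"
        if "p \<in> (SIGMA b:{b. b dvd d \<and> b \<le> U}. {n. n dvd d div b})" for p
      proof -
        obtain n b where p: "p = (b, n)" "b dvd d" "n dvd d div b" "b \<le> U" using \<open>p \<in> _\<close> by auto
        then have "n * b dvd d" using key[OF assms, of b n] by (simp add: mult.commute)
        then show ?thesis using key[OF assms, of n b] p by simp
      qed
    qed auto
    also have "\<dots> = (\<Sum>b | b dvd d \<and> b \<le> U. moebius b * (\<Sum>n | n dvd d div b. moebius n))"
      using fin pos by (subst sum.Sigma[symmetric]) (auto simp: sum_distrib_left mult.commute intro: finite_subset[OF _ fin])
    also have "\<dots> = (\<Sum>b | b dvd d \<and> b \<le> U. if b = d then moebius d else 0)"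
      using pos eq1 by (intro sum.cong refl) (auto simp: sum_moebius_divisors)
    also have "\<dots> = (if d \<le> U then moebius d else 0)"
      using fin by (subst sum.delta) (auto intro: finite_subset[OF _ fin])
    finally show ?thesis .
  qed
  have "(\<Sum>n\<in>?Dv. (if U < n then moebius n else 0) * moebius_high U (d div n))
    = (\<Sum>n\<in>?Dv. (if n = d \<and> U < d then moebius d else 0)
        - (moebius n - (if n \<le> U then moebius n else 0)) * moebius_low U (d div n))"
  proof (intro sum.cong refl)
    fix n assume n: "n \<in> ?Dv"
    have h: "moebius_high U (d div n) = (if n = d then 1 else 0) - moebius_low U (d div n)"
      using moebius_low_plus_high[OF pos(1)[OF n], of U] eq1[OF n] by (simp add: algebra_simps)
    show "(if U < n then moebius n else 0) * moebius_high U (d div n)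
      = (if n = d \<and> U < d then moebius d else 0) - (moebius n - (if n \<le> U then moebius n else 0)) * moebius_low U (d div n)"
      unfolding h by (auto simp: algebra_simps)
  qed
  also have "\<dots> = (if U < d then moebius d else 0) - (if d \<le> U then moebius d else 0)
      + (\<Sum>n\<in>?Dv. (if n \<le> U then moebius n else 0) * moebius_low U (d div n))"
  proof -
    have "(\<Sum>n\<in>?Dv. if n = d \<and> U < d then moebius d else 0) = (if U < d then moebius d else 0)"
      using fin by (cases "U < d") (auto simp: sum.delta)
    then show ?thesis by (simp add: sum_subtractf left_diff_distrib low)
  qed
  finally show ?thesis by auto
qed

section \<open>Cancellation in Moebius sums\<close>

lemma sum_dyadic:
  fixes h :: "nat \<Rightarrow> 'a :: comm_monoid_add"
  shows "(\<Sum>m\<in>{1<..2 ^ K}. h m) = (\<Sum>i<K. \<Sum>m\<in>{2 ^ i<..2 * 2 ^ i}. h m)"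
proof (induction K)
  case (Suc K)
  have "{1<..2 ^ Suc K} = {1<..2 ^ K} \<union> {2 ^ K<..2 * 2 ^ K :: nat}"
    by (subst ivl_disj_un_two(6)) auto
  then have "(\<Sum>m\<in>{1<..2 ^ Suc K}. h m) = (\<Sum>m\<in>{1<..2 ^ K}. h m) + (\<Sum>m\<in>{2 ^ K<..2 * 2 ^ K}. h m)"
    by (simp only:) (rule sum.union_disjoint, auto)
  then show ?case using Suc by simp
qed simp

lemma sum_norm_product_le:
  fixes \<alpha> \<beta> :: "nat \<Rightarrow> real" and h :: "nat \<Rightarrow> nat \<Rightarrow> complex"
  assumes "\<And>m n. norm (h m n) \<le> \<bar>\<alpha> m\<bar> * \<bar>\<beta> n\<bar>"
  shows "(norm (\<Sum>m\<in>I. \<Sum>n\<in>J. h m n))\<^sup>2 \<le> (real (card I) * (\<Sum>m\<in>I. (\<alpha> m)\<^sup>2)) * (real (card J) * (\<Sum>n\<in>J. (\<beta> n)\<^sup>2))"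
proof -
  have "norm (\<Sum>m\<in>I. \<Sum>n\<in>J. h m n) \<le> (\<Sum>m\<in>I. \<Sum>n\<in>J. \<bar>\<alpha> m\<bar> * \<bar>\<beta> n\<bar>)"
    by (intro sum_norm_le assms)
  also have "\<dots> = (\<Sum>m\<in>I. \<bar>\<alpha> m\<bar>) * (\<Sum>n\<in>J. \<bar>\<beta> n\<bar>)" by (simp add: sum_product)
  finally have "(norm (\<Sum>m\<in>I. \<Sum>n\<in>J. h m n))\<^sup>2 \<le> ((\<Sum>m\<in>I. \<bar>\<alpha> m\<bar>) * (\<Sum>n\<in>J. \<bar>\<beta> n\<bar>))\<^sup>2"
    by (intro power_mono) auto
  also have "\<dots> = (\<Sum>m\<in>I. \<bar>\<alpha> m\<bar>)\<^sup>2 * (\<Sum>n\<in>J. \<bar>\<beta> n\<bar>)\<^sup>2" by (rule power_mult_distrib)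
  also have "\<dots> \<le> ((\<Sum>m\<in>I. \<bar>\<alpha> m\<bar>\<^sup>2) * real (card I)) * ((\<Sum>n\<in>J. \<bar>\<beta> n\<bar>\<^sup>2) * real (card J))"
    by (intro mult_mono sum_squared_le_sum_of_squares mult_nonneg_nonneg sum_nonneg) auto
  finally show ?thesis by (simp add: mult_ac)
qed

context modulus
begin

text \<open>If \<open>M * N\<close> is below \<open>D / w\<close>, the trivial bound already saves
  \<open>w\<close>. Otherwise \<open>M * N\<close> is at least \<open>\<rho> ^ 6 * w ^ 49\<close>,
  as the short range requires; this is where the exponent 50 in the condition on \<open>D\<close>
  comes from. The row sums save \<open>w\<close>, of which the Cauchy--Schwarz inequality keeps
  \<open>sqrt w\<close>.\<close>

lemma norm_bilinear_le:
  fixes \<rho> w L :: real and \<alpha> \<beta> :: "nat \<Rightarrow> real"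
  assumes c: "\<not> int q dvd c"
    and \<rho>: "real q = \<rho> ^ 8" "1 \<le> w" "w ^ 5 \<le> \<rho>" "4 \<le> \<rho>"
    and D: "\<rho> ^ 6 * w ^ 50 \<le> real D" and L: "LQ \<le> L" "1 + ln (real D) \<le> L"
    and \<alpha>: "\<And>m. 0 < m \<Longrightarrow> \<bar>\<alpha> m\<bar> \<le> real (card {d. d dvd m})"
    and \<beta>: "\<And>n. 0 < n \<Longrightarrow> \<bar>\<beta> n\<bar> \<le> real (card {d. d dvd n})"
    and NM: "w \<le> real N" "N \<le> M" "M * N < D"
  shows "norm (\<Sum>m\<in>{M<..2 * M}. \<Sum>n\<in>{N<..2 * N}. if m * n \<le> D then of_real (\<alpha> m * \<beta> n) * kern c (int (m * n)) else 0)
    \<le> 64 * L ^ 4 * real D / sqrt w" (is "norm ?S \<le> _")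
proof -
  have L1: "1 \<le> L" using L LQ_ge_1 by simp
  have N1: "1 \<le> N" using NM \<rho> by (cases N) auto
  have M1: "1 \<le> M" using N1 NM by simp
  have MD: "M \<le> D" using NM(3) N1 by (metis less_imp_le_nat mult.right_neutral mult_le_mono2 order_trans)
  have second_moment: "(\<Sum>m\<in>{K<..2 * K}. (\<gamma> m)\<^sup>2) \<le> 16 * real K * L ^ 3"
    if "1 \<le> K" "K \<le> D" and \<gamma>: "\<And>m. 0 < m \<Longrightarrow> \<bar>\<gamma> m\<bar> \<le> real (card {d. d dvd m})" for K and \<gamma> :: "nat \<Rightarrow> real"
  proof -
    have "(\<Sum>m\<in>{K<..2 * K}. (\<gamma> m)\<^sup>2) \<le> (\<Sum>m\<in>{K<..2 * K}. (real (card {d. d dvd m}))\<^sup>2)"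
    proof (rule sum_mono)
      fix m assume "m \<in> {K<..2 * K}"
      then have "\<bar>\<gamma> m\<bar>\<^sup>2 \<le> (real (card {d. d dvd m}))\<^sup>2" by (intro power_mono \<gamma>) auto
      then show "(\<gamma> m)\<^sup>2 \<le> (real (card {d. d dvd m}))\<^sup>2" by simp
    qed
    also have "\<dots> \<le> (\<Sum>m\<in>{1..2 * K}. (real (card {d. d dvd m}))\<^sup>2)"
      by (intro sum_mono2) auto
    also have "\<dots> \<le> real (2 * K) * (1 + ln (real (2 * K))) ^ 3"
      using that(1) by (intro sum_card_divisors_squared_le) simp
    also have "\<dots> \<le> real (2 * K) * (2 * L) ^ 3"
    proof (intro mult_left_mono power_mono)
      have "ln (real (2 * K)) = ln 2 + ln (real K)" using that(1) by (simp add: ln_mult)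
      also have "\<dots> \<le> 1 + ln (real D)"
        using that(1,2) ln_2_less_1 by (intro add_mono) auto
      finally show "1 + ln (real (2 * K)) \<le> 2 * L" using L L1 by linarith
      show "0 \<le> 1 + ln (real (2 * K))" using that(1) by simp
    qed auto
    finally show ?thesis by (simp add: power_mult_distrib)
  qed
  have a2: "(\<Sum>m\<in>{M<..2 * M}. (\<alpha> m)\<^sup>2) \<le> 16 * real M * L ^ 3"
    by (rule second_moment[OF M1 MD \<alpha>])
  have b2: "(\<Sum>n\<in>{N<..2 * N}. (\<beta> n)\<^sup>2) \<le> 16 * real N * L ^ 3"
    by (rule second_moment[OF N1 _ \<beta>]) (use MD NM in auto)
  have MN0: "0 \<le> real M * real N" by simp
  have MND: "real M * real N \<le> real D" using of_nat_mono[OF less_imp_le[OF NM(3)], where 'a = real] by simp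
  have sw: "1 \<le> sqrt w" "sqrt w * sqrt w = w" using \<rho> by simp_all
  show ?thesis
  proof (cases "real M * real N * w < real D")
    case True
    let ?h = "\<lambda>m n. if m * n \<le> D then of_real (\<alpha> m * \<beta> n) * kern c (int (m * n)) else 0"
    have "norm (?h m n) \<le> \<bar>\<alpha> m\<bar> * \<bar>\<beta> n\<bar>" for m n
      using norm_kern_le[of c "int (m * n)"] mult_left_mono[of "norm (kern c (int (m * n)))" 1 "\<bar>\<alpha> m * \<beta> n\<bar>"]
      by (auto simp: norm_mult abs_mult simp del: of_nat_mult)
    then have "(norm ?S)\<^sup>2 \<le> (real (card {M<..2 * M}) * (\<Sum>m\<in>{M<..2 * M}. (\<alpha> m)\<^sup>2)) * (real (card {N<..2 * N}) * (\<Sum>n\<in>{N<..2 * N}. (\<beta> n)\<^sup>2))"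
      by (rule sum_norm_product_le)
    also have "\<dots> \<le> (real M * (16 * real M * L ^ 3)) * (real N * (16 * real N * L ^ 3))"
      using a2 b2 L1 by (intro mult_mono mult_nonneg_nonneg sum_nonneg) auto
    also have "\<dots> = (16 * L ^ 3 * (real M * real N))\<^sup>2"
      by (simp add: power2_eq_square)
    finally have "norm ?S \<le> 16 * L ^ 3 * (real M * real N)"
      by (rule power2_le_imp_le) (use L1 in auto)
    also have "\<dots> \<le> 64 * L ^ 4 * (real D / sqrt w)"
    proof (intro mult_mono)
      show "L ^ 3 \<le> L ^ 4" using L1 by (intro power_increasing) auto
      have "real M * real N * sqrt w \<le> real M * real N * w"
        using sw by (intro mult_left_mono) (metis dual_order.trans mult_le_cancel_right1 real_sqrt_ge_0_iff zero_le_one mult_left_mono mult.right_neutral, simp)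
      then show "real M * real N \<le> real D / sqrt w"
        using True sw by (simp add: field_simps)
    qed (use L1 in auto)
    finally show ?thesis by simp
  next
    case False
    have E: "(\<Sum>n'\<in>{N<..2 * N}. norm (kern_corr c D M n n')) \<le> 16 * LQ * real M * real N / w" if "n \<in> {N<..2 * N}" for n
    proof (cases "\<rho> ^ 6 * w \<le> real M")
      case True
      then show ?thesis using \<rho> NM by (intro sum_kern_corr_long[OF c \<rho>(1,2,3)]) auto
    next
      case False2: False
      have "\<rho> ^ 6 * w ^ 50 = (\<rho> ^ 6 * w ^ 49) * w" by (simp add: power_numeral_reduce)
      then have "(\<rho> ^ 6 * w ^ 49) * w \<le> real M * real N * w" using False D by linarith
      then have "\<rho> ^ 6 * w ^ 49 \<le> real M * real N" using \<rho> by (simp add: mult_le_cancel_right)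
      then show ?thesis using False2 NM that by (intro sum_kern_corr_short[OF c \<rho>]) auto
    qed
    have "(norm ?S)\<^sup>2 \<le> (\<Sum>m\<in>{M<..2 * M}. (\<alpha> m)\<^sup>2) * ((\<Sum>n\<in>{N<..2 * N}. (\<beta> n)\<^sup>2) * (16 * LQ * real M * real N / w))"
      by (rule bilinear_Cauchy[OF E])
    also have "\<dots> \<le> (16 * real M * L ^ 3) * ((16 * real N * L ^ 3) * (16 * L * real M * real N / w))"
      using a2 b2 L1 L LQ_ge_1 \<rho>
      by (intro mult_mono mult_nonneg_nonneg divide_right_mono divide_nonneg_nonneg sum_nonneg) auto
    also have "\<dots> = 4096 * L ^ 7 * (real M * real N)\<^sup>2 / w"
      by (simp add: power_numeral_reduce power2_eq_square)
    also have "\<dots> \<le> 4096 * L ^ 8 * (real D)\<^sup>2 / w"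
      using L1 \<rho> MND by (intro divide_right_mono mult_mono power_mono power_increasing) auto
    also have "\<dots> = (64 * L ^ 4 * real D / sqrt w)\<^sup>2"
      using \<rho> by (simp add: power_divide power_mult_distrib flip: power_mult)
    finally show ?thesis
      by (rule power2_le_imp_le) (use L1 sw in auto)
  qed
qed

text \<open>The row sums need the longer variable inside; the summand depends on
  \<open>m * n\<close> only, so the two roles can be exchanged.\<close>

lemma norm_bilinear_symmetric_le:
  fixes \<rho> w L :: real and \<alpha> \<beta> :: "nat \<Rightarrow> real"
  assumes c: "\<not> int q dvd c"
    and \<rho>: "real q = \<rho> ^ 8" "1 \<le> w" "w ^ 5 \<le> \<rho>" "4 \<le> \<rho>"
    and D: "\<rho> ^ 6 * w ^ 50 \<le> real D" and L: "LQ \<le> L" "1 + ln (real D) \<le> L"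
    and \<alpha>: "\<And>m. 0 < m \<Longrightarrow> \<bar>\<alpha> m\<bar> \<le> real (card {d. d dvd m})"
    and \<beta>: "\<And>n. 0 < n \<Longrightarrow> \<bar>\<beta> n\<bar> \<le> real (card {d. d dvd n})"
    and NM: "w \<le> real N" "w \<le> real M" "M * N < D"
  shows "norm (\<Sum>m\<in>{M<..2 * M}. \<Sum>n\<in>{N<..2 * N}. if m * n \<le> D then of_real (\<alpha> m * \<beta> n) * kern c (int (m * n)) else 0)
    \<le> 64 * L ^ 4 * real D / sqrt w"
proof (cases "N \<le> M")
  case True
  then show ?thesis using assms by (intro norm_bilinear_le) auto
next
  case False
  have "(\<Sum>m\<in>{M<..2 * M}. \<Sum>n\<in>{N<..2 * N}. if m * n \<le> D then of_real (\<alpha> m * \<beta> n) * kern c (int (m * n)) else 0)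
    = (\<Sum>n\<in>{N<..2 * N}. \<Sum>m\<in>{M<..2 * M}. if n * m \<le> D then of_real (\<beta> n * \<alpha> m) * kern c (int (n * m)) else 0)"
    by (subst sum.swap) (simp only: mult.commute)
  then show ?thesis
    using norm_bilinear_le[OF c \<rho> D L \<beta> \<alpha>, of M N] NM False by (simp add: mult.commute)
qed

lemma norm_sum_kern_multiples_le:
  assumes "\<not> int q dvd c" "0 < k"
  shows "norm (\<Sum>r = 1..R. kern c (int (r * k))) \<le> 4 * real q powr (3 / 4) * (LQ + real R / real q)"
proof (cases "q dvd k")
  case True
  then have "(\<Sum>r = 1..R. kern c (int (r * k))) = 0"
    by (intro sum.neutral) (auto simp: kern_def)
  then show ?thesis using LQ_ge_1 by simp
next
  case False
  have "kern c (int (r * k)) = kern (c * isq (int k)) (int r)" for r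
    using kern_mult[of "int k" c "int r"] False by (simp add: mult.commute)
  moreover have "\<not> int q dvd c * isq (int k)"
    using assms False prime_int_q by (simp add: prime_dvd_mult_iff dvd_isq_iff)
  ultimately show ?thesis
    using norm_sum_kern_le[of "c * isq (int k)" 0 R] by (simp add: atLeastSucAtMost_greaterThanAtMost)
qed

text \<open>With a cutoff \<open>U\<close> of size \<open>w\<close> the sums over intervals lose
  only about \<open>\<rho> ^ 6 * w\<^sup>2\<close>, far below \<open>D / sqrt w\<close>. The
  bilinear part is cut into at most \<open>(2 * L)\<^sup>2\<close> dyadic rectangles, hence
  \<open>L ^ 6\<close> from the \<open>L ^ 4\<close> of a single one.\<close>

lemma norm_sum_moebius_kern_le:
  fixes \<rho> w L :: real
  assumes c: "\<not> int q dvd c"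
    and \<rho>: "real q = \<rho> ^ 8" "1 \<le> w" "w ^ 5 \<le> \<rho>" "4 \<le> \<rho>"
    and D: "\<rho> ^ 6 * w ^ 50 \<le> real D" and L: "LQ \<le> L" "1 + ln (real D) \<le> L"
  shows "norm (\<Sum>d = 1..D. of_int (moebius d) * kern c (int d)) \<le> 400 * L ^ 6 * real D / sqrt w"
proof -
  \<comment> \<open>With \<open>2 * w \<le> U\<close>, a dyadic interval from \<open>N\<close> to
    \<open>2 * N\<close> that meets the numbers above \<open>U\<close> has \<open>w \<le> N\<close>,
    as the bilinear estimate demands.\<close>
  define U where "U = 2 * nat \<lceil>w\<rceil>"
  define K where "K = nat \<lceil>log 2 (real D)\<rceil>"
  define \<alpha> where "\<alpha> m = real_of_int (moebius_high U m)" for m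
  define \<beta> where "\<beta> n = (if U < n then real_of_int (moebius n) else 0)" for n
  define \<gamma> where "\<gamma> n = (if n \<le> U then moebius n else 0)" for n
  have L1: "1 \<le> L" using L LQ_ge_1 by simp
  have w\<rho>: "w \<le> \<rho>"
  proof -
    have "w \<le> w ^ 5" using \<rho>(2) by (rule self_le_power) simp
    then show ?thesis using \<rho>(3) by simp
  qed
  have \<rho>6: "real q powr (3 / 4) = \<rho> ^ 6"
    using \<rho>(4) by (simp add: \<rho>(1) powr_realpow[symmetric] powr_powr flip: powr_numeral)
  have sw: "1 \<le> sqrt w" "sqrt w * sqrt w = w" "sqrt w \<le> w"
  proof -
    show "1 \<le> sqrt w" "sqrt w * sqrt w = w" using \<rho> by simp_all
    then show "sqrt w \<le> w" using mult_left_mono[of 1 "sqrt w" "sqrt w"] by simp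
  qed
  have Dw: "\<rho> ^ 6 * w ^ 3 \<le> real D"
  proof -
    have "\<rho> ^ 6 * w ^ 3 \<le> \<rho> ^ 6 * w ^ 50" using \<rho> by (intro mult_left_mono power_increasing) auto
    then show ?thesis using D by simp
  qed
  have U: "2 * w \<le> real U" "real U \<le> 4 * w" "1 \<le> U"
  proof -
    have a: "w \<le> real (nat \<lceil>w\<rceil>)" "real (nat \<lceil>w\<rceil>) \<le> w + 1" using \<rho>(2) by linarith+
    have e: "real U = 2 * real (nat \<lceil>w\<rceil>)" by (simp only: U_def of_nat_mult of_nat_numeral)
    show "2 * w \<le> real U" "real U \<le> 4 * w" using a \<rho>(2) unfolding e by linarith+
    then have "0 < real U" using \<rho>(2) by linarith
    then show "1 \<le> U" by simp
  qed
  have w3: "4 * w \<le> real D / sqrt w" "\<rho> ^ 6 * w\<^sup>2 \<le> real D / sqrt w"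
  proof -
    have "\<rho> ^ 6 * w\<^sup>2 * sqrt w \<le> \<rho> ^ 6 * w\<^sup>2 * w" using sw \<rho> by (intro mult_left_mono) auto
    also have "\<dots> = \<rho> ^ 6 * w ^ 3" by (simp add: power_numeral_reduce)
    also have "\<dots> \<le> real D" by (rule Dw)
    finally show 1: "\<rho> ^ 6 * w\<^sup>2 \<le> real D / sqrt w" using sw by (simp add: field_simps)
    have "4 * w \<le> \<rho> ^ 6 * w\<^sup>2"
    proof (rule mult_mono)
      have "\<rho> \<le> \<rho> ^ 6" using \<rho>(4) by (intro self_le_power) auto
      then show "4 \<le> \<rho> ^ 6" using \<rho>(4) by simp
      show "w \<le> w\<^sup>2" using \<rho>(2) by (intro self_le_power) auto
    qed (use \<rho> in auto)
    then show "4 * w \<le> real D / sqrt w" using 1 by simp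
  qed
  have UD: "real U \<le> real D"
  proof -
    have "real D / sqrt w \<le> real D / 1" using sw by (intro divide_left_mono) auto
    then show ?thesis using w3 U by simp
  qed
  have D1: "1 \<le> D" using UD U by simp
  have K: "D \<le> 2 ^ K" "real K \<le> 2 * L"
  proof -
    have "real D = 2 powr log 2 (real D)" using D1 by simp
    also have "\<dots> \<le> 2 powr real K"
      by (intro powr_mono) (auto simp: K_def real_nat_ceiling_ge)
    also have "\<dots> = real (2 ^ K)" by (simp add: powr_realpow)
    finally show "D \<le> 2 ^ K" by (simp only: of_nat_le_iff)
    have "0 \<le> log 2 (real D)" using D1 by simp
    then have "real K \<le> log 2 (real D) + 1" unfolding K_def by linarith
    also have "log 2 (real D) \<le> 2 * ln (real D)"
    proof -
      have "ln (real D) * 1 \<le> ln (real D) * (2 * ln 2)"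
        using D1 ln2_ge_two_thirds by (intro mult_left_mono) auto
      then show ?thesis by (simp add: log_def field_simps)
    qed
    finally show "real K \<le> 2 * L" using L D1 by (simp add: algebra_simps)
  qed
  let ?f = "\<lambda>d. kern c (int d)"
  let ?T0 = "\<Sum>d = 1..D. of_int (\<gamma> d) * ?f d"
  let ?T1 = "\<Sum>n = 1..D. \<Sum>m = 1..D div n. of_int (\<gamma> n) * of_int (moebius_low U m) * ?f (m * n)"
  let ?T2 = "\<Sum>n = 1..D. \<Sum>m = 1..D div n. of_real (\<alpha> m * \<beta> n) * ?f (m * n)"
  have "(\<Sum>d = 1..D. of_int (moebius d) * ?f d)
    = (\<Sum>d = 1..D. 2 * (of_int (\<gamma> d) * ?f d)
        - (\<Sum>n | n dvd d. of_int (\<gamma> n) * of_int (moebius_low U (d div n)) * ?f (d div n * n))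
        + (\<Sum>n | n dvd d. of_real (\<alpha> (d div n) * \<beta> n) * ?f (d div n * n)))"
  proof (rule sum.cong[OF refl])
    fix d assume d: "d \<in> {1..D}"
    have "of_int (moebius d) = (of_int (2 * \<gamma> d - (\<Sum>n | n dvd d. \<gamma> n * moebius_low U (d div n))
        + (\<Sum>n | n dvd d. (if U < n then moebius n else 0) * moebius_high U (d div n))) :: complex)"
      using Vaughan_identity[of d U] d unfolding \<gamma>_def by simp
    also have "\<dots> = 2 * of_int (\<gamma> d) - (\<Sum>n | n dvd d. of_int (\<gamma> n) * of_int (moebius_low U (d div n)))
        + (\<Sum>n | n dvd d. of_real (\<alpha> (d div n) * \<beta> n))"
    proof -
      have "of_int (\<Sum>n | n dvd d. (if U < n then moebius n else 0) * moebius_high U (d div n))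
        = (\<Sum>n | n dvd d. complex_of_real (\<alpha> (d div n) * \<beta> n))"
        unfolding of_int_sum by (rule sum.cong[OF refl]) (simp add: \<alpha>_def \<beta>_def mult.commute)
      then show ?thesis by simp
    qed
    finally have "of_int (moebius d) * ?f d = 2 * (of_int (\<gamma> d) * ?f d)
        - (\<Sum>n | n dvd d. of_int (\<gamma> n) * of_int (moebius_low U (d div n)) * ?f d)
        + (\<Sum>n | n dvd d. of_real (\<alpha> (d div n) * \<beta> n) * ?f d)"
      by (simp add: left_diff_distrib distrib_right sum_distrib_right)
    moreover have "(\<Sum>n | n dvd d. g n * ?f (d div n * n)) = (\<Sum>n | n dvd d. g n * ?f d)" for g
      by (rule sum.cong[OF refl]) simp
    ultimately show "of_int (moebius d) * ?f d = 2 * (of_int (\<gamma> d) * ?f d)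
        - (\<Sum>n | n dvd d. of_int (\<gamma> n) * of_int (moebius_low U (d div n)) * ?f (d div n * n))
        + (\<Sum>n | n dvd d. of_real (\<alpha> (d div n) * \<beta> n) * ?f (d div n * n))"
      by (simp only:)
  qed
  also have "\<dots> = 2 * ?T0 - ?T1 + ?T2"
    unfolding sum.distrib sum_subtractf
    using sum_divisor_pairs[of "\<lambda>m n. of_int (\<gamma> n) * of_int (moebius_low U m) * ?f (m * n)" D]
      sum_divisor_pairs[of "\<lambda>m n. of_real (\<alpha> m * \<beta> n) * ?f (m * n)" D]
    by (simp add: sum_distrib_left)
  finally have split: "(\<Sum>d = 1..D. of_int (moebius d) * ?f d) = 2 * ?T0 - ?T1 + ?T2" .
  have norm_moebius: "norm (of_int (moebius n) :: complex) \<le> 1" for n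
    using abs_moebius_le[of n] by (simp flip: of_int_abs)
  have norm_\<gamma>: "norm (of_int (\<gamma> n) :: complex) \<le> (if n \<le> U then 1 else 0)" for n
    using norm_moebius by (simp add: \<gamma>_def)
  have T0: "norm ?T0 \<le> real U"
  proof -
    have "norm ?T0 \<le> (\<Sum>d = 1..D. if d \<le> U then 1 else 0)"
    proof (rule sum_norm_le)
      fix d
      have "norm (of_int (\<gamma> d) :: complex) * norm (?f d) \<le> (if d \<le> U then 1 else 0) * 1"
        by (intro mult_mono norm_\<gamma> norm_kern_le) auto
      then show "norm (of_int (\<gamma> d) * ?f d) \<le> (if d \<le> U then 1 else 0)" by (simp add: norm_mult)
    qed
    also have "\<dots> = real (card {d \<in> {1..D}. d \<le> U})"
      using sum.inter_filter[of "{1..D}" "\<lambda>_. 1 :: real" "\<lambda>d. d \<le> U"] by simp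
    also have "\<dots> \<le> real (card {1..U})" by (intro of_nat_mono card_mono) auto
    finally show ?thesis by simp
  qed
  \<comment> \<open>For each of the at most \<open>U\<^sup>2\<close> pairs of small variables
    \<open>n\<close>, \<open>b\<close>, completion is applied to the multiples of
    \<open>b * n\<close>.\<close>
  have T1: "norm ?T1 \<le> 4 * \<rho> ^ 6 * L * (real U)\<^sup>2 + 4 * \<rho> ^ 6 * (real D / real q) * L\<^sup>2"
  proof -
    let ?B = "\<lambda>n b. 4 * \<rho> ^ 6 * (LQ + real D / real q * (1 / real n * (1 / real b)))"
    have B0: "0 \<le> ?B n b" for n b using \<rho> LQ_ge_1 by simp
    have inner: "norm (\<Sum>m = 1..D div n. of_int (moebius_low U m) * ?f (m * n)) \<le> (\<Sum>b = 1..U. ?B n b)"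
      if n: "1 \<le> n" for n
    proof -
      let ?H = "D div n"
      have "(\<Sum>m = 1..?H. of_int (moebius_low U m) * ?f (m * n))
        = (\<Sum>m = 1..?H. \<Sum>b | b dvd m. of_int (\<gamma> b) * ?f (m div b * (b * n)))"
      proof (rule sum.cong[OF refl])
        fix m assume m: "m \<in> {1..?H}"
        then have "finite {b. b dvd m}" by simp
        then have "moebius_low U m = (\<Sum>b | b dvd m. \<gamma> b)"
          unfolding moebius_low_def \<gamma>_def
          using sum.inter_filter[of "{b. b dvd m}" moebius "\<lambda>b. b \<le> U"] by simp
        then have "of_int (moebius_low U m) * ?f (m * n) = (\<Sum>b | b dvd m. of_int (\<gamma> b) * ?f (m * n))"
          by (simp add: sum_distrib_right)
        also have "\<dots> = (\<Sum>b | b dvd m. of_int (\<gamma> b) * ?f (m div b * (b * n)))"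
          by (intro sum.cong refl) (simp flip: mult.assoc)
        finally show "of_int (moebius_low U m) * ?f (m * n) = (\<Sum>b | b dvd m. of_int (\<gamma> b) * ?f (m div b * (b * n)))" .
      qed
      also have "\<dots> = (\<Sum>b = 1..?H. \<Sum>r = 1..?H div b. of_int (\<gamma> b) * ?f (r * (b * n)))"
        by (rule sum_divisor_pairs)
      finally have "norm (\<Sum>m = 1..?H. of_int (moebius_low U m) * ?f (m * n))
        = norm (\<Sum>b = 1..?H. \<Sum>r = 1..?H div b. of_int (\<gamma> b) * ?f (r * (b * n)))" by (rule arg_cong)
      also have "\<dots> \<le> (\<Sum>b = 1..?H. if b \<le> U then ?B n b else 0)"
      proof (rule sum_norm_le)
        fix b assume b: "b \<in> {1..?H}"
        have "norm (\<Sum>r = 1..?H div b. ?f (r * (b * n))) \<le> 4 * \<rho> ^ 6 * (LQ + real (?H div b) / real q)"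
          using norm_sum_kern_multiples_le[OF c, of "b * n" "?H div b"] b n \<rho>6 by simp
        also have "\<dots> \<le> ?B n b"
        proof -
          have "real (?H div b) \<le> real D / real (n * b)"
            unfolding div_mult2_eq[symmetric] by (rule of_nat_div_le_of_nat)
          then have "real (?H div b) / real q \<le> real D / real (n * b) / real q" by (intro divide_right_mono) auto
          then show ?thesis using \<rho> by (intro mult_left_mono) (auto simp: mult.commute)
        qed
        finally have "norm (\<Sum>r = 1..?H div b. ?f (r * (b * n))) \<le> ?B n b" .
        then have "norm (of_int (\<gamma> b) :: complex) * norm (\<Sum>r = 1..?H div b. ?f (r * (b * n))) \<le> (if b \<le> U then 1 else 0) * ?B n b"
          by (intro mult_mono norm_\<gamma>) auto
        then show "norm (\<Sum>r = 1..?H div b. of_int (\<gamma> b) * ?f (r * (b * n))) \<le> (if b \<le> U then ?B n b else 0)"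
          unfolding sum_distrib_left[symmetric] norm_mult by (simp split: if_splits)
      qed
      also have "\<dots> = (\<Sum>b\<in>{b \<in> {1..?H}. b \<le> U}. ?B n b)" by (rule sum.inter_filter[symmetric]) simp
      also have "\<dots> \<le> (\<Sum>b = 1..U. ?B n b)" by (intro sum_mono2 B0) auto
      finally show ?thesis .
    qed
    have "norm ?T1 \<le> (\<Sum>n = 1..D. if n \<le> U then (\<Sum>b = 1..U. ?B n b) else 0)"
    proof (rule sum_norm_le)
      fix n assume n: "n \<in> {1..D}"
      have "norm (of_int (\<gamma> n) :: complex) * norm (\<Sum>m = 1..D div n. of_int (moebius_low U m) * ?f (m * n))
        \<le> (if n \<le> U then 1 else 0) * (\<Sum>b = 1..U. ?B n b)"
        using n by (intro mult_mono norm_\<gamma> inner) auto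
      then show "norm (\<Sum>m = 1..D div n. of_int (\<gamma> n) * of_int (moebius_low U m) * ?f (m * n))
        \<le> (if n \<le> U then (\<Sum>b = 1..U. ?B n b) else 0)"
        unfolding mult.assoc sum_distrib_left[symmetric] norm_mult by (simp split: if_splits)
    qed
    also have "\<dots> = (\<Sum>n\<in>{n \<in> {1..D}. n \<le> U}. \<Sum>b = 1..U. ?B n b)" by (rule sum.inter_filter[symmetric]) simp
    also have "\<dots> \<le> (\<Sum>n = 1..U. \<Sum>b = 1..U. ?B n b)" by (intro sum_mono2 sum_nonneg B0) auto
    also have "\<dots> = 4 * \<rho> ^ 6 * (LQ * (real U)\<^sup>2 + real D / real q * (\<Sum>n = 1..U. 1 / real n)\<^sup>2)"
    proof -
      have "(\<Sum>n = 1..U. 1 / real n)\<^sup>2 = (\<Sum>n = 1..U. \<Sum>b = 1..U. 1 / real n * (1 / real b))"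
        by (simp only: power2_eq_square sum_product)
      then show ?thesis
        unfolding sum_distrib_left[symmetric] sum.distrib by (simp add: power2_eq_square mult_ac)
    qed
    also have "\<dots> \<le> 4 * \<rho> ^ 6 * (L * (real U)\<^sup>2 + real D / real q * L\<^sup>2)"
    proof (intro mult_left_mono add_mono mult_right_mono power_mono L)
      have "(\<Sum>n = 1..U. 1 / real n) \<le> 1 + ln (real U)" using U by (intro sum_inverse_le_ln) simp
      also have "\<dots> \<le> 1 + ln (real D)" using UD U by simp
      finally show "(\<Sum>n = 1..U. 1 / real n) \<le> L" using L by simp
    qed (use \<rho> in \<open>auto intro: sum_nonneg\<close>)
    finally show ?thesis by (simp add: algebra_simps)
  qed
  have T2: "norm ?T2 \<le> (real K)\<^sup>2 * (64 * L ^ 4 * real D / sqrt w)"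
  proof -
    let ?g = "\<lambda>m n. if m * n \<le> D then of_real (\<alpha> m * \<beta> n) * ?f (m * n) else 0"
    have \<alpha>0: "\<alpha> m = 0" if "0 < m" "m \<le> U" for m using that by (simp add: \<alpha>_def moebius_high_eq_0)
    have \<beta>0: "\<beta> n = 0" if "n \<le> U" for n using that by (simp add: \<beta>_def)
    have row: "(\<Sum>m = 1..D div n. of_real (\<alpha> m * \<beta> n) * ?f (m * n)) = (\<Sum>m\<in>{1<..2 ^ K}. ?g m n)"
      if n: "1 \<le> n" for n
    proof -
      have "(\<Sum>m = 1..D div n. of_real (\<alpha> m * \<beta> n) * ?f (m * n)) = (\<Sum>m\<in>{1..D div n}. ?g m n)"
        using n by (intro sum.cong refl) (auto simp: less_eq_div_iff_mult_less_eq)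
      also have "\<dots> = (\<Sum>m\<in>{1..2 ^ K}. ?g m n)"
      proof (rule sum.mono_neutral_left)
        have "D div n \<le> 2 ^ K" using K(1) by (meson div_le_dividend order.trans)
        then show "{1..D div n} \<subseteq> {1..2 ^ K}" by auto
        show "\<forall>m\<in>{1..2 ^ K} - {1..D div n}. ?g m n = 0"
          using n by (auto simp: less_eq_div_iff_mult_less_eq)
      qed simp
      also have "\<dots> = (\<Sum>m\<in>{1<..2 ^ K}. ?g m n)"
      proof (rule sum.mono_neutral_right)
        show "\<forall>m\<in>{1..2 ^ K} - {1<..2 ^ K}. ?g m n = 0"
        proof
          fix m :: nat assume "m \<in> {1..2 ^ K} - {1<..2 ^ K}"
          then have "m = 1" by auto
          then show "?g m n = 0" using \<alpha>0[of 1] U by simp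
        qed
      qed auto
      finally show ?thesis .
    qed
    have "?T2 = (\<Sum>n = 1..D. \<Sum>m\<in>{1<..2 ^ K}. ?g m n)"
      by (intro sum.cong refl row) simp
    also have "\<dots> = (\<Sum>n\<in>{1..2 ^ K}. \<Sum>m\<in>{1<..2 ^ K}. ?g m n)"
    proof (rule sum.mono_neutral_left)
      show "{1..D} \<subseteq> {1..2 ^ K}" using K(1) by auto
      show "\<forall>n\<in>{1..2 ^ K} - {1..D}. (\<Sum>m\<in>{1<..2 ^ K}. ?g m n) = 0"
      proof
        fix n assume "n \<in> {1..2 ^ K} - {1..D}"
        then have n: "D < n" by auto
        show "(\<Sum>m\<in>{1<..2 ^ K}. ?g m n) = 0"
        proof (rule sum.neutral, rule ballI)
          fix m :: nat assume "m \<in> {1<..2 ^ K}"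
          then have "n \<le> m * n" by simp
          then have "\<not> m * n \<le> D" using n by linarith
          then show "?g m n = 0" by (rule if_not_P)
        qed
      qed
    qed simp
    also have "\<dots> = (\<Sum>n\<in>{1<..2 ^ K}. \<Sum>m\<in>{1<..2 ^ K}. ?g m n)"
    proof (rule sum.mono_neutral_right)
      show "\<forall>n\<in>{1..2 ^ K} - {1<..2 ^ K}. (\<Sum>m\<in>{1<..2 ^ K}. ?g m n) = 0"
      proof
        fix n :: nat assume "n \<in> {1..2 ^ K} - {1<..2 ^ K}"
        then have "n = 1" by auto
        then show "(\<Sum>m\<in>{1<..2 ^ K}. ?g m n) = 0" using \<beta>0[of 1] U by (intro sum.neutral) simp
      qed
    qed auto
    also have "\<dots> = (\<Sum>j<K. \<Sum>n\<in>{2 ^ j<..2 * 2 ^ j}. \<Sum>i<K. \<Sum>m\<in>{2 ^ i<..2 * 2 ^ i}. ?g m n)"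
      by (simp only: sum_dyadic)
    also have "\<dots> = (\<Sum>j<K. \<Sum>i<K. \<Sum>n\<in>{2 ^ j<..2 * 2 ^ j}. \<Sum>m\<in>{2 ^ i<..2 * 2 ^ i}. ?g m n)"
      by (rule sum.cong[OF refl], rule sum.swap)
    also have "\<dots> = (\<Sum>j<K. \<Sum>i<K. \<Sum>m\<in>{2 ^ i<..2 * 2 ^ i}. \<Sum>n\<in>{2 ^ j<..2 * 2 ^ j}. ?g m n)"
      by (rule sum.cong[OF refl], rule sum.cong[OF refl], rule sum.swap)
    finally have "norm ?T2 = norm (\<Sum>j<K. \<Sum>i<K. \<Sum>m\<in>{2 ^ i<..2 * 2 ^ i}. \<Sum>n\<in>{2 ^ j<..2 * 2 ^ j}. ?g m n)"
      by (rule arg_cong)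
    also have "\<dots> \<le> (\<Sum>j<K. \<Sum>i<K. 64 * L ^ 4 * real D / sqrt w)"
    proof (intro sum_norm_le)
      fix i j :: nat
      let ?M = "2 ^ i :: nat" and ?N = "2 ^ j :: nat"
      \<comment> \<open>In the first three cases every term vanishes: the rectangle lies beyond the
        hyperbola, or one coefficient is supported above \<open>U\<close> only.\<close>
      consider "D \<le> ?M * ?N" | "2 * ?N \<le> U" | "2 * ?M \<le> U" | "?M * ?N < D" "U < 2 * ?N" "U < 2 * ?M"
        by linarith
      then show "norm (\<Sum>m\<in>{?M<..2 * ?M}. \<Sum>n\<in>{?N<..2 * ?N}. ?g m n) \<le> 64 * L ^ 4 * real D / sqrt w"
      proof cases
        case 1
        have "?g m n = 0" if "m \<in> {?M<..2 * ?M}" "n \<in> {?N<..2 * ?N}" for m n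
        proof -
          have "?M * ?N < m * n" using that by (intro mult_strict_mono) auto
          then show ?thesis using 1 by simp
        qed
        then have "(\<Sum>m\<in>{?M<..2 * ?M}. \<Sum>n\<in>{?N<..2 * ?N}. ?g m n) = 0" by (intro sum.neutral ballI) blast
        then show ?thesis using L1 sw by simp
      next
        case 2
        then have "?g m n = 0" if "m \<in> {?M<..2 * ?M}" "n \<in> {?N<..2 * ?N}" for m n
          using that \<beta>0[of n] by simp
        then have "(\<Sum>m\<in>{?M<..2 * ?M}. \<Sum>n\<in>{?N<..2 * ?N}. ?g m n) = 0" by (intro sum.neutral ballI) blast
        then show ?thesis using L1 sw by simp
      next
        case 3
        then have "?g m n = 0" if "m \<in> {?M<..2 * ?M}" "n \<in> {?N<..2 * ?N}" for m n
          using that \<alpha>0[of m] by simp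
        then have "(\<Sum>m\<in>{?M<..2 * ?M}. \<Sum>n\<in>{?N<..2 * ?N}. ?g m n) = 0" by (intro sum.neutral ballI) blast
        then show ?thesis using L1 sw by simp
      next
        case 4
        have "real U \<le> real (2 * ?N)" "real U \<le> real (2 * ?M)" using 4 by (auto simp only: of_nat_le_iff)
        then have wN: "w \<le> real ?N" "w \<le> real ?M" using U(1) unfolding of_nat_mult by linarith+
        show ?thesis
        proof (rule norm_bilinear_symmetric_le[OF c \<rho> D L])
          show "\<bar>\<alpha> m\<bar> \<le> real (card {d. d dvd m})" if "0 < m" for m
            using abs_moebius_high_le[OF that] by (simp add: \<alpha>_def)
          show "\<bar>\<beta> n\<bar> \<le> real (card {d. d dvd n})" if "0 < n" for n
          proof -
            have "1 \<le> card {d. d dvd n}" using that by (simp add: Suc_le_eq card_gt_0_iff) blast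
            then show ?thesis using abs_moebius_le[of n] by (simp add: \<beta>_def flip: of_int_abs)
          qed
        qed (use wN 4 in auto)
      qed
    qed
    also have "\<dots> = (real K)\<^sup>2 * (64 * L ^ 4 * real D / sqrt w)" by (simp add: power2_eq_square)
    finally show ?thesis .
  qed
  let ?Z = "L ^ 6 * (real D / sqrt w)"
  have Z: "L * (real D / sqrt w) \<le> ?Z" "L\<^sup>2 * (real D / sqrt w) \<le> ?Z" "1 * (real D / sqrt w) \<le> ?Z"
  proof -
    have "L ^ 1 \<le> L ^ 6" "L\<^sup>2 \<le> L ^ 6" "L ^ 0 \<le> L ^ 6" using L1 by (intro power_increasing; simp)+
    then show "L * (real D / sqrt w) \<le> ?Z" "L\<^sup>2 * (real D / sqrt w) \<le> ?Z" "1 * (real D / sqrt w) \<le> ?Z"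
      using sw by (intro mult_right_mono; simp)+
  qed
  have n0: "2 * norm ?T0 \<le> 2 * ?Z" using T0 U(2) w3(1) Z(3) by linarith
  have n1: "norm ?T1 \<le> 68 * ?Z"
  proof -
    have "4 * \<rho> ^ 6 * L * (real U)\<^sup>2 \<le> 4 * \<rho> ^ 6 * L * (4 * w)\<^sup>2"
      using U \<rho> L1 by (intro mult_left_mono power_mono) auto
    also have "\<dots> = 64 * (L * (\<rho> ^ 6 * w\<^sup>2))" by (simp add: power_mult_distrib)
    also have "\<dots> \<le> 64 * (L * (real D / sqrt w))" using w3(2) L1 by (intro mult_left_mono) auto
    finally have a: "4 * \<rho> ^ 6 * L * (real U)\<^sup>2 \<le> 64 * ?Z" using Z(1) by linarith
    have "\<rho> ^ 6 * (real D / real q) \<le> real D / sqrt w"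
    proof -
      have "\<rho> ^ 6 * sqrt w \<le> \<rho> ^ 6 * \<rho>\<^sup>2"
      proof (intro mult_left_mono)
        have "\<rho> \<le> \<rho>\<^sup>2" using \<rho>(4) by (intro self_le_power) auto
        then show "sqrt w \<le> \<rho>\<^sup>2" using sw w\<rho> by linarith
      qed (use \<rho> in auto)
      also have "\<dots> = real q" by (simp add: \<rho>(1) flip: power_add)
      finally have "\<rho> ^ 6 * sqrt w * real D \<le> real q * real D" by (intro mult_right_mono) auto
      then show ?thesis using q_pos sw by (simp add: field_simps)
    qed
    then have "4 * \<rho> ^ 6 * (real D / real q) * L\<^sup>2 \<le> 4 * (L\<^sup>2 * (real D / sqrt w))"
      using mult_left_mono[of "\<rho> ^ 6 * (real D / real q)" "real D / sqrt w" "4 * L\<^sup>2"] by (simp add: mult_ac)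
    then show ?thesis using T1 a Z(2) by linarith
  qed
  have n2: "norm ?T2 \<le> 256 * ?Z"
  proof -
    have "(real K)\<^sup>2 * (64 * L ^ 4 * real D / sqrt w) \<le> (2 * L)\<^sup>2 * (64 * L ^ 4 * real D / sqrt w)"
      using K(2) L1 sw by (intro mult_right_mono power_mono) auto
    also have "\<dots> = 256 * ?Z" by (simp add: power_mult_distrib flip: power_add)
    finally show ?thesis using T2 by linarith
  qed
  have "norm (2 * ?T0 - ?T1 + ?T2) \<le> 2 * norm ?T0 + norm ?T1 + norm ?T2"
    by (rule order.trans[OF norm_triangle_ineq add_right_mono[OF order.trans[OF norm_triangle_ineq4]]]) (simp add: norm_mult)
  also have "\<dots> \<le> 400 * ?Z"
  proof -
    have "0 \<le> ?Z" using L1 sw by simp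
    then show ?thesis using n0 n1 n2 by linarith
  qed
  finally show ?thesis unfolding split by (simp add: mult.assoc)
qed

end

section \<open>Reduction of the error term\<close>

text \<open>Any \<open>T\<close> above \<open>X\<close> serves as range for \<open>d\<close>, since
  the set of \<open>m\<close> is empty once \<open>d\<^sup>2\<close> exceeds \<open>X\<close>; this
  permits a power of 2 and hence a clean dyadic decomposition.\<close>

lemma sum_moebius_squared:
  fixes X :: real
  assumes "0 \<le> X" "X \<le> real T"
  shows "(\<Sum>n\<in>{n :: nat. 0 < n \<and> real n \<le> X \<and> P n}. real_of_int ((moebius n)\<^sup>2))
    = (\<Sum>d = 1..T. real_of_int (moebius d) * real (card {m \<in> {0<..nat \<lfloor>X / (real d)\<^sup>2\<rfloor>}. P (d\<^sup>2 * m)}))"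
proof -
  let ?S = "{n :: nat. 0 < n \<and> real n \<le> X \<and> P n}"
  have fin: "finite ?S" by (rule finite_sqfree_error_index)
  have "(\<Sum>n\<in>?S. real_of_int ((moebius n)\<^sup>2)) = (\<Sum>n\<in>?S. \<Sum>d = 1..T. if d\<^sup>2 dvd n then real_of_int (moebius d) else 0)"
  proof (rule sum.cong[OF refl])
    fix n assume n: "n \<in> ?S"
    then have "real n \<le> real T" using assms by simp
    then have nT: "n \<le> T" by (simp only: of_nat_le_iff)
    have "d \<in> {1..T}" if "d\<^sup>2 dvd n" for d
    proof -
      have "d\<^sup>2 \<le> n" using that n by (intro dvd_imp_le) auto
      moreover have "d \<noteq> 0" using that n by (auto intro: ccontr)
      moreover have "d \<le> d\<^sup>2" by (simp add: power2_eq_square)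
      ultimately show ?thesis using nT by simp
    qed
    then have "{d. d\<^sup>2 dvd n} = {d \<in> {1..T}. d\<^sup>2 dvd n}" by blast
    then have "real_of_int ((moebius n)\<^sup>2) = (\<Sum>d\<in>{d \<in> {1..T}. d\<^sup>2 dvd n}. real_of_int (moebius d))"
      using moebius_squared_eq_sum[of n] n by simp
    also have "\<dots> = (\<Sum>d = 1..T. if d\<^sup>2 dvd n then real_of_int (moebius d) else 0)"
      by (rule sum.inter_filter) simp
    finally show "real_of_int ((moebius n)\<^sup>2) = (\<Sum>d = 1..T. if d\<^sup>2 dvd n then real_of_int (moebius d) else 0)" .
  qed
  also have "\<dots> = (\<Sum>d = 1..T. \<Sum>n\<in>{n \<in> ?S. d\<^sup>2 dvd n}. real_of_int (moebius d))"
    by (subst sum.swap) (intro sum.cong refl sum.inter_filter[symmetric] fin)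
  also have "\<dots> = (\<Sum>d = 1..T. real_of_int (moebius d) * real (card {m \<in> {0<..nat \<lfloor>X / (real d)\<^sup>2\<rfloor>}. P (d\<^sup>2 * m)}))"
  proof (rule sum.cong[OF refl])
    fix d assume "d \<in> {1..T}"
    then have d: "0 < d" by simp
    have "bij_betw (\<lambda>m. d\<^sup>2 * m) {m \<in> {0<..nat \<lfloor>X / (real d)\<^sup>2\<rfloor>}. P (d\<^sup>2 * m)} {n \<in> ?S. d\<^sup>2 dvd n}"
    proof (rule bij_betwI[where g = "\<lambda>n. n div d\<^sup>2"])
      have le: "m \<le> nat \<lfloor>X / (real d)\<^sup>2\<rfloor> \<longleftrightarrow> real (d\<^sup>2 * m) \<le> X" for m
      proof -
        have "m \<le> nat \<lfloor>X / (real d)\<^sup>2\<rfloor> \<longleftrightarrow> real m \<le> X / (real d)\<^sup>2"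
          using assms(1) by (simp add: le_nat_iff le_floor_iff)
        then show ?thesis using d by (simp add: field_simps)
      qed
      show "(\<lambda>m. d\<^sup>2 * m) \<in> {m \<in> {0<..nat \<lfloor>X / (real d)\<^sup>2\<rfloor>}. P (d\<^sup>2 * m)} \<rightarrow> {n \<in> ?S. d\<^sup>2 dvd n}"
        using d le by auto
      show "(\<lambda>n. n div d\<^sup>2) \<in> {n \<in> ?S. d\<^sup>2 dvd n} \<rightarrow> {m \<in> {0<..nat \<lfloor>X / (real d)\<^sup>2\<rfloor>}. P (d\<^sup>2 * m)}"
        using d le by (auto simp: dvd_imp_le div_greater_zero_iff simp del: of_nat_mult)
    qed (use d in auto)
    then have "card {n \<in> ?S. d\<^sup>2 dvd n} = card {m \<in> {0<..nat \<lfloor>X / (real d)\<^sup>2\<rfloor>}. P (d\<^sup>2 * m)}"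
      by (simp add: bij_betw_same_card)
    then show "(\<Sum>n\<in>{n \<in> ?S. d\<^sup>2 dvd n}. real_of_int (moebius d))
      = real_of_int (moebius d) * real (card {m \<in> {0<..nat \<lfloor>X / (real d)\<^sup>2\<rfloor>}. P (d\<^sup>2 * m)})"
      by (simp add: mult.commute)
  qed
  finally show ?thesis .
qed

context modulus
begin

definition sq_quotient :: "real \<Rightarrow> nat \<Rightarrow> nat" where
  "sq_quotient X d = nat \<lfloor>X / (real d)\<^sup>2\<rfloor>"

text \<open>
  The discrepancy compares with the mean over all residue classes instead of the classes coprime
  to \<open>q\<close>; the effect of this change is the second quantity.
\<close>

definition discrep :: "real \<Rightarrow> int \<Rightarrow> nat \<Rightarrow> real" where
  "discrep X a d = real (class_count a {0<..sq_quotient X d} d) - real (sq_quotient X d) / real q"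

definition mean_gap :: "real \<Rightarrow> nat \<Rightarrow> real" where
  "mean_gap X d = real (card {m \<in> {0<..sq_quotient X d}. \<not> q dvd m}) / (real q - 1) - real (sq_quotient X d) / real q"

lemma sq_quotient_le: "0 \<le> X \<Longrightarrow> real (sq_quotient X d) \<le> X / (real d)\<^sup>2"
  by (simp add: sq_quotient_def)

text \<open>Multiples \<open>d\<close> of \<open>q\<close> drop out because neither the class of a
  unit \<open>a\<close> nor the numbers coprime to \<open>q\<close> contain multiples of
  \<open>q\<close>. For the other \<open>d\<close> the square can be divided out of both
  conditions.\<close>

lemma sqfree_error_eq:
  assumes X: "0 \<le> X" "X \<le> real T" and a: "\<not> int q dvd a"
  shows "sqfree_error X q a
    = (\<Sum>d\<in>{d \<in> {1..T}. \<not> q dvd d}. real_of_int (moebius d) * (discrep X a d - mean_gap X d))"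
proof -
  have c: "card {m \<in> {0<..sq_quotient X d}. [int (d\<^sup>2 * m) = a] (mod int q)}
    = (if q dvd d then 0 else class_count a {0<..sq_quotient X d} d)" for d
  proof (cases "q dvd d")
    case True
    then have "int q dvd int (d\<^sup>2 * m)" for m by (simp add: power2_eq_square)
    then have "{m \<in> {0<..sq_quotient X d}. [int (d\<^sup>2 * m) = a] (mod int q)} = {}"
      using a cong_dvd_iff by blast
    then show ?thesis using True by (simp only: card.empty if_True)
  next
    case False
    then have unit: "\<not> int q dvd int d" by simp
    have "[int (d\<^sup>2 * m) = a] (mod int q) \<longleftrightarrow> [int m = a * isq (int d)] (mod int q)" for m
    proof -
      have inv: "[(int d)\<^sup>2 * isq (int d) = 1] (mod int q)" by (rule isq_inverse[OF unit])
      have e: "[(int d)\<^sup>2 * (a * isq (int d)) = a] (mod int q)"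
        using cong_mult[OF cong_refl[of a] inv] by (simp add: mult_ac)
      have u2: "\<not> int q dvd (int d)\<^sup>2" using unit prime_int_q by (simp add: prime_dvd_power_iff)
      show ?thesis
      proof
        assume "[int (d\<^sup>2 * m) = a] (mod int q)"
        then have "[(int d)\<^sup>2 * int m = (int d)\<^sup>2 * (a * isq (int d))] (mod int q)"
          using e by (simp add: cong_def)
        then show "[int m = a * isq (int d)] (mod int q)" by (rule cong_cancel_unit[OF u2])
      next
        assume "[int m = a * isq (int d)] (mod int q)"
        then have "[(int d)\<^sup>2 * int m = (int d)\<^sup>2 * (a * isq (int d))] (mod int q)"
          by (intro cong_mult cong_refl)
        then show "[int (d\<^sup>2 * m) = a] (mod int q)" using e by (simp add: cong_def)
      qed
    qed
    then show ?thesis using False by (simp add: class_count_def)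
  qed
  have cop: "coprime n q \<longleftrightarrow> \<not> q dvd n" for n
    using prime_q by (metis coprime_commute coprime_absorb_left not_prime_unit prime_imp_coprime)
  have n: "card {m \<in> {0<..sq_quotient X d}. coprime (d\<^sup>2 * m) q}
    = (if q dvd d then 0 else card {m \<in> {0<..sq_quotient X d}. \<not> q dvd m})" for d
    using prime_q by (simp add: cop prime_dvd_mult_iff prime_dvd_power_iff)
  have tot: "real (totient q) = real q - 1"
    using prime_q q_pos by (simp add: totient_prime of_nat_diff)
  have "sqfree_error X q a = (\<Sum>d = 1..T. real_of_int (moebius d)
      * (real (card {m \<in> {0<..sq_quotient X d}. [int (d\<^sup>2 * m) = a] (mod int q)})
        - 1 / (real q - 1) * real (card {m \<in> {0<..sq_quotient X d}. coprime (d\<^sup>2 * m) q})))"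
    unfolding sqfree_error_def tot sq_quotient_def
    by (subst (1 2) sum_moebius_squared[OF X])
       (simp add: sum_subtractf right_diff_distrib sum_distrib_left mult_ac)
  also have "\<dots> = (\<Sum>d = 1..T. if \<not> q dvd d then real_of_int (moebius d) * (discrep X a d - mean_gap X d) else 0)"
    unfolding c n by (intro sum.cong refl) (simp add: discrep_def mean_gap_def)
  also have "\<dots> = (\<Sum>d\<in>{d \<in> {1..T}. \<not> q dvd d}. real_of_int (moebius d) * (discrep X a d - mean_gap X d))"
    by (rule sum.inter_filter[symmetric]) simp
  finally show ?thesis .
qed

section \<open>Pointwise bounds and a count by rows\<close>

lemma card_not_dvd: "card {m \<in> {0<..H}. \<not> q dvd m} = H - H div q"
proof -
  have "{m \<in> {0<..H}. q dvd m} = (\<lambda>k. q * k) ` {0<..H div q}"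
  proof (rule equalityI; rule subsetI)
    fix m assume "m \<in> {m \<in> {0<..H}. q dvd m}"
    then obtain k where k: "m = q * k" "0 < m" "m \<le> H" by (auto elim: dvdE)
    then have "0 < k" "k \<le> H div q" using q_pos by (auto simp: less_eq_div_iff_mult_less_eq mult.commute intro: Nat.gr0I)
    then show "m \<in> (\<lambda>k. q * k) ` {0<..H div q}" using k by auto
  next
    fix m assume "m \<in> (\<lambda>k. q * k) ` {0<..H div q}"
    then show "m \<in> {m \<in> {0<..H}. q dvd m}"
      using q_pos by (auto simp: less_eq_div_iff_mult_less_eq mult.commute)
  qed
  then have "card {m \<in> {0<..H}. q dvd m} = card ((\<lambda>k. q * k) ` {0<..H div q})" by simp
  also have "\<dots> = H div q" using q_pos by (subst card_image) (auto simp: inj_on_def)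
  finally have "card {m \<in> {0<..H}. q dvd m} = H div q" .
  moreover have "{m \<in> {0<..H}. \<not> q dvd m} = {0<..H} - {m \<in> {0<..H}. q dvd m}" by auto
  moreover have "card ({0<..H} - {m \<in> {0<..H}. q dvd m}) = card {0<..H} - card {m \<in> {0<..H}. q dvd m}"
    by (rule card_Diff_subset) auto
  ultimately show ?thesis by (simp only: card_greaterThanAtMost diff_zero)
qed

text \<open>If the quotient is \<open>q * k + r\<close> with \<open>r < q\<close>, the gap is
  exactly \<open>r / (q * (q - 1))\<close>.\<close>

lemma mean_gap_bounds: "0 \<le> mean_gap X d" "mean_gap X d \<le> 1 / real q" "mean_gap X d \<le> real (sq_quotient X d) / (real q * (real q - 1))"
proof -
  let ?H = "sq_quotient X d"
  define k r where "k = ?H div q" and "r = ?H mod q"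
  have H: "real ?H = real q * real k + real r"
    unfolding k_def r_def by (metis mult_div_mod_eq of_nat_add of_nat_mult)
  have r: "real r \<le> real q - 1"
  proof -
    have "r + 1 \<le> q" unfolding r_def using mod_less_divisor[OF q_pos, of ?H] by linarith
    then have "real (r + 1) \<le> real q" by (rule of_nat_mono)
    then show ?thesis by simp
  qed
  have q1: "1 < real q" using q_gt_3 by simp
  have "real (card {m \<in> {0<..?H}. \<not> q dvd m}) = real ?H - real k"
    unfolding card_not_dvd k_def by (simp add: of_nat_diff)
  then have "mean_gap X d = (real q * real k + real r - real k) / (real q - 1) - (real q * real k + real r) / real q"
    unfolding mean_gap_def H by simp
  also have "\<dots> = real r / (real q * (real q - 1))"
    using q1 by (simp add: field_simps)
  finally have e: "mean_gap X d = real r / (real q * (real q - 1))" .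
  show "0 \<le> mean_gap X d" unfolding e using q1 by simp
  have "real r / (real q * (real q - 1)) \<le> (real q - 1) / (real q * (real q - 1))"
    using r q1 by (intro divide_right_mono) auto
  then show "mean_gap X d \<le> 1 / real q" unfolding e using q1 by simp
  have "real r \<le> real ?H" unfolding H by simp
  then show "mean_gap X d \<le> real (sq_quotient X d) / (real q * (real q - 1))"
    unfolding e using q1 by (intro divide_right_mono) auto
qed

lemma abs_discrep_le: "\<bar>discrep X a d\<bar> \<le> 2"
proof -
  let ?H = "sq_quotient X d" and ?x = "a * isq (int d)"
  have "real (class_count a {0<..?H} d) \<le> real ?H / real q + 2"
    using card_class_interval_le[of 0 ?H ?x] by (simp add: class_count_def)
  moreover have "real ?H / real q - 1 \<le> real (class_count a {0<..?H} d)"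
  proof -
    \<comment> \<open>The representative of the class in \<open>1..q\<close>; shifting by one before
      and after the reduction avoids 0, which the counted interval excludes.\<close>
    define y where "y = nat ((?x - 1) mod int q) + 1"
    have y: "1 \<le> y" "y \<le> q" "[int y = ?x] (mod int q)"
    proof -
      have "0 \<le> (?x - 1) mod int q" "(?x - 1) mod int q < int q" using q_pos by simp_all
      then show "1 \<le> y" "y \<le> q" by (auto simp: y_def)
      have "int y = (?x - 1) mod int q + 1" using q_pos by (simp add: y_def)
      then show "[int y = ?x] (mod int q)"
        by (simp add: cong_def mod_add_left_eq)
    qed
    have "(\<lambda>j. y + q * j) ` {..<?H div q} \<subseteq> {m \<in> {0<..?H}. [int m = ?x] (mod int q)}"
    proof (rule image_subsetI)
      fix j assume "j \<in> {..<?H div q}"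
      then have "q * (j + 1) \<le> q * (?H div q)" by (intro mult_left_mono) auto
      also have "\<dots> \<le> ?H" by simp
      finally have "y + q * j \<le> ?H" using y by (simp add: algebra_simps)
      moreover have "[int (y + q * j) = ?x] (mod int q)" using y(3) by (simp add: cong_def)
      ultimately show "y + q * j \<in> {m \<in> {0<..?H}. [int m = ?x] (mod int q)}" using y by simp
    qed
    then have "card ((\<lambda>j. y + q * j) ` {..<?H div q}) \<le> class_count a {0<..?H} d"
      unfolding class_count_def by (intro card_mono) auto
    then have "?H div q \<le> class_count a {0<..?H} d"
      using q_pos by (subst (asm) card_image) (auto simp: inj_on_def)
    then have "real (?H div q) \<le> real (class_count a {0<..?H} d)" by (rule of_nat_mono)
    moreover have "real ?H / real q \<le> real (?H div q) + 1"
    proof -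
      have "?H = q * (?H div q) + ?H mod q" "?H mod q < q" using q_pos by simp_all
      then have "?H \<le> q * (?H div q) + q" by linarith
      then have "real ?H \<le> real (q * (?H div q) + q)" by (simp only: of_nat_le_iff)
      then show ?thesis using q_pos by (simp add: field_simps)
    qed
    ultimately show ?thesis by linarith
  qed
  ultimately show ?thesis unfolding discrep_def by linarith
qed

lemma class_count_mono: "finite J \<Longrightarrow> I \<subseteq> J \<Longrightarrow> class_count a I d \<le> class_count a J d"
  unfolding class_count_def by (intro card_mono) auto

text \<open>Each \<open>m\<close> determines \<open>d\<close> up to sign modulo \<open>q\<close>.
  This uses no exponential sums and is efficient when \<open>M\<close> is small, that is, for very
  large \<open>d\<close>.\<close>

lemma sum_class_count_le_by_rows:
  assumes a: "\<not> int q dvd a"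
  shows "(\<Sum>d\<in>{d \<in> {P<..2 * P}. \<not> q dvd d}. real (class_count a {0<..M} d)) \<le> real M * (2 * (real P / real q + 2))"
proof -
  let ?I = "{d \<in> {P<..2 * P}. \<not> q dvd d}"
  have "(\<Sum>d\<in>?I. real (class_count a {0<..M} d))
    = (\<Sum>d\<in>?I. \<Sum>m\<in>{0<..M}. if [int m = a * isq (int d)] (mod int q) then 1 else 0)"
  proof (rule sum.cong[OF refl])
    fix d
    show "real (class_count a {0<..M} d) = (\<Sum>m\<in>{0<..M}. if [int m = a * isq (int d)] (mod int q) then 1 else 0)"
      using sum.inter_filter[of "{0<..M}" "\<lambda>_. 1 :: real" "\<lambda>m. [int m = a * isq (int d)] (mod int q)"]
      by (simp add: class_count_def)
  qed
  also have "\<dots> = (\<Sum>m\<in>{0<..M}. real (card {d \<in> ?I. [int m = a * isq (int d)] (mod int q)}))"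
  proof -
    have "real (card {d \<in> ?I. [int m = a * isq (int d)] (mod int q)})
      = (\<Sum>d\<in>?I. if [int m = a * isq (int d)] (mod int q) then 1 else 0)" for m
      using sum.inter_filter[of ?I "\<lambda>_. 1 :: real" "\<lambda>d. [int m = a * isq (int d)] (mod int q)"] by simp
    then show ?thesis by (subst sum.swap) simp
  qed
  also have "\<dots> \<le> (\<Sum>m\<in>{0<..M}. 2 * (real P / real q + 2))"
  proof (rule sum_mono)
    fix m
    show "real (card {d \<in> ?I. [int m = a * isq (int d)] (mod int q)}) \<le> 2 * (real P / real q + 2)"
    proof (cases "{d \<in> ?I. [int m = a * isq (int d)] (mod int q)} = {}")
      case True
      then have "real (card {d \<in> ?I. [int m = a * isq (int d)] (mod int q)}) = 0"
        by (simp only: card.empty of_nat_0)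
      also have "0 \<le> 2 * (real P / real q + 2)" by simp
      finally show ?thesis .
    next
      case False
      then obtain d0 where d0: "\<not> q dvd d0" "[int m = a * isq (int d0)] (mod int q)" by auto
      let ?A = "{d \<in> {P<..P + P}. [int d = int d0] (mod int q)}" and ?B = "{d \<in> {P<..P + P}. [int d = - int d0] (mod int q)}"
      have "{d \<in> ?I. [int m = a * isq (int d)] (mod int q)} \<subseteq> ?A \<union> ?B"
      proof
        fix d assume d: "d \<in> {d \<in> ?I. [int m = a * isq (int d)] (mod int q)}"
        then have "[a * isq (int d) = a * isq (int d0)] (mod int q)"
          using d0(2) by (simp add: cong_def)
        then have "[isq (int d) = isq (int d0)] (mod int q)" by (rule cong_cancel_unit[OF a])
        then have "[int d = int d0] (mod int q) \<or> [int d = - int d0] (mod int q)"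
          using d d0 by (intro isq_eqD) auto
        then show "d \<in> ?A \<union> ?B" using d by auto
      qed
      then have "card {d \<in> ?I. [int m = a * isq (int d)] (mod int q)} \<le> card (?A \<union> ?B)"
        by (intro card_mono) auto
      also have "\<dots> \<le> card ?A + card ?B" by (rule card_Un_le)
      finally have "real (card {d \<in> ?I. [int m = a * isq (int d)] (mod int q)}) \<le> real (card ?A) + real (card ?B)"
        by (simp only: of_nat_le_iff flip: of_nat_add)
      also have "\<dots> \<le> (real P / real q + 2) + (real P / real q + 2)"
        by (intro add_mono card_class_interval_le)
      also have "\<dots> = 2 * (real P / real q + 2)" by simp
      finally show ?thesis .
    qed
  qed
  finally show ?thesis by simp
qed

end

section \<open>Dyadic blocks\<close>

lemma sum_consecutive_intervals:
  fixes h :: "nat \<Rightarrow> 'a :: comm_monoid_add" and e :: "nat \<Rightarrow> nat"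
  assumes "mono e"
  shows "(\<Sum>d\<in>{e 0<..e R}. h d) = (\<Sum>t<R. \<Sum>d\<in>{e t<..e (Suc t)}. h d)"
proof (induction R)
  case (Suc R)
  have "e 0 \<le> e R" "e R \<le> e (Suc R)" using assms by (simp_all add: monoD)
  then have "{e 0<..e (Suc R)} = {e 0<..e R} \<union> {e R<..e (Suc R)}" by auto
  then have "(\<Sum>d\<in>{e 0<..e (Suc R)}. h d) = (\<Sum>d\<in>{e 0<..e R}. h d) + (\<Sum>d\<in>{e R<..e (Suc R)}. h d)"
    by (simp only:) (rule sum.union_disjoint, auto)
  then show ?case using Suc by simp
qed simp

locale sieve_range = modulus +
  fixes X D0 \<rho> w z L :: real and a :: int
  assumes q_eq: "real q = \<rho> ^ 8" and \<rho>_ge: "4 \<le> \<rho>" and w_ge: "1 \<le> w" and w_le: "w ^ 5 \<le> \<rho>"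
    and z_ge: "1 \<le> z" and z_le: "z ^ 4 \<le> w" and q_le_X: "real q \<le> X"
    and D0_pos: "0 < D0" and D0_sq: "D0\<^sup>2 = X / real q" and D0_ge: "\<rho> ^ 6 * w ^ 50 * z \<le> D0"
    and L_ge: "2 + ln X \<le> L" and a: "\<not> int q dvd a"
begin

text \<open>
  Here \<open>\<rho>\<close> stands for \<open>q\<^bsup>1/8\<^esup>\<close>, so that all exponents below are integers, \<open>sqrt w\<close> is the saving in
  the Moebius sums, and \<open>z\<close> determines the window \<open>D0 / z < d \<le> D0 * z\<close> in which it is needed.
\<close>

lemma X_pos: "0 < X" using q_le_X q_pos by (metis of_nat_0_less_iff order_less_le_trans)

lemma L_ge_LQ: "LQ \<le> L" and L_ge_1: "1 \<le> L"
proof -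
  have "ln (real q) \<le> ln X" using q_le_X q_pos by simp
  then show "LQ \<le> L" using L_ge by (simp add: LQ_def)
  then show "1 \<le> L" using LQ_ge_1 by simp
qed

lemma \<rho>6: "real q powr (3 / 4) = \<rho> ^ 6"
  using \<rho>_ge by (simp add: q_eq powr_realpow[symmetric] powr_powr flip: powr_numeral)

lemma z_powers: "z ^ k \<le> w" if "k \<le> 4"
  using power_increasing[OF that z_ge] z_le by simp

lemma w_le_\<rho>: "w \<le> \<rho>"
  using self_le_power[OF w_ge, of 5] w_le by simp

text \<open>Even the lower end of the window lies in the range of
  \<open>norm_sum_moebius_kern_le\<close>.\<close>

lemma D0_over_z_ge: "\<rho> ^ 6 * w ^ 50 \<le> D0 / z" "\<rho> ^ 6 \<le> D0 / z" "1 \<le> D0 / z"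
proof -
  show 1: "\<rho> ^ 6 * w ^ 50 \<le> D0 / z" using D0_ge z_ge by (simp add: field_simps)
  have "\<rho> ^ 6 * 1 \<le> \<rho> ^ 6 * w ^ 50" using \<rho>_ge w_ge by (intro mult_left_mono one_le_power) auto
  then show 2: "\<rho> ^ 6 \<le> D0 / z" using 1 by simp
  have "1 \<le> \<rho> ^ 6" using \<rho>_ge by (intro one_le_power) auto
  then show "1 \<le> D0 / z" using 2 by simp
qed

definition block :: "nat \<Rightarrow> nat set" where
  "block P = {d \<in> {P<..2 * P}. \<not> q dvd d}"

definition block_sum :: "nat \<Rightarrow> real" where
  "block_sum P = (\<Sum>d\<in>block P. real_of_int (moebius d) * discrep X a d)"

lemma finite_block [simp]: "finite (block P)" by (simp add: block_def)

lemma card_block_le: "real (card (block P)) \<le> real P"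
proof -
  have "card (block P) \<le> card {P<..2 * P}" unfolding block_def by (intro card_mono) auto
  then show ?thesis by simp
qed

lemma sq_quotient_antimono: "0 < c \<Longrightarrow> c \<le> d \<Longrightarrow> sq_quotient X d \<le> sq_quotient X c"
  unfolding sq_quotient_def using X_pos by (intro nat_mono floor_mono divide_left_mono power_mono mult_pos_pos) auto

lemma abs_moebius_real_le: "\<bar>real_of_int (moebius d)\<bar> \<le> 1"
  using abs_moebius_le[of d] by (simp flip: of_int_abs)

lemma abs_sum_moebius_le: "\<bar>\<Sum>d\<in>I. real_of_int (moebius d) * f d\<bar> \<le> (\<Sum>d\<in>I. \<bar>f d\<bar>)"
proof -
  have "\<bar>\<Sum>d\<in>I. real_of_int (moebius d) * f d\<bar> \<le> (\<Sum>d\<in>I. \<bar>real_of_int (moebius d) * f d\<bar>)" by (rule sum_abs)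
  also have "\<dots> \<le> (\<Sum>d\<in>I. 1 * \<bar>f d\<bar>)"
    unfolding abs_mult by (intro sum_mono mult_right_mono abs_moebius_real_le) auto
  finally show ?thesis by simp
qed

text \<open>Up to \<open>D0\<close> the bound \<open>1 / q\<close> for the gap is used, beyond
  \<open>D0\<close> its decay like \<open>1 / P\<^sup>2\<close>. Either way the block gives at most
  \<open>D0 / (q - 1)\<close>, and \<open>z \<le> q - 1\<close>.\<close>

lemma abs_sum_moebius_mean_gap_le: "\<bar>\<Sum>d\<in>block P. real_of_int (moebius d) * mean_gap X d\<bar> \<le> D0 / z" if P: "1 \<le> P"
proof -
  have zq: "z \<le> real q - 1"
  proof -
    have "z \<le> \<rho>" using z_powers[of 1] w_le_\<rho> by simp
    moreover have "\<rho> * 4 \<le> \<rho> * \<rho> ^ 7"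
    proof (intro mult_left_mono)
      have "\<rho> \<le> \<rho> ^ 7" using \<rho>_ge by (intro self_le_power) auto
      then show "4 \<le> \<rho> ^ 7" using \<rho>_ge by simp
    qed (use \<rho>_ge in auto)
    moreover have "\<rho> * \<rho> ^ 7 = real q" by (simp add: q_eq flip: power_Suc)
    ultimately show ?thesis using \<rho>_ge by linarith
  qed
  have "\<bar>\<Sum>d\<in>block P. real_of_int (moebius d) * mean_gap X d\<bar> \<le> (\<Sum>d\<in>block P. \<bar>mean_gap X d\<bar>)"
    by (rule abs_sum_moebius_le)
  also have "\<dots> \<le> (\<Sum>d\<in>block P. min (1 / real q) (X / (real P)\<^sup>2 / (real q * (real q - 1))))"
  proof (rule sum_mono)
    fix d assume d: "d \<in> block P"
    have "mean_gap X d \<le> real (sq_quotient X d) / (real q * (real q - 1))" by (rule mean_gap_bounds)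
    also have "\<dots> \<le> X / (real P)\<^sup>2 / (real q * (real q - 1))"
    proof (intro divide_right_mono)
      have "real (sq_quotient X d) \<le> X / (real d)\<^sup>2" using X_pos by (intro sq_quotient_le) simp
      also have "\<dots> \<le> X / (real P)\<^sup>2" using d P X_pos
        by (intro divide_left_mono power_mono mult_pos_pos) (auto simp: block_def)
      finally show "real (sq_quotient X d) \<le> X / (real P)\<^sup>2" .
    qed (use zq z_ge in auto)
    finally show "\<bar>mean_gap X d\<bar> \<le> min (1 / real q) (X / (real P)\<^sup>2 / (real q * (real q - 1)))"
      using mean_gap_bounds[of X d] by simp
  qed
  also have "\<dots> \<le> real P * min (1 / real q) (X / (real P)\<^sup>2 / (real q * (real q - 1)))"
    using card_block_le X_pos zq z_ge by (simp add: mult_right_mono)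
  also have "\<dots> \<le> D0 / z"
  proof (cases "real P \<le> D0")
    case True
    have "real P * min (1 / real q) (X / (real P)\<^sup>2 / (real q * (real q - 1))) \<le> real P * (1 / real q)"
      by (intro mult_left_mono) auto
    also have "\<dots> \<le> D0 * (1 / z)"
      using True zq z_ge D0_pos by (intro mult_mono divide_left_mono) auto
    finally show ?thesis by simp
  next
    case False
    have "real P * min (1 / real q) (X / (real P)\<^sup>2 / (real q * (real q - 1)))
      \<le> real P * (X / (real P)\<^sup>2 / (real q * (real q - 1)))"
      by (intro mult_left_mono) auto
    also have "\<dots> = (X / real q) / (real P * (real q - 1))"
      using P by (simp add: power2_eq_square)
    also have "\<dots> = D0\<^sup>2 / (real P * (real q - 1))" unfolding D0_sq ..
    also have "\<dots> \<le> D0\<^sup>2 / (D0 * z)"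
      using False zq z_ge D0_pos by (intro divide_left_mono mult_mono mult_pos_pos) auto
    also have "\<dots> = D0 / z" using D0_pos by (simp add: power2_eq_square)
    finally show ?thesis .
  qed
  finally show ?thesis .
qed

section \<open>Small, large and middle blocks\<close>

lemma block_small:
  assumes "real P \<le> D0 / z"
  shows "\<bar>block_sum P\<bar> \<le> 2 * (D0 / z)"
proof -
  have "\<bar>block_sum P\<bar> \<le> (\<Sum>d\<in>block P. \<bar>discrep X a d\<bar>)"
    unfolding block_sum_def by (rule abs_sum_moebius_le)
  also have "\<dots> \<le> (\<Sum>d\<in>block P. 2)" by (intro sum_mono abs_discrep_le)
  also have "\<dots> \<le> 2 * real P" using card_block_le[of P] by simp
  finally show ?thesis using assms by simp
qed

text \<open>Beyond \<open>D0 * z\<close> the expected number of solutions, at most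
  \<open>D0\<^sup>2 / P\<close>, is already below \<open>D0 / z\<close>. So no cancellation in
  \<open>moebius\<close> is called for, only an upper bound for the number of solutions.\<close>

lemma block_large:
  assumes P: "D0 * z < real P"
  shows "\<bar>block_sum P\<bar> \<le> 18 * L\<^sup>2 * (D0 / z)"
proof -
  define M where "M = nat \<lfloor>X / (real P)\<^sup>2\<rfloor>"
  have P0: "0 < real P" using P D0_pos z_ge by (smt (verit) mult_nonneg_nonneg)
  have DP: "D0\<^sup>2 / real P \<le> D0 / z"
  proof -
    have "D0\<^sup>2 / real P \<le> D0\<^sup>2 / (D0 * z)"
      using P D0_pos z_ge P0 by (intro divide_left_mono mult_pos_pos) auto
    then show ?thesis using D0_pos by (simp add: power2_eq_square)
  qed
  have M: "real M \<le> X / (real P)\<^sup>2" unfolding M_def using X_pos by simp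
  have X_eq: "X = real q * D0\<^sup>2" unfolding D0_sq using q_pos by simp
  have PM: "real P * real M / real q \<le> D0\<^sup>2 / real P"
  proof -
    have "real P * real M / real q \<le> real P * (X / (real P)\<^sup>2) / real q"
      using M by (intro divide_right_mono mult_left_mono) auto
    then show ?thesis using P0 q_pos by (simp add: X_eq power2_eq_square)
  qed
  have sqM: "sq_quotient X d \<le> M" if "d \<in> block P" for d
    using that P0 sq_quotient_antimono[of P d] by (simp add: block_def M_def sq_quotient_def)
  have "\<bar>block_sum P\<bar> \<le> (\<Sum>d\<in>block P. \<bar>discrep X a d\<bar>)"
    unfolding block_sum_def by (rule abs_sum_moebius_le)
  also have "\<dots> \<le> (\<Sum>d\<in>block P. real (class_count a {0<..M} d) + real M / real q)"
  proof (rule sum_mono)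
    fix d assume d: "d \<in> block P"
    have "real (class_count a {0<..sq_quotient X d} d) \<le> real (class_count a {0<..M} d)"
      using sqM[OF d] by (intro of_nat_mono class_count_mono) auto
    moreover have "real (sq_quotient X d) / real q \<le> real M / real q"
      using sqM[OF d] by (intro divide_right_mono) auto
    moreover have "0 \<le> real (sq_quotient X d) / real q" by simp
    ultimately show "\<bar>discrep X a d\<bar> \<le> real (class_count a {0<..M} d) + real M / real q"
      unfolding discrep_def by linarith
  qed
  also have "\<dots> = (\<Sum>d\<in>block P. real (class_count a {0<..M} d)) + real (card (block P)) * (real M / real q)"
    by (simp add: sum.distrib)
  also have "\<dots> \<le> (\<Sum>d\<in>block P. real (class_count a {0<..M} d)) + D0 / z"
  proof -
    have "real (card (block P)) * (real M / real q) \<le> real P * (real M / real q)"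
      by (intro mult_right_mono card_block_le) auto
    then show ?thesis using PM DP by simp
  qed
  finally have main: "\<bar>block_sum P\<bar>
    \<le> (\<Sum>d\<in>block P. real (class_count a {0<..M} d)) + D0 / z" .
  have L2: "1 * (D0 / z) \<le> L\<^sup>2 * (D0 / z)"
    using L_ge_1 D0_over_z_ge by (intro mult_right_mono one_le_power) auto
  have arith: "E \<le> 18 * W" if "S \<le> u * zz + v * W" "E \<le> S + zz" "1 * zz \<le> W" "0 \<le> zz" "0 \<le> u" "u + v \<le> 17"
    for E S u v W zz :: real
  proof -
    have "u * zz \<le> u * W" using that by (intro mult_left_mono) auto
    then have "E \<le> (u + v + 1) * W" using that by (simp add: algebra_simps)
    also have "\<dots> \<le> 18 * W" using that by (intro mult_right_mono) auto
    finally show ?thesis .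
  qed
  \<comment> \<open>The box count is used as long as its error stays below \<open>D0 / z\<close>,
    which needs \<open>P\<close> not too large compared with \<open>q\<close>. Past the dividing
    line \<open>M\<close> itself is at most \<open>D0 / z\<close>, and counting by rows takes
    over.\<close>
  show ?thesis
  proof (cases "(real P)\<^sup>2 \<le> real q * D0 * z")
    case True
    have "(real P)\<^sup>2 \<le> (\<rho>\<^sup>2 * (D0 / z))\<^sup>2"
    proof -
      have "\<rho> ^ 4 * z ^ 3 \<le> \<rho> ^ 6 * w ^ 50"
      proof (rule mult_mono)
        have "z ^ 3 \<le> w" by (rule z_powers) simp
        also have "\<dots> \<le> w ^ 50" using w_ge by (intro self_le_power) auto
        finally show "z ^ 3 \<le> w ^ 50" .
        show "\<rho> ^ 4 \<le> \<rho> ^ 6" using \<rho>_ge by (intro power_increasing) auto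
      qed (use \<rho>_ge z_ge in auto)
      then have "\<rho> ^ 4 * z ^ 3 \<le> D0 / z" using D0_over_z_ge(1) by linarith
      then have "\<rho> ^ 4 * z ^ 3 \<le> D0" using z_ge D0_pos by (smt (verit) divide_le_eq_1 divide_right_mono div_by_1 frac_le)
      then have "(\<rho> ^ 4 * D0) * (\<rho> ^ 4 * z ^ 3) \<le> (\<rho> ^ 4 * D0) * D0"
        using D0_pos by (intro mult_left_mono) auto
      then have "real q * D0 * z * z\<^sup>2 \<le> \<rho> ^ 4 * D0\<^sup>2"
        by (simp add: q_eq power_numeral_reduce mult_ac)
      then have "real q * D0 * z \<le> \<rho> ^ 4 * D0\<^sup>2 / z\<^sup>2" using z_ge by (simp add: field_simps)
      also have "\<dots> = (\<rho>\<^sup>2 * (D0 / z))\<^sup>2" by (simp add: power_mult_distrib power_divide flip: power_mult)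
      finally show ?thesis using True by linarith
    qed
    then have "real P \<le> \<rho>\<^sup>2 * (D0 / z)" by (rule power2_le_imp_le) (use D0_pos z_ge in auto)
    then have P\<rho>: "\<rho> ^ 6 * (real P / real q) \<le> D0 / z"
    proof -
      assume P2: "real P \<le> \<rho>\<^sup>2 * (D0 / z)"
      have "\<rho> ^ 6 * real P \<le> \<rho> ^ 6 * (\<rho>\<^sup>2 * (D0 / z))" using P2 \<rho>_ge by (intro mult_left_mono) auto
      also have "\<dots> = real q * (D0 / z)" by (simp add: q_eq flip: power_add mult.assoc)
      finally show ?thesis using q_pos by (simp add: field_simps)
    qed
    have "(\<Sum>d\<in>block P. real (class_count a {0<..M} d))
      \<le> real (2 * P - P) * real (M - 0) / real q + 8 * \<rho> ^ 6 * LQ * (LQ + real (2 * P - P) / real q)"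
      using sum_class_count_le[OF a, where s = P and t = "2 * P" and u = 0 and v = M] unfolding block_def \<rho>6 .
    also have "\<dots> = real P * real M / real q + (8 * LQ * LQ * \<rho> ^ 6 + 8 * LQ * (\<rho> ^ 6 * (real P / real q)))"
      by (simp add: algebra_simps)
    also have "\<dots> \<le> D0 / z + (8 * L * L * (D0 / z) + 8 * L * L * (D0 / z))"
    proof (intro add_mono)
      show "real P * real M / real q \<le> D0 / z" using PM DP by linarith
      show "8 * LQ * LQ * \<rho> ^ 6 \<le> 8 * L * L * (D0 / z)"
        using L_ge_LQ LQ_ge_1 D0_over_z_ge \<rho>_ge by (intro mult_mono) auto
      have "8 * LQ * (\<rho> ^ 6 * (real P / real q)) \<le> 8 * L * (D0 / z)"
        using L_ge_LQ LQ_ge_1 P\<rho> \<rho>_ge by (intro mult_mono) auto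
      also have "\<dots> \<le> 8 * L * L * (D0 / z)"
        using L_ge_1 D0_over_z_ge by (intro mult_right_mono) auto
      finally show "8 * LQ * (\<rho> ^ 6 * (real P / real q)) \<le> 8 * L * L * (D0 / z)" .
    qed
    also have "\<dots> = 1 * (D0 / z) + 16 * (L\<^sup>2 * (D0 / z))" by (simp add: power2_eq_square)
    finally have "\<bar>block_sum P\<bar> \<le> 18 * (L\<^sup>2 * (D0 / z))"
      by (rule arith[OF _ main L2]) (use D0_over_z_ge in auto)
    then show ?thesis by (simp only: mult.assoc)
  next
    case False
    have "(\<Sum>d\<in>block P. real (class_count a {0<..M} d)) \<le> real M * (2 * (real P / real q + 2))"
      unfolding block_def by (rule sum_class_count_le_by_rows[OF a])
    also have "\<dots> = 2 * (real P * real M / real q) + 4 * real M" by (simp add: algebra_simps)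
    also have "\<dots> \<le> 2 * (D0 / z) + 4 * (D0 / z)"
    proof (intro add_mono mult_left_mono)
      show "real P * real M / real q \<le> D0 / z" using PM DP by linarith
      have "X / (real P)\<^sup>2 \<le> X / (real q * D0 * z)"
        using False X_pos D0_pos z_ge q_pos P0 by (intro divide_left_mono mult_pos_pos) auto
      also have "\<dots> = D0 / z" using D0_pos q_pos by (simp add: X_eq power2_eq_square)
      finally show "real M \<le> D0 / z" using M by linarith
    qed auto
    also have "\<dots> = 6 * (D0 / z) + 0 * (L\<^sup>2 * (D0 / z))" by simp
    finally have "\<bar>block_sum P\<bar> \<le> 18 * (L\<^sup>2 * (D0 / z))"
      by (rule arith[OF _ main L2]) (use D0_over_z_ge in auto)
    then show ?thesis by (simp only: mult.assoc)
  qed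
qed

text \<open>The one range where the cancellation in \<open>moebius\<close> enters. The cutoff
  \<open>X / d\<^sup>2\<close> depends on \<open>d\<close>; it is frozen on short subintervals, and
  the solutions in the strips between consecutive cutoffs are merely counted.\<close>

lemma block_middle:
  assumes P: "D0 / z < real P" "real P \<le> D0 * z"
  shows "\<bar>block_sum P\<bar> \<le> 6452 * L ^ 7 * (D0 / z)"
proof -
  \<comment> \<open>The area of all strips over \<open>q\<close> is of order
    \<open>(X / q) / (P * R)\<close>, so this number of pieces brings it down to
    \<open>D0 / z\<close>. The Moebius sums over the pieces add up to \<open>R * P / sqrt w\<close>,
    about \<open>D0 * z / sqrt w\<close>, and \<open>z\<^sup>2 \<le> sqrt w\<close>.\<close>
  define R where "R = nat \<lceil>D0 * z / real P\<rceil>"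
  define e where "e t = P + (P * t) div R" for t
  have P1: "1 < real P" using P(1) D0_over_z_ge(3) by linarith
  have Dz: "0 < D0 / z" "D0 / z \<le> D0 * z"
  proof -
    show "0 < D0 / z" using D0_pos z_ge by simp
    have "1 \<le> z * z" using z_ge by (metis mult_mono' mult_1 zero_le_one)
    then have "D0 * 1 \<le> D0 * (z * z)" using D0_pos by (intro mult_left_mono) auto
    then show "D0 / z \<le> D0 * z" using z_ge by (simp add: field_simps)
  qed
  have ratio: "1 \<le> D0 * z / real P" using P P1 by (simp add: field_simps)
  have R: "D0 * z / real P \<le> real R" "real R \<le> 2 * (D0 * z / real P)" "1 \<le> R"
  proof -
    show 1: "D0 * z / real P \<le> real R" unfolding R_def by (rule real_nat_ceiling_ge)
    have "real R \<le> D0 * z / real P + 1" unfolding R_def using ratio by linarith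
    then show "real R \<le> 2 * (D0 * z / real P)" using ratio by linarith
    have "0 < real R" using 1 ratio by linarith
    then show "1 \<le> R" by simp
  qed
  have RP: "real R * real P \<le> 2 * (D0 * z)" using R(2) P1 by (simp add: field_simps)
  have z2: "z\<^sup>2 \<le> w" "z ^ 3 \<le> w" "z\<^sup>2 \<le> sqrt w"
  proof -
    show "z\<^sup>2 \<le> w" "z ^ 3 \<le> w" by (rule z_powers; simp)+
    have "(z\<^sup>2)\<^sup>2 \<le> (sqrt w)\<^sup>2" using z_le w_ge by (simp flip: power_mult)
    then show "z\<^sup>2 \<le> sqrt w" by (rule power2_le_imp_le) (use w_ge in simp)
  qed
  have Rz: "real R \<le> 2 * z\<^sup>2"
  proof -
    have "D0 * z / real P \<le> D0 * z / (D0 / z)"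
      using P Dz D0_pos z_ge P1 by (intro divide_left_mono) (auto intro!: mult_pos_pos)
    also have "\<dots> = z\<^sup>2" using D0_pos z_ge by (simp add: power2_eq_square)
    finally show ?thesis using R(2) by linarith
  qed
  have R_le_P: "real R \<le> real P"
  proof -
    have "2 * z\<^sup>2 \<le> \<rho> ^ 6 * w ^ 50"
    proof (rule mult_mono)
      have "\<rho> \<le> \<rho> ^ 6" using \<rho>_ge by (intro self_le_power) auto
      then show "2 \<le> \<rho> ^ 6" using \<rho>_ge by simp
      have "w \<le> w ^ 50" using w_ge by (intro self_le_power) auto
      then show "z\<^sup>2 \<le> w ^ 50" using z2 by linarith
    qed (use \<rho>_ge in auto)
    then show ?thesis using Rz D0_over_z_ge(1) P(1) by linarith
  qed
  have X_eq: "X = real q * D0\<^sup>2" unfolding D0_sq using q_pos by simp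
  have mono_e: "mono e" unfolding e_def by (intro monoI add_left_mono div_le_mono mult_left_mono) auto
  have e0: "e 0 = P" and eR: "e R = 2 * P" using R(3) by (simp_all add: e_def)
  have e_ge: "P \<le> e t" for t by (simp add: e_def)
  have e_le: "e t \<le> 2 * P" if "t \<le> R" for t using monoD[OF mono_e that] by (simp add: eR)
  have e_step: "real (e (Suc t) - e t) \<le> 2 * (real P / real R)" for t
  proof -
    have "real ((P * Suc t) div R) \<le> real (P * Suc t) / real R" by (rule of_nat_div_le_of_nat)
    moreover have "real (P * t) / real R \<le> real ((P * t) div R) + 1"
    proof -
      have "P * t = R * ((P * t) div R) + (P * t) mod R" "(P * t) mod R < R" using R(3) by simp_all
      then have "P * t \<le> R * ((P * t) div R) + R" by linarith
      then have "real (P * t) \<le> real (R * ((P * t) div R) + R)" by (simp only: of_nat_le_iff)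
      then show ?thesis using R(3) by (simp add: field_simps)
    qed
    moreover have "real (P * Suc t) / real R = real (P * t) / real R + real P / real R"
      by (simp add: algebra_simps add_divide_distrib)
    moreover have "1 \<le> real P / real R" using R_le_P R(3) by simp
    moreover have "real (e (Suc t) - e t) = real (e (Suc t)) - real (e t)"
      using monoD[OF mono_e, of t "Suc t"] by (simp add: of_nat_diff)
    ultimately show ?thesis unfolding e_def of_nat_add by linarith
  qed
  define J where "J t = {d \<in> {e t<..e (Suc t)}. \<not> q dvd d}" for t
  \<comment> \<open>The cutoff at the left end of the piece: the set of \<open>m\<close> no longer
    depends on \<open>d\<close>, and the true cutoff lies between \<open>H (Suc t)\<close> and
    \<open>H t\<close>.\<close>
  define H where "H t = sq_quotient X (e t)" for t
  define F where "F t d = real (class_count a {0<..H t} d) - real (H t) / real q" for t d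
  have fJ [simp]: "finite (J t)" for t by (simp add: J_def)
  have HH: "real (H t - H (Suc t)) \<le> 4 * (X / ((real P)\<^sup>2 * real R)) + 1" for t
  proof -
    define u v where "u = real (e t)" and "v = real (e (Suc t))"
    have uv: "real P \<le> u" "u \<le> v" "v - u \<le> 2 * (real P / real R)"
      using e_ge[of t] monoD[OF mono_e, of t "Suc t"] e_step[of t] by (auto simp: u_def v_def of_nat_diff)
    have pos: "0 < u" "0 < v" using uv P1 by auto
    have "X / u\<^sup>2 - X / v\<^sup>2 = X * ((v - u) * (u + v)) / (u\<^sup>2 * v\<^sup>2)"
      using pos by (simp add: field_simps power2_eq_square)
    also have "\<dots> \<le> X * ((2 * (real P / real R)) * (2 * v)) / (u\<^sup>2 * v\<^sup>2)"
      using uv pos X_pos by (intro divide_right_mono mult_left_mono mult_mono) auto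
    also have "\<dots> = 4 * X * real P / real R * (1 / (u\<^sup>2 * v))"
      using pos by (simp add: power2_eq_square mult.assoc)
    also have "\<dots> \<le> 4 * X * real P / real R * (1 / ((real P)\<^sup>2 * real P))"
      using uv pos X_pos P1 by (intro mult_left_mono divide_left_mono mult_mono power_mono mult_pos_pos) auto
    also have "\<dots> = 4 * (X / ((real P)\<^sup>2 * real R))" using P1 by simp
    finally have "X / u\<^sup>2 - X / v\<^sup>2 \<le> 4 * (X / ((real P)\<^sup>2 * real R))" .
    moreover have "real (H t) \<le> X / u\<^sup>2" unfolding H_def u_def using X_pos by (intro sq_quotient_le) simp
    moreover have "X / v\<^sup>2 \<le> real (H (Suc t)) + 1"
      unfolding H_def sq_quotient_def v_def using X_pos by linarith
    moreover have "H (Suc t) \<le> H t"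
      unfolding H_def using monoD[OF mono_e, of t "Suc t"] e_ge[of t] P1 by (intro sq_quotient_antimono) auto
    ultimately show ?thesis by (simp add: of_nat_diff)
  qed
  have split_discrep: "\<bar>discrep X a d - F t d\<bar> \<le> real (class_count a {H (Suc t)<..H t} d) + real (H t - H (Suc t)) / real q"
    if d: "d \<in> J t" for t d
  proof -
    have ed: "e t < d" "d \<le> e (Suc t)" "0 < e t" using d e_ge[of t] P1 by (auto simp: J_def)
    have c1: "sq_quotient X d \<le> H t" "H (Suc t) \<le> sq_quotient X d"
      unfolding H_def using ed by (auto intro!: sq_quotient_antimono)
    have "class_count a {0<..H t} d = class_count a {0<..sq_quotient X d} d + class_count a {sq_quotient X d<..H t} d"
    proof -
      let ?A = "{m \<in> {0<..sq_quotient X d}. [int m = a * isq (int d)] (mod int q)}"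
      let ?B = "{m \<in> {sq_quotient X d<..H t}. [int m = a * isq (int d)] (mod int q)}"
      have "{m \<in> {0<..H t}. [int m = a * isq (int d)] (mod int q)} = ?A \<union> ?B"
        using c1(1) by auto
      then have "card {m \<in> {0<..H t}. [int m = a * isq (int d)] (mod int q)} = card (?A \<union> ?B)"
        by (rule arg_cong)
      also have "card (?A \<union> ?B) = card ?A + card ?B"
        by (rule card_Un_disjoint) auto
      finally show ?thesis unfolding class_count_def .
    qed
    moreover have "class_count a {sq_quotient X d<..H t} d \<le> class_count a {H (Suc t)<..H t} d"
      using c1 by (intro class_count_mono) auto
    moreover have "real (H t) - real (sq_quotient X d) \<le> real (H t - H (Suc t))" using c1 by (simp add: of_nat_diff)
    then have "(real (H t) - real (sq_quotient X d)) / real q \<le> real (H t - H (Suc t)) / real q"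
      by (intro divide_right_mono) auto
    moreover have "0 \<le> (real (H t) - real (sq_quotient X d)) / real q" using c1 by simp
    moreover have "(real (H t) - real (sq_quotient X d)) / real q = real (H t) / real q - real (sq_quotient X d) / real q"
      by (rule diff_divide_distrib)
    ultimately show ?thesis unfolding discrep_def F_def by linarith
  qed
  define Z where "Z = D0 / z"
  \<comment> \<open>The area of a strip over \<open>q\<close>, twice because both the class counts
    and their means change, plus the error of \<open>sum_class_count_le\<close>.\<close>
  define Err where "Err = 2 * (2 * (real P / real R)) * (4 * (X / ((real P)\<^sup>2 * real R)) + 1) / real q
      + 8 * \<rho> ^ 6 * LQ * (LQ + 2 * (real P / real R) / real q)"
  have err: "(\<Sum>d\<in>J t. real (class_count a {H (Suc t)<..H t} d) + real (H t - H (Suc t)) / real q)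
    \<le> Err" for t
  proof -
    let ?E = "real (e (Suc t) - e t)" and ?h = "real (H t - H (Suc t))"
    have "(\<Sum>d\<in>J t. real (class_count a {H (Suc t)<..H t} d) + ?h / real q)
      = (\<Sum>d\<in>J t. real (class_count a {H (Suc t)<..H t} d)) + real (card (J t)) * (?h / real q)"
      by (simp add: sum.distrib)
    also have "\<dots> \<le> (?E * ?h / real q + 8 * \<rho> ^ 6 * LQ * (LQ + ?E / real q)) + ?E * (?h / real q)"
    proof (intro add_mono mult_right_mono)
      show "(\<Sum>d\<in>J t. real (class_count a {H (Suc t)<..H t} d)) \<le> ?E * ?h / real q + 8 * \<rho> ^ 6 * LQ * (LQ + ?E / real q)"
        using sum_class_count_le[OF a, where s = "e t" and t = "e (Suc t)" and u = "H (Suc t)" and v = "H t"] unfolding J_def \<rho>6 .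
      have "card (J t) \<le> card {e t<..e (Suc t)}" unfolding J_def by (intro card_mono) auto
      then show "real (card (J t)) \<le> ?E" by simp
    qed auto
    also have "\<dots> = 2 * ?E * ?h / real q + 8 * \<rho> ^ 6 * LQ * (LQ + ?E / real q)" by simp
    also have "\<dots> \<le> Err"
      unfolding Err_def using e_step[of t] HH[of t] \<rho>_ge LQ_ge_1
      by (intro add_mono divide_right_mono mult_mono add_left_mono mult_left_mono) auto
    finally show ?thesis .
  qed
  have Z1: "1 \<le> Z" "\<rho> ^ 6 * w ^ 50 \<le> Z" "\<rho> ^ 6 \<le> Z" using D0_over_z_ge by (simp_all add: Z_def)
  have Zz: "D0 * z = Z * z\<^sup>2" using z_ge by (simp add: Z_def power2_eq_square)
  have L2: "1 \<le> L\<^sup>2" "L \<le> L\<^sup>2" using L_ge_1 by (simp_all add: self_le_power)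
  have err_total: "real R * Err \<le> 52 * (L\<^sup>2 * Z)"
  proof -
    have Rpos: "0 < real R" using R(3) by simp
    have eq: "real R * Err
      = 16 * ((X / real q) / (real P * real R)) + 4 * (real P / real q) + 8 * (real R * \<rho> ^ 6 * (LQ * LQ)) + 16 * (LQ * (\<rho> ^ 6 * (real P / real q)))"
      unfolding Err_def using Rpos P1 q_pos by (simp add: field_simps power2_eq_square)
    have f1: "(X / real q) / (real P * real R) \<le> Z"
    proof -
      have "D0 * z \<le> real P * real R" using R(1) P1 by (simp add: field_simps)
      then have "D0\<^sup>2 / (real P * real R) \<le> D0\<^sup>2 / (D0 * z)"
        using D0_pos z_ge Rpos P1 by (intro divide_left_mono mult_pos_pos) auto
      then show ?thesis using D0_pos by (simp add: Z_def power2_eq_square flip: D0_sq)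
    qed
    have f2: "Z \<le> L\<^sup>2 * Z" using L2 Z1 by simp
    have P\<rho>: "real P / real q \<le> \<rho> ^ 6 * (real P / real q)"
    proof -
      have "1 \<le> \<rho> ^ 6" using \<rho>_ge by (intro one_le_power) auto
      then have "1 * (real P / real q) \<le> \<rho> ^ 6 * (real P / real q)" by (intro mult_right_mono) auto
      then show ?thesis by simp
    qed
    have P6: "\<rho> ^ 6 * (real P / real q) \<le> Z"
    proof -
      have "z\<^sup>2 \<le> \<rho>\<^sup>2"
        using z2(1) w_le_\<rho> self_le_power[of \<rho> 2] \<rho>_ge by simp
      then have "Z * z\<^sup>2 \<le> Z * \<rho>\<^sup>2" using Z1 by (intro mult_left_mono) auto
      then have "real P \<le> \<rho>\<^sup>2 * Z" using P(2) unfolding Zz by (simp add: mult.commute)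
      then have "\<rho> ^ 6 * real P \<le> \<rho> ^ 6 * (\<rho>\<^sup>2 * Z)" using \<rho>_ge by (intro mult_left_mono) auto
      also have "\<dots> = real q * Z" by (simp add: q_eq flip: power_add mult.assoc)
      finally show ?thesis using q_pos by (simp add: field_simps)
    qed
    have f3: "real R * \<rho> ^ 6 * (LQ * LQ) \<le> 2 * Z * (L * L)"
    proof (rule mult_mono)
      show "LQ * LQ \<le> L * L" using L_ge_LQ LQ_ge_1 by (intro mult_mono) auto
      have "real R * \<rho> ^ 6 \<le> 2 * (w ^ 50) * \<rho> ^ 6"
      proof (intro mult_right_mono)
        have "w \<le> w ^ 50" using w_ge by (intro self_le_power) auto
        then show "real R \<le> 2 * w ^ 50" using Rz z2(1) by linarith
      qed (use \<rho>_ge in auto)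
      then show "real R * \<rho> ^ 6 \<le> 2 * Z" using Z1(2) by (simp add: mult.commute)
    qed (use L_ge_LQ LQ_ge_1 Z1 L_ge_1 in auto)
    have f4: "LQ * (\<rho> ^ 6 * (real P / real q)) \<le> L\<^sup>2 * Z"
      using L_ge_LQ L2 LQ_ge_1 \<rho>_ge by (intro mult_mono[OF _ P6]) auto
    have "2 * Z * (L * L) = 2 * (L\<^sup>2 * Z)" by (simp add: power2_eq_square)
    then show ?thesis using f1 f2 f3 f4 P\<rho> P6 unfolding eq by linarith
  qed
  have partial: "norm (\<Sum>d = 1..D. of_int (moebius d) * kern c (int d)) \<le> 800 * L ^ 6 * real P / sqrt w"
    if c: "\<not> int q dvd c" and D: "P \<le> D" "D \<le> 2 * P" for c D
  proof -
    have "\<rho> ^ 6 * w ^ 50 \<le> real D" using P(1) D(1) D0_over_z_ge(1) of_nat_mono[OF D(1), where 'a = real] by linarith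
    moreover have "1 + ln (real D) \<le> L"
    proof -
      have "real D \<le> 2 * sqrt X"
      proof -
        have "(D0 * z)\<^sup>2 \<le> X"
        proof -
          have "z\<^sup>2 \<le> real q"
          proof -
            have "\<rho> \<le> \<rho> ^ 8" using \<rho>_ge by (intro self_le_power) auto
            then show ?thesis using z2(1) w_le_\<rho> q_eq by linarith
          qed
          then have "D0\<^sup>2 * z\<^sup>2 \<le> D0\<^sup>2 * real q" by (intro mult_left_mono) auto
          then show ?thesis by (simp add: X_eq power_mult_distrib mult.commute)
        qed
        then have "D0 * z \<le> sqrt X" by (rule real_le_rsqrt)
        moreover have "real D \<le> 2 * real P" using D(2) of_nat_mono[OF D(2), where 'a = real] by simp
        ultimately show ?thesis using P(2) by linarith
      qed
      moreover have "0 < real D" using D(1) P1 by simp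
      ultimately have "ln (real D) \<le> ln (2 * sqrt X)" using X_pos by simp
      also have "\<dots> = ln 2 + ln X / 2" using X_pos by (simp add: ln_mult ln_sqrt)
      also have "\<dots> \<le> 1 + ln X"
      proof -
        have "3 < real q" using q_gt_3 by simp
        then have "0 \<le> ln X" using q_le_X by (intro ln_ge_zero) linarith
        then show ?thesis using ln_2_less_1 by linarith
      qed
      finally show ?thesis using L_ge by linarith
    qed
    ultimately have "norm (\<Sum>d = 1..D. of_int (moebius d) * kern c (int d)) \<le> 400 * L ^ 6 * real D / sqrt w"
      by (intro norm_sum_moebius_kern_le[OF c q_eq w_ge w_le \<rho>_ge] L_ge_LQ)
    also have "\<dots> \<le> 400 * L ^ 6 * (2 * real P) / sqrt w"
    proof (intro divide_right_mono mult_left_mono)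
      show "real D \<le> 2 * real P" using D(2) of_nat_mono[OF D(2), where 'a = real] by simp
    qed (use L_ge_1 w_ge in auto)
    finally show ?thesis by simp
  qed
  have smooth: "\<bar>\<Sum>d\<in>J t. real_of_int (moebius d) * F t d\<bar> \<le> 3200 * L ^ 7 * real P / sqrt w" if t: "t < R" for t
  proof -
    let ?I = "{e t<..e (Suc t)}" and ?T = "1600 * L ^ 6 * real P / sqrt w"
    have "norm (\<Sum>d\<in>?I. of_int (moebius d) * kern c (int d)) \<le> ?T" if c: "\<not> int q dvd c" for c
    proof -
      have "e t \<le> e (Suc t)" using mono_e by (simp add: monoD)
      then have "{1..e (Suc t)} = {1..e t} \<union> ?I" by auto
      then have "(\<Sum>d = 1..e (Suc t). of_int (moebius d) * kern c (int d))
        = (\<Sum>d = 1..e t. of_int (moebius d) * kern c (int d)) + (\<Sum>d\<in>?I. of_int (moebius d) * kern c (int d))"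
        by (simp only:) (rule sum.union_disjoint, auto)
      then have "(\<Sum>d\<in>?I. of_int (moebius d) * kern c (int d))
        = (\<Sum>d = 1..e (Suc t). of_int (moebius d) * kern c (int d)) - (\<Sum>d = 1..e t. of_int (moebius d) * kern c (int d))"
        by simp
      then have "norm (\<Sum>d\<in>?I. of_int (moebius d) * kern c (int d))
        \<le> norm (\<Sum>d = 1..e (Suc t). of_int (moebius d) * kern c (int d)) + norm (\<Sum>d = 1..e t. of_int (moebius d) * kern c (int d))"
        by (simp only: norm_triangle_ineq4)
      moreover have "norm (\<Sum>d = 1..e (Suc t). of_int (moebius d) * kern c (int d)) \<le> 800 * L ^ 6 * real P / sqrt w"
        using t by (intro partial[OF c] e_ge e_le) simp
      moreover have "norm (\<Sum>d = 1..e t. of_int (moebius d) * kern c (int d)) \<le> 800 * L ^ 6 * real P / sqrt w"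
        using t by (intro partial[OF c] e_ge e_le) simp
      ultimately show ?thesis by linarith
    qed
    then have "norm (\<Sum>d\<in>{d \<in> ?I. \<not> q dvd d}. of_int (moebius d) * (of_nat (class_count a {0<..H t} d) - of_nat (H t - 0) / of_nat q :: complex)) \<le> 2 * LQ * ?T"
      by (intro norm_sum_class_count_le a) auto
    moreover have "(\<Sum>d\<in>{d \<in> ?I. \<not> q dvd d}. of_int (moebius d) * (of_nat (class_count a {0<..H t} d) - of_nat (H t - 0) / of_nat q :: complex))
      = of_real (\<Sum>d\<in>J t. real_of_int (moebius d) * F t d)"
      by (simp add: J_def F_def)
    ultimately have "\<bar>\<Sum>d\<in>J t. real_of_int (moebius d) * F t d\<bar> \<le> 2 * LQ * ?T"
      by (simp only: norm_of_real)
    also have "\<dots> \<le> 2 * L * ?T" using L_ge_LQ L_ge_1 w_ge by (intro mult_right_mono) auto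
    also have "\<dots> = 3200 * L ^ 7 * real P / sqrt w" by (simp add: power_numeral_reduce)
    finally show ?thesis .
  qed
  have "block_sum P
    = (\<Sum>d\<in>{e 0<..e R}. if \<not> q dvd d then real_of_int (moebius d) * discrep X a d else 0)"
    unfolding block_sum_def block_def e0 eR by (rule sum.inter_filter) simp
  also have "\<dots> = (\<Sum>t<R. \<Sum>d\<in>{e t<..e (Suc t)}. if \<not> q dvd d then real_of_int (moebius d) * discrep X a d else 0)"
    by (rule sum_consecutive_intervals[OF mono_e])
  also have "\<dots> = (\<Sum>t<R. \<Sum>d\<in>J t. real_of_int (moebius d) * discrep X a d)"
    unfolding J_def by (intro sum.cong refl sum.inter_filter[symmetric]) simp
  finally have "\<bar>block_sum P\<bar>
    = \<bar>\<Sum>t<R. \<Sum>d\<in>J t. real_of_int (moebius d) * discrep X a d\<bar>" by simp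
  also have "\<dots> \<le> (\<Sum>t<R. \<bar>\<Sum>d\<in>J t. real_of_int (moebius d) * discrep X a d\<bar>)" by (rule sum_abs)
  also have "\<dots> \<le> (\<Sum>t<R. 3200 * L ^ 7 * real P / sqrt w
      + Err)"
  proof (rule sum_mono)
    fix t assume t: "t \<in> {..<R}"
    have "(\<Sum>d\<in>J t. real_of_int (moebius d) * discrep X a d)
      = (\<Sum>d\<in>J t. real_of_int (moebius d) * F t d) + (\<Sum>d\<in>J t. real_of_int (moebius d) * (discrep X a d - F t d))"
      by (simp add: algebra_simps flip: sum.distrib)
    moreover have "\<bar>\<Sum>d\<in>J t. real_of_int (moebius d) * (discrep X a d - F t d)\<bar> \<le> (\<Sum>d\<in>J t. \<bar>discrep X a d - F t d\<bar>)"
      by (rule abs_sum_moebius_le)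
    moreover have "(\<Sum>d\<in>J t. \<bar>discrep X a d - F t d\<bar>)
      \<le> (\<Sum>d\<in>J t. real (class_count a {H (Suc t)<..H t} d) + real (H t - H (Suc t)) / real q)"
      by (intro sum_mono split_discrep)
    ultimately show "\<bar>\<Sum>d\<in>J t. real_of_int (moebius d) * discrep X a d\<bar> \<le> 3200 * L ^ 7 * real P / sqrt w
      + Err"
      using smooth[of t] err[of t] t by auto
  qed
  also have "\<dots> = real R * (3200 * L ^ 7 * real P / sqrt w)
      + real R * Err"
    by (simp only: sum_constant card_lessThan distrib_left)
  also have "\<dots> \<le> 6400 * (L ^ 7 * Z) + 52 * (L\<^sup>2 * Z)"
  proof (rule add_mono[OF _ err_total])
    have "real R * (3200 * L ^ 7 * real P / sqrt w) = 3200 * L ^ 7 * ((real R * real P) / sqrt w)" by simp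
    also have "\<dots> \<le> 3200 * L ^ 7 * (2 * Z)"
    proof (intro mult_left_mono)
      have "real R * real P \<le> 2 * (Z * z\<^sup>2)" using RP unfolding Zz .
      also have "\<dots> \<le> 2 * (Z * sqrt w)" using z2 Z1 by (intro mult_left_mono) auto
      finally show "(real R * real P) / sqrt w \<le> 2 * Z" using w_ge by (simp add: field_simps)
    qed (use L_ge_1 in auto)
    finally show "real R * (3200 * L ^ 7 * real P / sqrt w) \<le> 6400 * (L ^ 7 * Z)" by simp
  qed
  also have "\<dots> \<le> 6400 * (L ^ 7 * Z) + 52 * (L ^ 7 * Z)"
    using L_ge_1 Z1 by (intro add_left_mono mult_left_mono mult_right_mono power_increasing) auto
  also have "\<dots> = 6452 * L ^ 7 * (D0 / z)" by (simp add: Z_def)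
  finally show ?thesis .
qed

text \<open>At most \<open>2 * L\<close> dyadic blocks occur, and the worst of them loses
  \<open>L ^ 7\<close>.\<close>

lemma abs_sqfree_error_le: "\<bar>sqfree_error X q a\<bar> \<le> 20000 * L ^ 8 * (D0 / z)"
proof -
  define K where "K = nat \<lceil>log 2 X\<rceil>"
  define B where "B = 6453 * L ^ 7 * (D0 / z)"
  have X1: "1 < X" using q_le_X q_gt_3 by simp
  have K: "X \<le> real (2 ^ K)" "real K \<le> 2 * L"
  proof -
    have "X = 2 powr log 2 X" using X1 by simp
    also have "\<dots> \<le> 2 powr real K"
      by (intro powr_mono) (auto simp: K_def real_nat_ceiling_ge)
    finally show "X \<le> real (2 ^ K)" by (simp add: powr_realpow)
    have "0 \<le> log 2 X" using X1 by simp
    then have "real K \<le> log 2 X + 1" unfolding K_def by linarith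
    moreover have "log 2 X \<le> 2 * ln X"
    proof -
      have "ln X * 1 \<le> ln X * (2 * ln 2)"
        using X1 ln2_ge_two_thirds by (intro mult_left_mono) auto
      then show ?thesis by (simp add: log_def field_simps)
    qed
    ultimately show "real K \<le> 2 * L" using L_ge by linarith
  qed
  let ?g = "\<lambda>d. real_of_int (moebius d) * (discrep X a d - mean_gap X d)"
  have L7: "1 \<le> L ^ 7" "L\<^sup>2 \<le> L ^ 7" using L_ge_1 by (auto intro: power_increasing one_le_power)
  have Z0: "1 \<le> D0 / z" by (rule D0_over_z_ge)
  have blk: "\<bar>\<Sum>d\<in>block P. ?g d\<bar> \<le> B" if P: "1 \<le> P" for P
  proof -
    have "(\<Sum>d\<in>block P. ?g d) = block_sum P - (\<Sum>d\<in>block P. real_of_int (moebius d) * mean_gap X d)"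
      unfolding block_sum_def by (simp add: right_diff_distrib sum_subtractf)
    moreover have "\<bar>block_sum P\<bar> \<le> 6452 * L ^ 7 * (D0 / z)"
    proof -
      consider "real P \<le> D0 / z" | "D0 * z < real P" | "D0 / z < real P" "real P \<le> D0 * z" by linarith
      then show ?thesis
      proof cases
        case 1
        have "2 * (D0 / z) \<le> 6452 * L ^ 7 * (D0 / z)" using L7 Z0 by (intro mult_right_mono) auto
        then show ?thesis using block_small[OF 1] by linarith
      next
        case 2
        have "18 * L\<^sup>2 * (D0 / z) \<le> 6452 * L ^ 7 * (D0 / z)" using L7 Z0 by (intro mult_right_mono mult_mono) auto
        then show ?thesis using block_large[OF 2] by linarith
      qed (rule block_middle)
    qed
    moreover have "\<bar>\<Sum>d\<in>block P. real_of_int (moebius d) * mean_gap X d\<bar> \<le> L ^ 7 * (D0 / z)"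
    proof -
      have "1 * (D0 / z) \<le> L ^ 7 * (D0 / z)" using L7 Z0 by (intro mult_right_mono) auto
      then show ?thesis using abs_sum_moebius_mean_gap_le[OF P] by linarith
    qed
    ultimately show ?thesis unfolding B_def by linarith
  qed
  have "sqfree_error X q a = (\<Sum>d\<in>{d \<in> {1..2 ^ K}. \<not> q dvd d}. ?g d)"
    using K X1 by (intro sqfree_error_eq a) auto
  also have "\<dots> = (\<Sum>d = 1..2 ^ K. if \<not> q dvd d then ?g d else 0)"
    by (rule sum.inter_filter) simp
  \<comment> \<open>The half-open dyadic blocks start above 1, so \<open>d = 1\<close> is split off
    and bounded trivially.\<close>
  also have "{1..2 ^ K} = insert 1 {1<..2 ^ K :: nat}" by auto
  also have "(\<Sum>d\<in>insert 1 {1<..2 ^ K}. if \<not> q dvd d then ?g d else 0)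
    = ?g 1 + (\<Sum>d\<in>{1<..2 ^ K}. if \<not> q dvd d then ?g d else 0)"
    using q_gt_3 by simp
  also have "(\<Sum>d\<in>{1<..2 ^ K}. if \<not> q dvd d then ?g d else 0) = (\<Sum>i<K. \<Sum>d\<in>block (2 ^ i). ?g d)"
    unfolding sum_dyadic block_def by (intro sum.cong refl sum.inter_filter[symmetric]) simp
  finally have "\<bar>sqfree_error X q a\<bar> \<le> \<bar>?g 1\<bar> + \<bar>\<Sum>i<K. \<Sum>d\<in>block (2 ^ i). ?g d\<bar>" by simp
  moreover have "\<bar>?g 1\<bar> \<le> 3"
  proof -
    have "\<bar>?g 1\<bar> \<le> 1 * \<bar>discrep X a 1 - mean_gap X 1\<bar>"
      unfolding abs_mult by (intro mult_right_mono abs_moebius_real_le) auto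
    moreover have "1 / real q \<le> 1" using q_gt_3 by simp
    then have "\<bar>discrep X a 1 - mean_gap X 1\<bar> \<le> 3"
      using abs_discrep_le[of X a 1] mean_gap_bounds(1,2)[of X 1] by linarith
    ultimately show ?thesis by simp
  qed
  moreover have "\<bar>\<Sum>i<K. \<Sum>d\<in>block (2 ^ i). ?g d\<bar> \<le> 2 * L * B"
  proof -
    have "\<bar>\<Sum>i<K. \<Sum>d\<in>block (2 ^ i). ?g d\<bar> \<le> (\<Sum>i<K. \<bar>\<Sum>d\<in>block (2 ^ i). ?g d\<bar>)" by (rule sum_abs)
    also have "\<dots> \<le> (\<Sum>i<K. B)" by (intro sum_mono blk) simp
    also have "\<dots> = real K * B" by simp
    also have "\<dots> \<le> 2 * L * B"
    proof (rule mult_right_mono[OF K(2)])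
      have "0 \<le> D0 / z" using Z0 by linarith
      then show "0 \<le> B" unfolding B_def using L_ge_1 by (intro mult_nonneg_nonneg) auto
    qed
    finally show ?thesis .
  qed
  moreover have "2 * L * B = 12906 * (L ^ 8 * (D0 / z))" unfolding B_def by (simp add: power_numeral_reduce)
  moreover have "1 * 1 \<le> L ^ 8 * (D0 / z)" using L_ge_1 Z0 by (intro mult_mono one_le_power) auto
  ultimately have "\<bar>sqfree_error X q a\<bar> \<le> 20000 * (L ^ 8 * (D0 / z))" by linarith
  then show ?thesis by (simp add: mult.assoc)
qed

end

section \<open>The bound\<close>

lemma abs_sqfree_error_trivial:
  assumes "0 \<le> X"
  shows "\<bar>sqfree_error X q a\<bar> \<le> 2 * X"
proof -
  have bound: "0 \<le> (\<Sum>n\<in>{n :: nat. 0 < n \<and> real n \<le> X \<and> P n}. real_of_int ((moebius n)\<^sup>2))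
    \<and> (\<Sum>n\<in>{n :: nat. 0 < n \<and> real n \<le> X \<and> P n}. real_of_int ((moebius n)\<^sup>2)) \<le> X" for P
  proof
    let ?S = "{n :: nat. 0 < n \<and> real n \<le> X \<and> P n}"
    show "0 \<le> (\<Sum>n\<in>?S. real_of_int ((moebius n)\<^sup>2))" by (intro sum_nonneg) simp
    have "(\<Sum>n\<in>?S. real_of_int ((moebius n)\<^sup>2)) \<le> (\<Sum>n\<in>?S. 1)"
      by (intro sum_mono) (simp add: moebius_squared)
    also have "\<dots> = real (card ?S)" by simp
    also have "\<dots> \<le> real (card {1..nat \<lfloor>X\<rfloor>})"
      by (intro of_nat_mono card_mono) (auto simp: le_nat_floor)
    also have "\<dots> \<le> X" using assms by simp
    finally show "(\<Sum>n\<in>?S. real_of_int ((moebius n)\<^sup>2)) \<le> X" .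
  qed
  \<comment> \<open>If \<open>totient q\<close> is 0, the quotient is 0 by the convention for
    division.\<close>
  have t: "1 / real (totient q) \<le> 1"
    by (cases "totient q") (auto simp: divide_le_eq)
  define S1 S2 where "S1 = (\<Sum>n\<in>{n :: nat. 0 < n \<and> real n \<le> X \<and> [int n = a] (mod int q)}. real_of_int ((moebius n)\<^sup>2))"
    and "S2 = (\<Sum>n\<in>{n :: nat. 0 < n \<and> real n \<le> X \<and> coprime n q}. real_of_int ((moebius n)\<^sup>2))"
  have S: "0 \<le> S1" "S1 \<le> X" "0 \<le> S2" "S2 \<le> X" unfolding S1_def S2_def
    using bound[of "\<lambda>n. [int n = a] (mod int q)"] bound[of "\<lambda>n. coprime n q"] by simp_all
  have "0 \<le> 1 / real (totient q) * S2" using S by simp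
  moreover have "1 / real (totient q) * S2 \<le> 1 * X"
    using t S by (intro mult_mono) auto
  ultimately have "\<bar>S1 - 1 / real (totient q) * S2\<bar> \<le> 2 * X" using S by linarith
  then show ?thesis unfolding sqfree_error_def S1_def S2_def .
qed

lemma ln_le_powr:
  fixes x \<eta> :: real
  assumes "1 \<le> x" "0 < \<eta>"
  shows "2 + ln x \<le> (2 + 1 / \<eta>) * x powr \<eta>"
proof -
  have "\<eta> * ln x = ln (x powr \<eta>)" using assms by (simp add: ln_powr)
  also have "\<dots> \<le> x powr \<eta>" using assms ln_le_minus_one[of "x powr \<eta>"] by simp
  finally have "ln x \<le> 1 / \<eta> * x powr \<eta>" using assms by (simp add: field_simps)
  moreover have "1 \<le> x powr \<eta>" using assms by (intro ge_one_powr_ge_zero) auto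
  ultimately show ?thesis by (simp add: algebra_simps)
qed

theorem corollary2:
  fixes \<epsilon> :: real
  assumes "0 < \<epsilon>" and "\<epsilon> < 1 / 5"
  shows "\<exists>C::real. C > 0 \<and>
    (\<forall>(X::real) (q::nat) (a::int).
       X > 1 \<longrightarrow> prime q \<longrightarrow> X powr \<epsilon> \<le> real q \<longrightarrow> real q \<le> X powr (2 / 5 - \<epsilon>) \<longrightarrow>
       coprime a (int q) \<longrightarrow>
       \<bar>sqfree_error X q a\<bar> \<le> C * (X / real q) powr (1 / 2 - delta_exp \<epsilon>))"
proof -
  \<comment> \<open>Chosen so that \<open>8 * \<eta> + \<epsilon> / 192 = \<epsilon> / 180\<close>:
    the loss of \<open>L ^ 8\<close> and the factor \<open>(X / q) powr \<delta>\<close> together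
    use up the saving \<open>z\<close> below.\<close>
  define \<eta> where "\<eta> = \<epsilon> / 23040"
  \<comment> \<open>The second summand covers \<open>q < 65536\<close>, where the lower bound for
    \<open>q\<close> keeps \<open>X\<close> below
    \<open>65536 powr (1 / \<epsilon>)\<close>.\<close>
  define C where "C = 20000 * (2 + 1 / \<eta>) ^ 8 + 2 * 65536 powr (1 / \<epsilon>)"
  define \<delta> where "\<delta> = delta_exp \<epsilon>"
  have \<eta>: "0 < \<eta>" using assms by (simp add: \<eta>_def)
  have \<delta>: "0 \<le> \<delta>" "\<delta> \<le> \<epsilon> / (192 * (1 - \<epsilon>))" "\<delta> \<le> 1 / 2"
  proof -
    show "0 \<le> \<delta>" using assms by (simp add: \<delta>_def delta_exp_def)
    show 1: "\<delta> \<le> \<epsilon> / (192 * (1 - \<epsilon>))" by (simp add: \<delta>_def delta_exp_def)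
    have "\<epsilon> / (192 * (1 - \<epsilon>)) \<le> 1 / 2" using assms by (simp add: field_simps)
    with 1 show "\<delta> \<le> 1 / 2" by (rule order.trans)
  qed
  have "\<bar>sqfree_error X q a\<bar> \<le> C * (X / real q) powr (1 / 2 - \<delta>)"
    if X: "X > 1" and q: "prime q" "X powr \<epsilon> \<le> real q" "real q \<le> X powr (2 / 5 - \<epsilon>)" and a: "coprime a (int q)"
    for X :: real and q :: nat and a :: int
  proof -
    have q0: "0 < real q" using q(1) prime_gt_0_nat by simp
    have qX: "real q \<le> X"
    proof -
      have "X powr (2 / 5 - \<epsilon>) \<le> X powr 1" using X assms by (intro powr_mono) auto
      then show ?thesis using q(3) X by simp
    qed
    have Xq: "1 \<le> X / real q" using qX q0 by simp
    have Xq_powr: "1 \<le> (X / real q) powr (1 / 2 - \<delta>)"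
      using Xq \<delta>(3) by (intro ge_one_powr_ge_zero) auto
    show ?thesis
    \<comment> \<open>The number is \<open>4 ^ 8\<close>, which gives
      \<open>4 \<le> \<rho>\<close>.\<close>
    proof (cases "65536 \<le> real q")
      case False
      have "X = (X powr \<epsilon>) powr (1 / \<epsilon>)" using X assms by (simp add: powr_powr)
      also have "\<dots> \<le> 65536 powr (1 / \<epsilon>)" using False q(2) assms X by (intro powr_mono2) auto
      finally have "2 * X \<le> C * 1" using \<eta> by (simp add: C_def add_increasing)
      also have "\<dots> \<le> C * (X / real q) powr (1 / 2 - \<delta>)"
        using Xq_powr \<eta> by (intro mult_left_mono) (auto simp: C_def)
      finally show ?thesis using abs_sqfree_error_trivial[of X q a] X by linarith
    next
      case True
      \<comment> \<open>The exponents satisfy 5/41 < 1/8 for \<open>w ^ 5 \<le> \<rho>\<close>,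
        4/180 < 1/41 for \<open>z ^ 4 \<le> w\<close>, and 50/41 + 1/180 < 5/4 for the lower bound
        on \<open>D0\<close>. The last margin comes from (2/5 - \<epsilon>) times 5/4, which is 1/2
        - 5/4 \<epsilon>.\<close>
      define \<rho> w z D0 L where "\<rho> = real q powr (1 / 8)" and "w = X powr (\<epsilon> / 41)"
        and "z = X powr (\<epsilon> / 180)" and "D0 = sqrt (X / real q)" and "L = 2 + ln X"
      have X_powr_power: "(X powr s) ^ k = X powr (real k * s)" for s k
        using X by (simp add: powr_realpow[symmetric] powr_powr mult.commute)
      have \<rho>8: "\<rho> ^ 8 = real q" using q0 by (simp add: \<rho>_def powr_realpow[symmetric] powr_powr flip: powr_numeral)
      have \<rho>6: "\<rho> ^ 6 = real q powr (3 / 4)" using q0 by (simp add: \<rho>_def powr_realpow[symmetric] powr_powr flip: powr_numeral)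
      have "sieve_range q X D0 \<rho> w z L a"
      proof
        show "prime q" by (rule q(1))
        show "3 < q" using True by simp
        show "real q = \<rho> ^ 8" using \<rho>8 by simp
        show "4 \<le> \<rho>"
        proof (rule ccontr)
          assume "\<not> 4 \<le> \<rho>"
          then have "\<rho> ^ 8 < 4 ^ 8" by (intro power_strict_mono) (auto simp: \<rho>_def)
          then show False using True \<rho>8 by simp
        qed
        show "1 \<le> w" "1 \<le> z" unfolding w_def z_def using X assms by (intro ge_one_powr_ge_zero; simp)+
        have "w ^ 5 = X powr (5 * (\<epsilon> / 41))" unfolding w_def X_powr_power by simp
        also have "\<dots> \<le> X powr (\<epsilon> * (1 / 8))" using X assms by (intro powr_mono) auto
        also have "\<dots> = (X powr \<epsilon>) powr (1 / 8)" by (simp add: powr_powr)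
        also have "\<dots> \<le> \<rho>" unfolding \<rho>_def using q(2) by (intro powr_mono2) auto
        finally show "w ^ 5 \<le> \<rho>" .
        have "z ^ 4 = X powr (4 * (\<epsilon> / 180))" unfolding z_def X_powr_power by simp
        also have "\<dots> \<le> w" unfolding w_def using X assms by (intro powr_mono) auto
        finally show "z ^ 4 \<le> w" .
        show "real q \<le> X" by (rule qX)
        show "0 < D0" using X q0 by (simp add: D0_def)
        show "D0\<^sup>2 = X / real q" using X q0 by (simp add: D0_def)
        have "\<rho> ^ 6 * w ^ 50 * z * sqrt (real q) = (real q powr (3 / 4) * real q powr (1 / 2)) * (w ^ 50 * z)"
          using q0 by (simp add: \<rho>6 powr_half_sqrt)
        also have "\<dots> = real q powr (5 / 4) * (w ^ 50 * z)" by (simp flip: powr_add)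
        also have "\<dots> \<le> (X powr (2 / 5 - \<epsilon>)) powr (5 / 4) * (w ^ 50 * z)"
          using q(3) q0 by (intro mult_right_mono powr_mono2) (auto simp: w_def z_def)
        also have "\<dots> = X powr ((2 / 5 - \<epsilon>) * (5 / 4) + (50 * (\<epsilon> / 41) + \<epsilon> / 180))"
          unfolding w_def z_def X_powr_power by (simp only: powr_powr powr_add of_nat_numeral)
        also have "\<dots> \<le> X powr (1 / 2)" using X assms by (intro powr_mono) (auto simp: field_simps)
        also have "\<dots> = sqrt X" using X by (simp add: powr_half_sqrt)
        finally show "\<rho> ^ 6 * w ^ 50 * z \<le> D0" using q0 by (simp add: D0_def real_sqrt_divide field_simps)
        show "2 + ln X \<le> L" by (simp add: L_def)
        show "\<not> int q dvd a" using a q(1) by (metis coprime_absorb_left coprime_commute not_prime_unit prime_nat_int_transfer)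
      qed
      then have main: "\<bar>sqfree_error X q a\<bar> \<le> 20000 * L ^ 8 * (D0 / z)"
        by (rule sieve_range.abs_sqfree_error_le)
      have L8: "L ^ 8 \<le> (2 + 1 / \<eta>) ^ 8 * X powr (8 * \<eta>)"
      proof -
        have "L ^ 8 \<le> ((2 + 1 / \<eta>) * X powr \<eta>) ^ 8"
          unfolding L_def using X \<eta> by (intro power_mono ln_le_powr) auto
        then show ?thesis by (simp add: power_mult_distrib X_powr_power)
      qed
      \<comment> \<open>The lower bound for \<open>q\<close> makes \<open>X / q\<close> at most
        \<open>X powr (1 - \<epsilon>)\<close>, which the factor \<open>1 - \<epsilon>\<close> in
        the denominator of \<open>delta_exp\<close> compensates.\<close>
      have saving: "(X / real q) powr \<delta> \<le> X powr (\<epsilon> / 192)"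
      proof -
        have "X / real q \<le> X / X powr \<epsilon>" using q(2) X q0 by (intro divide_left_mono) auto
        also have "\<dots> = X powr (1 - \<epsilon>)" using X by (simp add: powr_diff)
        finally have "(X / real q) powr \<delta> \<le> (X powr (1 - \<epsilon>)) powr \<delta>"
          using X q0 \<delta>(1) by (intro powr_mono2) auto
        also have "\<dots> = X powr ((1 - \<epsilon>) * \<delta>)" by (simp add: powr_powr)
        also have "\<dots> \<le> X powr (\<epsilon> / 192)"
        proof (rule powr_mono)
          have "(1 - \<epsilon>) * \<delta> \<le> (1 - \<epsilon>) * (\<epsilon> / (192 * (1 - \<epsilon>)))" using \<delta>(2) assms by (intro mult_left_mono) auto
          also have "\<dots> = \<epsilon> / 192"
          proof -
            have "1 - \<epsilon> \<noteq> 0" using assms by simp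
            then show ?thesis by (simp only: times_divide_eq_right mult.commute[of 192]) (erule nonzero_mult_divide_mult_cancel_left)
          qed
          finally show "(1 - \<epsilon>) * \<delta> \<le> \<epsilon> / 192" .
        qed (use X in simp)
        finally show ?thesis .
      qed
      let ?Y = "(X / real q) powr (1 / 2 - \<delta>)"
      have D0: "D0 = ?Y * (X / real q) powr \<delta>"
        using Xq by (simp add: D0_def powr_half_sqrt flip: powr_add)
      have "L ^ 8 * (D0 / z) \<le> ((2 + 1 / \<eta>) ^ 8 * X powr (8 * \<eta>)) * (?Y * X powr (\<epsilon> / 192) / z)"
        unfolding D0 using L8 saving \<eta> X
        by (intro mult_mono divide_right_mono mult_left_mono) (auto simp: z_def)
      also have "\<dots> = (2 + 1 / \<eta>) ^ 8 * ?Y * (X powr (8 * \<eta> + \<epsilon> / 192) / z)"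
        by (simp add: powr_add)
      also have "X powr (8 * \<eta> + \<epsilon> / 192) = z" by (simp add: z_def \<eta>_def)
      also have "(2 + 1 / \<eta>) ^ 8 * ?Y * (z / z) = (2 + 1 / \<eta>) ^ 8 * ?Y" using X by (simp add: z_def)
      finally have "20000 * (L ^ 8 * (D0 / z)) \<le> 20000 * ((2 + 1 / \<eta>) ^ 8 * ?Y)" by simp
      also have "\<dots> \<le> C * ?Y" unfolding C_def by (simp add: distrib_right)
      finally show ?thesis using main by (simp only: mult.assoc)
    qed
  qed
  moreover have "C > 0"
  proof -
    have "0 < 2 + 1 / \<eta>" using \<eta> by (intro add_pos_pos) auto
    then have "0 < (2 + 1 / \<eta>) ^ 8" by (rule zero_less_power)
    then show ?thesis unfolding C_def by (simp add: add_pos_nonneg)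
  qed
  ultimately show ?thesis unfolding \<delta>_def by blast
qed

end
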